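(* Let $G$ be a (commutative, one-dimensional) formal group over a ring $R$, let $\mathcal I$ be the ideal sheaf of the identity, let $G_\circ$ be the associated formal group over $R_1=\operatorname{colim}_k\mathcal I^{-k}\mathcal O_G$, and let $p\ge1$. If $s$ is a $\Theta^{p+1}$-structure on $\mathcal I=\mathcal I_G(0)$, then the section $s^\sharp$ of $\Theta^p\mathcal I_{G_\circ}(0)$ is a $\Theta^p$-structure. Thus $s\mapsto s^\sharp$ defines a map $$C^{p+1}(G;\mathcal I)\to C^p(G_\circ;\mathcal I).$$
   Context: **$\Theta^p$-structures.** For a group $G$ over $S$ and a line bundle $\mathcal L$ on $G$, let $\mu_I:G^p\to G$, $(a_1,\dots,a_p)\mapsto\sum_{i\in I}a_i$ for $I\subseteq\{1,\dots,p\}$ ($\mu_\emptyset$ the zero section) and, for $p\ge1$, $\Theta^p\mathcal L=\bigotimes_{I\subseteq\{1,\dots,p\}}(\mu_I^*\mathcal L)^{(-1)^{|I|}}$ on $G^p$. A $\Theta^p$-structure on $\mathcal L$ is a trivialization $s$ of $\Theta^p\mathcal L$ such that: $s$ is rigid (its restriction to $(0,\dots,0)$ is the canonical trivialization); $s$ is invariant under the canonical isomorphisms $\pi_\sigma^*\Theta^p\mathcal L\cong\Theta^p\mathcal L$, $\sigma\in\Sigma_p$; and for $p>1$, $s(a_1,a_2,\dots)\otimes s(a_0+a_1,a_2,\dots)^{-1}\otimes s(a_0,a_1+a_2,\dots)\otimes s(a_0,a_1,\dots)^{-1}$ corresponds to $1$ under the canonical trivialization of the corresponding tensor product of line bundles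 on $G^{p+1}$. $C^p(G;\mathcal L)$ is the set of $\Theta^p$-structures on $\mathcal L$. **$G_\circ$.** In terms of a coordinate, $\mathcal O_G\cong R[\![y]\!]$, $\mathcal I=(y)$, $R_1\cong R(\!(y)\!)$ (finite-tailed Laurent series). $G_\circ$ is the pull-back of the formal group $G$ along $\mathrm{spec}\,R_1\to\mathrm{spec}\,\mathcal O_G\to\mathrm{spec}\,R$, so $\mathcal O_{G_\circ^p}\cong R(\!(y)\!)[\![x_1,\dots,x_p]\!]$. **$s^\sharp$.** For $p\ge1$ let $\Theta^p_*\mathcal L=\bigotimes_{I\subseteq\{1,\dots,p\}}(\mu_{I\cup\{p+1\}}^*\mathcal L)^{(-1)^{|I|+1}}$ on $G^{p+1}$, and $\hat\pi_{p+1}:G^{p+1}\to G^p$ the projection to the first $p$ factors. Then $\Theta^{p+1}\mathcal L\cong\hat\pi_{p+1}^*\Theta^p\mathcal L\otimes\Theta^p_*\mathcal L$. Pull back along $\mathcal O_{G^{p+1}}=R[\![x_1,\dots,x_p,y]\!]\to R(\!(y)\!)[\![x_1,\dots,x_p]\!]=\mathcal O_{G_\circ^p}$, where the last factor of $G^{p+1}$ has coordinate $y$. There each ideal $\mu_{I\cup\{p+1\}}^*\mathcal I$ becomes the unit ideal (its generator becomes a unit), so $\Theta^p_*\mathcal I$ becomes canonically trivial, and $\hat\pi_{p+1}^*\Theta^p\mathcal I$ becomes $\Theta^p\mathcal I_{G_\circ}(0)$. Hence a section $s$ of $\Theta^{p+1}\mathcal I$ gives a section $s^\sharp$ of $\Theta^p\mathcal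 I_{G_\circ}(0)$ over $G_\circ^p$. *)

theory Defs
  imports
    "HOL-Computational_Algebra.Computational_Algebra"
    "HOL-Library.Multiset"
    "HOL-Library.FuncSet"
    "HOL-Combinatorics.Permutations"
begin

section \<open>Formal power series in several variables\<close>

text \<open>
  The variables are indexed by natural numbers, and a monomial is the multiset of its variables:
  \<open>{#1, 1, 2#}\<close> stands for \<open>x\<^sub>1\<^sup>2 x\<^sub>2\<close>.
\<close>

typedef 'a mfps = "UNIV :: (nat multiset \<Rightarrow> 'a) set"
  morphisms mfps_nth Abs_mfps by simp

setup_lifting type_definition_mfps

lemma mfps_eqI: "(\<And>\<alpha>. mfps_nth f \<alpha> = mfps_nth g \<alpha>) \<Longrightarrow> f = g"
  by (simp add: mfps_nth_inject[symmetric] fun_eq_iff)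

lemma finite_submultisets: "finite {\<beta>. \<beta> \<subseteq># (\<alpha> :: 'i multiset)}"
proof (rule finite_subset)
  show "{\<beta>. \<beta> \<subseteq># \<alpha>} \<subseteq> (\<Union>n\<le>size \<alpha>. multisets_of_size (set_mset \<alpha>) n)"
    by (auto simp: multisets_of_size_def dest: size_mset_mono mset_subset_eqD)
qed auto

lemma submultisets_empty [simp]: "{\<beta>. \<beta> = {#}} = {{#}}"
  by auto

instantiation mfps :: (comm_ring_1) comm_ring_1
begin

lift_definition zero_mfps :: "'a mfps" is "\<lambda>_. 0" .
lift_definition one_mfps :: "'a mfps" is "\<lambda>\<alpha>. if \<alpha> = {#} then 1 else 0" .
lift_definition plus_mfps :: "'a mfps \<Rightarrow> 'a mfps \<Rightarrow> 'a mfps" is "\<lambda>f g \<alpha>. f \<alpha> + g \<alpha>" .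
lift_definition minus_mfps :: "'a mfps \<Rightarrow> 'a mfps \<Rightarrow> 'a mfps" is "\<lambda>f g \<alpha>. f \<alpha> - g \<alpha>" .
lift_definition uminus_mfps :: "'a mfps \<Rightarrow> 'a mfps" is "\<lambda>f \<alpha>. - f \<alpha>" .
lift_definition times_mfps :: "'a mfps \<Rightarrow> 'a mfps \<Rightarrow> 'a mfps"
  is "\<lambda>f g \<alpha>. \<Sum>\<beta> | \<beta> \<subseteq># \<alpha>. f \<beta> * g (\<alpha> - \<beta>)" .

lemmas mfps_nth_simps =
  zero_mfps.rep_eq one_mfps.rep_eq plus_mfps.rep_eq minus_mfps.rep_eq uminus_mfps.rep_eq
  times_mfps.rep_eq

instance
proof
  fix a b c :: "'a mfps"
  show "a * b * c = a * (b * c)"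
  proof (rule mfps_eqI)
    fix \<alpha>
    let ?a = "mfps_nth a" and ?b = "mfps_nth b" and ?c = "mfps_nth c"
    have "mfps_nth (a * b * c) \<alpha> =
        (\<Sum>\<beta> | \<beta> \<subseteq># \<alpha>. \<Sum>\<gamma> | \<gamma> \<subseteq># \<beta>. ?a \<gamma> * ?b (\<beta> - \<gamma>) * ?c (\<alpha> - \<beta>))"
      by (simp add: mfps_nth_simps sum_distrib_right)
    also have "\<dots> = (\<Sum>(\<beta>, \<gamma>)\<in>(SIGMA \<beta>:{\<beta>. \<beta> \<subseteq># \<alpha>}. {\<gamma>. \<gamma> \<subseteq># \<beta>}).
        ?a \<gamma> * ?b (\<beta> - \<gamma>) * ?c (\<alpha> - \<beta>))"
      by (rule sum.Sigma) (auto intro: finite_submultisets)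
    also have "\<dots> = (\<Sum>(\<gamma>, \<delta>)\<in>(SIGMA \<gamma>:{\<gamma>. \<gamma> \<subseteq># \<alpha>}. {\<delta>. \<delta> \<subseteq># \<alpha> - \<gamma>}).
        ?a \<gamma> * (?b \<delta> * ?c (\<alpha> - \<gamma> - \<delta>)))"
    proof (rule sum.reindex_bij_witness
        [where i = "\<lambda>(\<gamma>, \<delta>). (\<gamma> + \<delta>, \<gamma>)" and j = "\<lambda>(\<beta>, \<gamma>). (\<gamma>, \<beta> - \<gamma>)"], goal_cases)
      case (2 x)
      then show ?case
        by (auto simp: subseteq_mset_def intro!: diff_le_mono intro: order_trans)
    next
      case (4 x)
      then obtain \<gamma> \<delta> where x: "x = (\<gamma>, \<delta>)" "\<gamma> \<subseteq># \<alpha>" "\<delta> \<subseteq># \<alpha> - \<gamma>"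
        by auto
      then have "\<gamma> + \<delta> \<subseteq># \<alpha>"
        by (metis subset_mset.add_left_mono subset_mset.add_diff_inverse)
      then show ?case
        using x by simp
    next
      case (5 x)
      then show ?case
        by (auto simp: mult.assoc)
    qed auto
    also have "\<dots> = (\<Sum>\<gamma> | \<gamma> \<subseteq># \<alpha>. \<Sum>\<delta> | \<delta> \<subseteq># \<alpha> - \<gamma>.
        ?a \<gamma> * (?b \<delta> * ?c (\<alpha> - \<gamma> - \<delta>)))"
      by (rule sum.Sigma[symmetric]) (auto intro: finite_submultisets)
    also have "\<dots> = mfps_nth (a * (b * c)) \<alpha>"
      by (simp add: mfps_nth_simps sum_distrib_left)
    finally show "mfps_nth (a * b * c) \<alpha> = mfps_nth (a * (b * c)) \<alpha>" .
  qed
  show "a * b = b * a"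
  proof (rule mfps_eqI)
    fix \<alpha>
    show "mfps_nth (a * b) \<alpha> = mfps_nth (b * a) \<alpha>"
      unfolding times_mfps.rep_eq
      by (rule sum.reindex_bij_witness[where i = "\<lambda>\<beta>. \<alpha> - \<beta>" and j = "\<lambda>\<beta>. \<alpha> - \<beta>"])
        (auto simp: mult.commute double_diff subset_mset.diff_diff_right)
  qed
  show "1 * a = a"
  proof (rule mfps_eqI)
    fix \<alpha>
    have "mfps_nth (1 * a) \<alpha> = (\<Sum>\<beta> | \<beta> \<subseteq># \<alpha>. if \<beta> = {#} then mfps_nth a \<alpha> else 0)"
      unfolding times_mfps.rep_eq one_mfps.rep_eq by (rule sum.cong) auto
    then show "mfps_nth (1 * a) \<alpha> = mfps_nth a \<alpha>"
      by (simp add: finite_submultisets)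
  qed
  have "mfps_nth 0 {#} \<noteq> mfps_nth (1 :: 'a mfps) {#}"
    by (simp add: mfps_nth_simps)
  then show "(0 :: 'a mfps) \<noteq> 1"
    by metis
qed (auto intro!: mfps_eqI simp: mfps_nth_simps algebra_simps sum.distrib)

end

definition mfps_var :: "nat \<Rightarrow> 'a::comm_ring_1 mfps" where
  "mfps_var i = Abs_mfps (\<lambda>\<alpha>. if \<alpha> = {#i#} then 1 else 0)"

definition mfps_const_term :: "'a mfps \<Rightarrow> 'a" where
  "mfps_const_term f = mfps_nth f {#}"

text \<open>\<open>mfps_over V\<close> is the subring \<open>R[[x\<^sub>i : i \<in> V]]\<close>.\<close>

definition mfps_over :: "nat set \<Rightarrow> 'a::zero mfps set" where
  "mfps_over V = {f. \<forall>\<alpha>. \<not> set_mset \<alpha> \<subseteq> V \<longrightarrow> mfps_nth f \<alpha> = 0}"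

definition mfps_map :: "('a \<Rightarrow> 'b) \<Rightarrow> 'a mfps \<Rightarrow> 'b mfps" where
  "mfps_map h f = Abs_mfps (\<lambda>\<alpha>. h (mfps_nth f \<alpha>))"

text \<open>
  Substitution \<open>f(u)\<close> in one variable, and \<open>f(b\<^sub>i : i \<in> V)\<close> for \<open>V\<close> finite. The substituted series
  must have zero constant term; then monomials of degree larger than the size of \<open>\<alpha>\<close> do not
  contribute to the coefficient of \<open>\<alpha>\<close>, so the sums below are complete.
\<close>

definition fps_subst :: "'a::comm_ring_1 mfps \<Rightarrow> 'a fps \<Rightarrow> 'a mfps" where
  "fps_subst u f = Abs_mfps (\<lambda>\<alpha>. \<Sum>n\<le>size \<alpha>. fps_nth f n * mfps_nth (u ^ n) \<alpha>)"

definition mfps_subst :: "nat set \<Rightarrow> (nat \<Rightarrow> 'a::comm_ring_1 mfps) \<Rightarrow> 'a mfps \<Rightarrow> 'a mfps" where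
  "mfps_subst V b f = Abs_mfps (\<lambda>\<alpha>.
     \<Sum>\<beta> | set_mset \<beta> \<subseteq> V \<and> size \<beta> \<le> size \<alpha>.
       mfps_nth f \<beta> * mfps_nth (\<Prod>i\<in>#\<beta>. b i) \<alpha>)"

section \<open>Formal groups\<close>

text \<open>
  A formal group \<open>G\<close> over \<open>R\<close> is given by its group law \<open>F(x\<^sub>1, x\<^sub>2)\<close> in some coordinate. Then
  \<open>O\<^bsub>G\<^esub> = R[[x]]\<close>, and \<open>mfps_over V\<close> is the ring of functions on the power of \<open>G\<close> with factors
  indexed by \<open>V\<close>. The inverse is not part of the data since it exists automatically.
\<close>

definition fg_add :: "'a::comm_ring_1 mfps \<Rightarrow> 'a mfps \<Rightarrow> 'a mfps \<Rightarrow> 'a mfps" where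
  "fg_add F a b = mfps_subst {1, 2} (\<lambda>i. if i = 1 then a else b) F"

definition formal_group :: "'a::comm_ring_1 mfps \<Rightarrow> bool" where
  "formal_group F \<longleftrightarrow>
     F \<in> mfps_over {1, 2} \<and>
     fg_add F (mfps_var 1) 0 = mfps_var 1 \<and>
     fg_add F 0 (mfps_var 1) = mfps_var 1 \<and>
     fg_add F (mfps_var 1) (mfps_var 2) = fg_add F (mfps_var 2) (mfps_var 1) \<and>
     fg_add F (fg_add F (mfps_var 1) (mfps_var 2)) (mfps_var 3) =
       fg_add F (mfps_var 1) (fg_add F (mfps_var 2) (mfps_var 3))"

text \<open>The coordinate of the point \<open>\<Sum>i\<in>I. a\<^sub>i\<close>, and the ring map \<open>\<mu>\<^sub>I\<^sup>*\<close>.\<close>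

definition fg_sum :: "'a::comm_ring_1 mfps \<Rightarrow> nat set \<Rightarrow> 'a mfps" where
  "fg_sum F I = foldr (\<lambda>i. fg_add F (mfps_var i)) (sorted_list_of_set I) 0"

definition mu :: "'a::comm_ring_1 mfps \<Rightarrow> nat set \<Rightarrow> 'a fps \<Rightarrow> 'a mfps" where
  "mu F I = fps_subst (fg_sum F I)"

section \<open>Tensor products of pulled back line bundles\<close>

text \<open>
  A line bundle \<open>L\<close> on \<open>G\<close> is an invertible \<open>R[[x]]\<close>-submodule of \<open>R((x))\<close>, and \<open>L\<^sup>-\<^sup>1\<close> is its inverse
  fractional ideal; the pairing of \<open>L\<close> with \<open>L\<^sup>-\<^sup>1\<close> is multiplication. The ideal sheaf of the identity
  is the kernel of restriction to the zero section.
\<close>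

definition structure_sheaf :: "'a::comm_ring_1 fls set" where
  "structure_sheaf = range fps_to_fls"

definition identity_ideal :: "'a::comm_ring_1 fls set" where
  "identity_ideal = fps_to_fls ` {f. fps_nth f 0 = 0}"

definition twist :: "'a::comm_ring_1 fls set \<Rightarrow> int \<Rightarrow> 'a fls set" where
  "twist L e = (if e = 1 then L else {f. \<forall>l\<in>L. f * l \<in> structure_sheaf})"

text \<open>
  Let \<open>A\<close> be a ring and \<open>m\<^sub>j : O\<^bsub>G\<^esub> \<rightarrow> A\<close> ring maps with exponents \<open>e\<^sub>j \<in> {1, -1}\<close>, for \<open>j\<close> in a
  finite set \<open>J\<close>. As \<open>L\<close> is invertible, \<open>\<Otimes>\<^sub>j (m\<^sub>j\<^sup>* L)\<^bsup>e\<^sub>j\<^esup>\<close> is the module of \<open>A\<close>-multilinear forms on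
  the modules \<open>m\<^sub>j\<^sup>* L\<^bsup>-e\<^sub>j\<^esup>\<close>: the tensor of the \<open>m\<^sub>j\<^sup>* g\<^sub>j\<close> with \<open>g\<^sub>j \<in> L\<^bsup>e\<^sub>j\<^esup>\<close> is the form
  \<open>l \<mapsto> \<Prod>j. m\<^sub>j (g\<^sub>j l\<^sub>j)\<close>. By the universal property of base change such a form is the same as a map on
  families \<open>l\<^sub>j \<in> L\<^bsup>-e\<^sub>j\<^esup>\<close> which is additive and \<open>m\<^sub>j\<close>-semilinear in the \<open>j\<close>-th argument.
  In this description, pulling back along a ring map \<open>A \<rightarrow> B\<close> is composition with it, and the tensor
  product of sections is the product of the forms in disjoint sets of arguments.
\<close>

definition tensor_args :: "'a::comm_ring_1 fls set \<Rightarrow> 'i set \<Rightarrow> ('i \<Rightarrow> int) \<Rightarrow> ('i \<Rightarrow> 'a fls) set" where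
  "tensor_args L J e = (\<Pi>\<^sub>E j\<in>J. twist L (- e j))"

definition tensor_sections ::
  "'b::comm_ring_1 set \<Rightarrow> 'a::comm_ring_1 fls set \<Rightarrow> 'i set \<Rightarrow> ('i \<Rightarrow> 'a fps \<Rightarrow> 'b) \<Rightarrow> ('i \<Rightarrow> int)
     \<Rightarrow> (('i \<Rightarrow> 'a fls) \<Rightarrow> 'b) set" where
  "tensor_sections A L J m e = {\<phi> \<in> tensor_args L J e \<rightarrow>\<^sub>E A.
     (\<forall>l\<in>tensor_args L J e. \<forall>j\<in>J.
        (\<forall>v\<in>twist L (- e j). \<phi> (l(j := l j + v)) = \<phi> l + \<phi> (l(j := v))) \<and>
        (\<forall>f. \<phi> (l(j := fps_to_fls f * l j)) = m j f * \<phi> l))}"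

definition trivialization ::
  "'b::comm_ring_1 set \<Rightarrow> 'a::comm_ring_1 fls set \<Rightarrow> 'i set \<Rightarrow> ('i \<Rightarrow> 'a fps \<Rightarrow> 'b) \<Rightarrow> ('i \<Rightarrow> int)
     \<Rightarrow> (('i \<Rightarrow> 'a fls) \<Rightarrow> 'b) \<Rightarrow> bool" where
  "trivialization A L J m e \<phi> \<longleftrightarrow> \<phi> \<in> tensor_sections A L J m e \<and>
     (\<forall>\<psi>\<in>tensor_sections A L J m e. \<exists>!a. a \<in> A \<and> (\<forall>l\<in>tensor_args L J e. \<psi> l = a * \<phi> l))"

definition pullback_section ::
  "('b \<Rightarrow> 'c) \<Rightarrow> 'a::comm_ring_1 fls set \<Rightarrow> 'i set \<Rightarrow> ('i \<Rightarrow> int) \<Rightarrow> (('i \<Rightarrow> 'a fls) \<Rightarrow> 'b)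
     \<Rightarrow> ('i \<Rightarrow> 'a fls) \<Rightarrow> 'c" where
  "pullback_section h L J e \<phi> = (\<lambda>l\<in>tensor_args L J e. h (\<phi> l))"

text \<open>The section of the dual bundle whose tensor product with \<open>\<phi>\<close> contracts to \<open>1\<close>.\<close>

definition inverse_section ::
  "'b::comm_ring_1 set \<Rightarrow> 'a::comm_ring_1 fls set \<Rightarrow> 'i set \<Rightarrow> ('i \<Rightarrow> 'a fps \<Rightarrow> 'b) \<Rightarrow> ('i \<Rightarrow> int)
     \<Rightarrow> (('i \<Rightarrow> 'a fls) \<Rightarrow> 'b) \<Rightarrow> ('i \<Rightarrow> 'a fls) \<Rightarrow> 'b" where
  "inverse_section A L J m e \<phi> = (THE \<psi>. \<psi> \<in> tensor_sections A L J m (\<lambda>j. - e j) \<and>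
     (\<forall>l\<in>tensor_args L J e. \<forall>l'\<in>tensor_args L J (\<lambda>j. - e j).
        \<phi> l * \<psi> l' = (\<Prod>j\<in>J. m j (fls_regpart (l j * l' j)))))"

text \<open>
  If for each ring map \<open>h\<close> the exponents of the factors with \<open>m\<^sub>j = h\<close> add up to zero, these factors
  cancel by contraction, and the tensor product is canonically trivial. This is the section
  corresponding to \<open>1\<close>: the product of the \<open>l\<^sub>j\<close> with \<open>m\<^sub>j = h\<close> lies in \<open>L\<^sup>0 = O\<^bsub>G\<^esub>\<close>, where
  \<open>fls_regpart\<close> only inverts \<open>fps_to_fls\<close>.
\<close>

definition canonical_section ::
  "'i set \<Rightarrow> ('i \<Rightarrow> 'a::comm_ring_1 fps \<Rightarrow> 'b::comm_ring_1) \<Rightarrow> ('i \<Rightarrow> 'a fls) \<Rightarrow> 'b" where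
  "canonical_section J m l = (\<Prod>h\<in>m ` J. h (fls_regpart (\<Prod>j\<in>{j\<in>J. m j = h}. l j)))"

section \<open>\<open>\<Theta>\<^sup>p\<close>-structures\<close>

definition theta_sign :: "nat set \<Rightarrow> int" where
  "theta_sign I = (- 1) ^ card I"

definition theta_sections ::
  "'a::comm_ring_1 mfps \<Rightarrow> nat \<Rightarrow> 'a fls set \<Rightarrow> ((nat set \<Rightarrow> 'a fls) \<Rightarrow> 'a mfps) set" where
  "theta_sections F p L = tensor_sections (mfps_over {1..p}) L (Pow {1..p}) (mu F) theta_sign"

definition theta_trivialization ::
  "'a::comm_ring_1 mfps \<Rightarrow> nat \<Rightarrow> 'a fls set \<Rightarrow> ((nat set \<Rightarrow> 'a fls) \<Rightarrow> 'a mfps) \<Rightarrow> bool" where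
  "theta_trivialization F p L s \<longleftrightarrow>
     trivialization (mfps_over {1..p}) L (Pow {1..p}) (mu F) theta_sign s"

text \<open>Restriction to \<open>(0, \<dots>, 0)\<close> takes constant terms; all factors become the fibre of \<open>L\<close> at \<open>0\<close>.\<close>

definition theta_rigid ::
  "'a::comm_ring_1 mfps \<Rightarrow> nat \<Rightarrow> 'a fls set \<Rightarrow> ((nat set \<Rightarrow> 'a fls) \<Rightarrow> 'a mfps) \<Rightarrow> bool" where
  "theta_rigid F p L s \<longleftrightarrow>
     (\<forall>l\<in>tensor_args L (Pow {1..p}) theta_sign.
        pullback_section mfps_const_term L (Pow {1..p}) theta_sign s l =
        canonical_section (Pow {1..p}) (\<lambda>I. mfps_const_term \<circ> mu F I) l)"

text \<open>
  For \<open>\<pi>\<^sub>\<sigma>(a\<^sub>1, \<dots>, a\<^sub>p) = (a\<^bsub>\<sigma>(1)\<^esub>, \<dots>, a\<^bsub>\<sigma>(p)\<^esub>)\<close> we have \<open>\<mu>\<^sub>I \<circ> \<pi>\<^sub>\<sigma> = \<mu>\<^bsub>\<sigma>(I)\<^esub>\<close>, so the canonical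
  isomorphism sends the factor of \<open>\<pi>\<^sub>\<sigma>\<^sup>* \<Theta>\<^sup>p L\<close> at \<open>I\<close> to the factor of \<open>\<Theta>\<^sup>p L\<close> at \<open>\<sigma>(I)\<close>.
\<close>

definition theta_symmetric ::
  "nat \<Rightarrow> 'a::comm_ring_1 fls set \<Rightarrow> ((nat set \<Rightarrow> 'a fls) \<Rightarrow> 'a mfps) \<Rightarrow> bool" where
  "theta_symmetric p L s \<longleftrightarrow>
     (\<forall>\<sigma>. \<sigma> permutes {1..p} \<longrightarrow>
       (\<forall>l\<in>tensor_args L (Pow {1..p}) theta_sign.
          pullback_section (mfps_subst {1..p} (\<lambda>i. mfps_var (\<sigma> i))) L (Pow {1..p}) theta_sign s
            (\<lambda>I\<in>Pow {1..p}. l (\<sigma> ` I)) = s l))"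

text \<open>
  The \<open>i\<close>-th component of the \<open>k\<close>-th of the four maps from \<open>G\<^bsup>p+1\<^esup>\<close>, with coordinates
  \<open>a\<^sub>0, \<dots>, a\<^sub>p\<close>, to \<open>G\<^sup>p\<close>:
  \<open>(a\<^sub>1, a\<^sub>2, a\<^sub>3, \<dots>)\<close>, \<open>(a\<^sub>0 + a\<^sub>1, a\<^sub>2, a\<^sub>3, \<dots>)\<close>, \<open>(a\<^sub>0, a\<^sub>1 + a\<^sub>2, a\<^sub>3, \<dots>)\<close>, \<open>(a\<^sub>0, a\<^sub>1, a\<^sub>3, \<dots>)\<close>.
\<close>

definition cocycle_map :: "'a::comm_ring_1 mfps \<Rightarrow> nat \<Rightarrow> nat \<Rightarrow> 'a mfps" where
  "cocycle_map F k i =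
     (if k = 2 \<and> i = 1 then fg_add F (mfps_var 0) (mfps_var 1)
      else if k = 3 \<and> i = 1 then mfps_var 0
      else if k = 3 \<and> i = 2 then fg_add F (mfps_var 1) (mfps_var 2)
      else if k = 4 \<and> i = 1 then mfps_var 0
      else if k = 4 \<and> i = 2 then mfps_var 1
      else mfps_var i)"

definition cocycle_factor ::
  "'a::comm_ring_1 mfps \<Rightarrow> nat \<Rightarrow> nat \<times> nat set \<Rightarrow> 'a fps \<Rightarrow> 'a mfps" where
  "cocycle_factor F p = (\<lambda>(k, I). mfps_subst {1..p} (cocycle_map F k) \<circ> mu F I)"

definition cocycle_sign :: "nat \<times> nat set \<Rightarrow> int" where
  "cocycle_sign = (\<lambda>(k, I). (- 1) ^ (k + 1) * theta_sign I)"

text \<open>\<open>s\<close> pulled back along the \<open>k\<close>-th map, inverted for \<open>k = 2\<close> and \<open>k = 4\<close>.\<close>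

definition cocycle_term ::
  "'a::comm_ring_1 mfps \<Rightarrow> nat \<Rightarrow> 'a fls set \<Rightarrow> ((nat set \<Rightarrow> 'a fls) \<Rightarrow> 'a mfps) \<Rightarrow> nat
     \<Rightarrow> (nat set \<Rightarrow> 'a fls) \<Rightarrow> 'a mfps" where
  "cocycle_term F p L s k =
     (let s\<^sub>k = pullback_section (mfps_subst {1..p} (cocycle_map F k)) L (Pow {1..p}) theta_sign s
      in if odd k then s\<^sub>k
         else inverse_section (mfps_over {0..p}) L (Pow {1..p})
                (\<lambda>I. cocycle_factor F p (k, I)) theta_sign s\<^sub>k)"

definition theta_cocycle ::
  "'a::comm_ring_1 mfps \<Rightarrow> nat \<Rightarrow> 'a fls set \<Rightarrow> ((nat set \<Rightarrow> 'a fls) \<Rightarrow> 'a mfps) \<Rightarrow> bool" where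
  "theta_cocycle F p L s \<longleftrightarrow>
     (\<forall>l\<in>tensor_args L ({1..4} \<times> Pow {1..p}) cocycle_sign.
        (\<Prod>k\<in>{1..4}. cocycle_term F p L s k (\<lambda>I\<in>Pow {1..p}. l (k, I))) =
        canonical_section ({1..4} \<times> Pow {1..p}) (cocycle_factor F p) l)"

definition theta_structures ::
  "'a::comm_ring_1 mfps \<Rightarrow> nat \<Rightarrow> 'a fls set \<Rightarrow> ((nat set \<Rightarrow> 'a fls) \<Rightarrow> 'a mfps) set" where
  "theta_structures F p L =
     {s. theta_trivialization F p L s \<and> theta_rigid F p L s \<and> theta_symmetric p L s \<and>
         (p > 1 \<longrightarrow> theta_cocycle F p L s)}"

section \<open>The formal group \<open>G\<^sub>\<circ>\<close> and the section \<open>s\<^sup>\<sharp>\<close>\<close>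

text \<open>\<open>R\<^sub>1 = R((y))\<close> is the type \<open>'a fls\<close>.\<close>

definition punctured_group :: "'a::comm_ring_1 mfps \<Rightarrow> 'a fls mfps" where
  "punctured_group F = mfps_map fls_const F"

definition fls_base_change :: "'a::comm_ring_1 fls \<Rightarrow> 'a fls fls" where
  "fls_base_change f = Abs_fls (\<lambda>n. fls_const (fls_nth f n))"

text \<open>The inclusion of \<open>R[[x\<^sub>i (i \<noteq> q), x\<^sub>q]]\<close> in \<open>R((y))[[x\<^sub>i (i \<noteq> q)]]\<close> that sends \<open>x\<^sub>q\<close> to \<open>y\<close>.\<close>

definition to_punctured :: "nat \<Rightarrow> 'a::comm_ring_1 mfps \<Rightarrow> 'a fls mfps" where
  "to_punctured q f = Abs_mfps (\<lambda>\<alpha>. if q \<in># \<alpha> then 0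
     else fps_to_fls (Abs_fps (\<lambda>k. mfps_nth f (\<alpha> + replicate_mset k q))))"

text \<open>
  If \<open>m : O\<^bsub>G\<^esub> \<rightarrow> A\<close> maps the ideal of the identity to the unit ideal, then \<open>m\<close> extends uniquely to
  \<open>R((x))\<close>. For \<open>L\<close> the ideal of the identity or its inverse, the extension restricted to \<open>L\<close> induces
  the isomorphism of \<open>m\<^sup>* L\<close> with \<open>A\<close>.
\<close>

definition extend_map :: "('a::comm_ring_1 fps \<Rightarrow> 'b::comm_ring_1) \<Rightarrow> 'a fls \<Rightarrow> 'b" where
  "extend_map m l = (THE a. \<forall>f g. fps_to_fls f * l = fps_to_fls g \<longrightarrow> m f * a = m g)"

text \<open>
  The section of the pull back of \<open>\<Theta>\<^sup>p\<^sub>* I\<close> that corresponds to \<open>1\<close> under its canonical trivialization.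
  The factor at \<open>I\<close> is the pull back along \<open>\<mu>\<^bsub>I \<union> {p+1}\<^esub>\<close>.
\<close>

definition theta_star_canonical ::
  "'a::comm_ring_1 mfps \<Rightarrow> nat \<Rightarrow> (nat set \<Rightarrow> 'a fls) \<Rightarrow> 'a fls mfps" where
  "theta_star_canonical F p l =
     (\<Prod>I\<in>Pow {1..p}. extend_map (to_punctured (p + 1) \<circ> mu F (insert (p + 1) I)) (l I))"

text \<open>
  The pull back of \<open>s\<close> is \<open>s\<^sup>\<sharp>\<close> tensor the section above, under the isomorphism of \<open>\<Theta>\<^bsup>p+1\<^esup> I\<close> with the
  tensor product of the pull back of \<open>\<Theta>\<^sup>p I\<close> (the factors at subsets of \<open>{1..p}\<close>) and \<open>\<Theta>\<^sup>p\<^sub>* I\<close>.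
  Forms on the ideal of the identity of \<open>G\<^sub>\<circ>\<close> are determined by their restriction to that of \<open>G\<close>.
\<close>

definition sharp ::
  "'a::comm_ring_1 mfps \<Rightarrow> nat \<Rightarrow> ((nat set \<Rightarrow> 'a fls) \<Rightarrow> 'a mfps)
     \<Rightarrow> (nat set \<Rightarrow> 'a fls fls) \<Rightarrow> 'a fls mfps" where
  "sharp F p s = (THE t. t \<in> theta_sections (punctured_group F) p identity_ideal \<and>
     (\<forall>l\<in>tensor_args identity_ideal (Pow {1..p + 1}) theta_sign.
        pullback_section (to_punctured (p + 1)) identity_ideal (Pow {1..p + 1}) theta_sign s l =
        t (\<lambda>I\<in>Pow {1..p}. fls_base_change (l I)) *
        theta_star_canonical F p (\<lambda>I\<in>Pow {1..p}. l (insert (p + 1) I))))"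

end

theory Submission
  imports Defs
begin

text \<open>
  Multilinearity makes a section of a tensor product of pull backs of \<open>(x)\<^sup>\<plusminus>\<^sup>1\<close> a multiple \<open>c\<close> of the
  product of the standard generators, and the factors in the cocycle condition cancel: the maps
  occurring there are the sums over subsets \<open>T\<close> of \<open>{0..p}\<close>, and the signs over each \<open>T\<close> add up to
  zero. So a \<open>\<Theta>\<^sup>p\<close>-structure is a series \<open>c(x\<^sub>1, \<dots>, x\<^sub>p)\<close> with constant term \<open>1\<close> that is symmetric
  and a multiplicative 2-cocycle in its first two arguments. In these terms
  \<open>s\<^sup>\<sharp> = c(x\<^sub>1, \<dots>, x\<^sub>p, y) \<Prod>\<^sub>I (\<mu>\<^bsub>I \<union> {p+1}\<^esub>)\<^bsup>e(I)\<^esup>\<close> with \<open>I \<subseteq> {1..p}\<close>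
  and \<open>e(I) = -(-1)\<^bsup>|I|\<^esup>\<close>. The product is symmetric,
  and it is a cocycle by the same cancellation. At \<open>x = 0\<close> it is a product of powers of \<open>y\<close> with total
  exponent \<open>0\<close>, and \<open>c(0, \<dots>, 0, y) = 1\<close> follows from the cocycle condition and symmetry.
\<close>

section \<open>Substitution into power series in several variables\<close>

text \<open>Canonical sections group factors by equality of ring maps, whereas the signs cancel over
  sets T. The two agree because the sum of the points a_i with i in T has as linear part the sum of
  the x_i, so different T give different maps. At the origin all the maps coincide, and the
  cancellation is over all subsets at once, which is where p >= 1 enters. For s^sharp the point is
  that the sum of y and the a_i with i in I takes the value y at x = 0. This is a unit of R((y)), so
  a geometric series inverts it over R((y))[[x]] and negative exponents make sense. Permutations and
  cocycle maps of the first p factors fix y and do not introduce it elsewhere, hence commute with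
  the passage from R[[x, y]] to R((y))[[x]]. That passage moves a variable into the coefficients, so
  it is handled coefficient by coefficient. The cocycle condition on c in p + 1 variables serves
  twice: it gives the one for s^sharp, and its restriction to an axis gives rigidity, where rigidity
  of c itself only covers y = 0.\<close>

lemma mfps_nth_Abs [simp]: "mfps_nth (Abs_mfps f) = f"
  by (simp add: Abs_mfps_inverse)

lemma mfps_nth_add [simp]: "mfps_nth (f + g) \<alpha> = mfps_nth f \<alpha> + mfps_nth g \<alpha>"
  by (simp add: plus_mfps.rep_eq)

lemma mfps_nth_0 [simp]: "mfps_nth 0 \<alpha> = 0"
  by (simp add: zero_mfps.rep_eq)

lemma mfps_nth_1 [simp]: "mfps_nth 1 \<alpha> = (if \<alpha> = {#} then 1 else 0)"
  by (simp add: one_mfps.rep_eq)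

lemma mfps_nth_sum: "mfps_nth (\<Sum>x\<in>A. f x) \<alpha> = (\<Sum>x\<in>A. mfps_nth (f x) \<alpha>)"
  by (induction A rule: infinite_finite_induct) auto

lemma mfps_nth_var: "mfps_nth (mfps_var i) \<alpha> = (if \<alpha> = {#i#} then 1 else 0)"
  by (simp add: mfps_var_def)

section \<open>Constants and constant terms\<close>

definition mfps_const :: "'a::comm_ring_1 \<Rightarrow> 'a mfps" where
  "mfps_const c = Abs_mfps (\<lambda>\<alpha>. if \<alpha> = {#} then c else 0)"

lemma mfps_nth_const_mult: "mfps_nth (mfps_const c * f) \<alpha> = c * mfps_nth f \<alpha>"
proof -
  have "mfps_nth (mfps_const c * f) \<alpha> = (\<Sum>\<beta> | \<beta> \<subseteq># \<alpha>. if \<beta> = {#} then c * mfps_nth f \<alpha> else 0)"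
    unfolding times_mfps.rep_eq mfps_const_def by (rule sum.cong) auto
  then show ?thesis
    by (simp add: finite_submultisets)
qed

lemma mfps_const_mult: "mfps_const (a * b) = mfps_const a * mfps_const b"
  by (rule mfps_eqI) (simp add: mfps_nth_const_mult, simp add: mfps_const_def)

lemma mfps_const_0 [simp]: "mfps_const 0 = 0"
  by (rule mfps_eqI) (simp add: mfps_const_def)

lemma mfps_const_1 [simp]: "mfps_const 1 = 1"
  by (rule mfps_eqI) (simp add: mfps_const_def)

lemma mfps_const_add: "mfps_const (a + b) = mfps_const a + mfps_const b"
  by (rule mfps_eqI) (simp add: mfps_const_def)

lemma mfps_const_sum: "mfps_const (\<Sum>x\<in>A. f x) = (\<Sum>x\<in>A. mfps_const (f x))"
  by (induction A rule: infinite_finite_induct) (auto simp: mfps_const_add)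

lemma const_term_add [simp]:
    "mfps_const_term (f + g) = mfps_const_term f + mfps_const_term g"
  and const_term_0 [simp]: "mfps_const_term 0 = 0"
  and const_term_1 [simp]: "mfps_const_term 1 = 1"
  and const_term_var [simp]: "mfps_const_term (mfps_var i) = 0"
  and const_term_const [simp]: "mfps_const_term (mfps_const c) = c"
  by (simp_all add: mfps_const_term_def mfps_nth_var mfps_const_def)

lemma const_term_mult [simp]:
  "mfps_const_term (f * g) = mfps_const_term f * mfps_const_term g"
  by (simp add: mfps_const_term_def times_mfps.rep_eq)

lemma const_term_prod [simp]:
  "mfps_const_term (\<Prod>x\<in>A. f x) = (\<Prod>x\<in>A. mfps_const_term (f x))"
  by (induction A rule: infinite_finite_induct) auto

text \<open>Equality up to total degree n. The range of the sum that defines a substitution varies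
  with the coefficient; up to a fixed degree the substitution is one finite sum in the ring.\<close>

definition mfps_cong :: "nat \<Rightarrow> 'a mfps \<Rightarrow> 'a mfps \<Rightarrow> bool" where
  "mfps_cong n f g \<longleftrightarrow> (\<forall>\<alpha>. size \<alpha> \<le> n \<longrightarrow> mfps_nth f \<alpha> = mfps_nth g \<alpha>)"

lemma mfps_cong_sym: "mfps_cong n f g \<Longrightarrow> mfps_cong n g f"
  by (simp add: mfps_cong_def)

lemma mfps_cong_trans [trans]: "mfps_cong n f g \<Longrightarrow> mfps_cong n g h \<Longrightarrow> mfps_cong n f h"
  by (simp add: mfps_cong_def)

lemma mfps_cong_eqI: "(\<And>n. mfps_cong n f g) \<Longrightarrow> f = g"
  by (rule mfps_eqI) (auto simp: mfps_cong_def)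

lemma mfps_cong_mult:
  assumes "mfps_cong n f f'" and "mfps_cong n g g'"
  shows "mfps_cong n (f * g) (f' * g')"
  unfolding mfps_cong_def times_mfps.rep_eq
proof (intro allI impI sum.cong refl)
  fix \<alpha> \<beta> :: "nat multiset"
  assume *: "size \<alpha> \<le> n" "\<beta> \<in> {\<beta>. \<beta> \<subseteq># \<alpha>}"
  then have "size \<beta> \<le> n" "size (\<alpha> - \<beta>) \<le> n"
    using size_mset_mono[of \<beta> \<alpha>] size_mset_mono[of "\<alpha> - \<beta>" \<alpha>] by auto
  then show "mfps_nth f \<beta> * mfps_nth g (\<alpha> - \<beta>) = mfps_nth f' \<beta> * mfps_nth g' (\<alpha> - \<beta>)"
    using assms by (simp add: mfps_cong_def)
qed

text \<open>Each factor without constant term raises the least degree by at least one.\<close>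

lemma nth_prod_mset_eq_0:
  assumes "\<And>i. i \<in># \<beta> \<Longrightarrow> mfps_const_term (b i) = 0" and "size \<alpha> < size \<beta>"
  shows "mfps_nth (\<Prod>i\<in>#\<beta>. b i) \<alpha> = 0"
  using assms
proof (induction \<beta> arbitrary: \<alpha>)
  case (add x \<beta>)
  have "mfps_nth (b x) \<gamma> * mfps_nth (\<Prod>i\<in>#\<beta>. b i) (\<alpha> - \<gamma>) = 0" if "\<gamma> \<subseteq># \<alpha>" for \<gamma>
  proof (cases "\<gamma> = {#}")
    case True
    then show ?thesis
      using add.prems(1)[of x] by (simp add: mfps_const_term_def)
  next
    case False
    then have "size (\<alpha> - \<gamma>) < size \<alpha>"
      using that by (simp add: size_Diff_submset nonempty_has_size size_mset_mono)
        (meson diff_less nonempty_has_size order_less_le_trans size_mset_mono)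
    then have "mfps_nth (\<Prod>i\<in>#\<beta>. b i) (\<alpha> - \<gamma>) = 0"
      using add.prems by (intro add.IH) auto
    then show ?thesis
      by simp
  qed
  then show ?case
    by (simp add: times_mfps.rep_eq)
qed auto

lemma nth_power_eq_0:
  assumes "mfps_const_term u = 0" and "size \<alpha> < n"
  shows "mfps_nth (u ^ n) \<alpha> = 0"
  \<comment> \<open>A power is the product over n copies of an arbitrary index.\<close>
  using nth_prod_mset_eq_0[of "replicate_mset n 0" "\<lambda>_. u"] assms by simp

definition monomials :: "nat set \<Rightarrow> nat \<Rightarrow> nat multiset set" where
  "monomials V n = {\<beta>. set_mset \<beta> \<subseteq> V \<and> size \<beta> \<le> n}"

lemma finite_monomials [simp]: "finite V \<Longrightarrow> finite (monomials V n)"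
  by (rule finite_subset[of _ "\<Union>k\<le>n. multisets_of_size V k"])
    (auto simp: monomials_def finite_multisets_of_size, simp add: multisets_of_size_def)

text \<open>Monomials of size above \<open>size \<alpha>\<close> have no term at
  \<open>\<alpha>\<close>, so the bound in the definition may be raised to the common bound
  n.\<close>

lemma mfps_subst_cong_polynomial:
  assumes "finite V" and "\<And>i. i \<in> V \<Longrightarrow> mfps_const_term (b i) = 0"
  shows "mfps_cong n (mfps_subst V b f)
    (\<Sum>\<beta>\<in>monomials V n. mfps_const (mfps_nth f \<beta>) * (\<Prod>i\<in>#\<beta>. b i))"
  unfolding mfps_cong_def
proof (intro allI impI)
  fix \<alpha> :: "nat multiset"
  assume "size \<alpha> \<le> n"
  have "mfps_nth (mfps_subst V b f) \<alpha> =
      (\<Sum>\<beta>\<in>monomials V (size \<alpha>). mfps_nth f \<beta> * mfps_nth (\<Prod>i\<in>#\<beta>. b i) \<alpha>)"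
    by (simp add: mfps_subst_def monomials_def)
  also have "\<dots> = (\<Sum>\<beta>\<in>monomials V n. mfps_nth f \<beta> * mfps_nth (\<Prod>i\<in>#\<beta>. b i) \<alpha>)"
    using assms \<open>size \<alpha> \<le> n\<close>
    by (intro sum.mono_neutral_left ballI)
      (auto simp: monomials_def not_le subset_iff nth_prod_mset_eq_0
        finite_monomials[unfolded monomials_def subset_iff])
  finally show "mfps_nth (mfps_subst V b f) \<alpha> = mfps_nth
      (\<Sum>\<beta>\<in>monomials V n. mfps_const (mfps_nth f \<beta>) * (\<Prod>i\<in>#\<beta>. b i)) \<alpha>"
    by (simp add: mfps_nth_sum mfps_nth_const_mult)
qed

lemma fps_subst_cong_polynomial:
  assumes "mfps_const_term u = 0"
  shows "mfps_cong n (fps_subst u f) (\<Sum>k\<le>n. mfps_const (fps_nth f k) * u ^ k)"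
  unfolding mfps_cong_def
proof (intro allI impI)
  fix \<alpha> :: "nat multiset"
  assume "size \<alpha> \<le> n"
  then have "(\<Sum>k\<le>size \<alpha>. fps_nth f k * mfps_nth (u ^ k) \<alpha>) =
      (\<Sum>k\<le>n. fps_nth f k * mfps_nth (u ^ k) \<alpha>)"
    using assms by (intro sum.mono_neutral_left ballI) (auto simp: nth_power_eq_0)
  then show "mfps_nth (fps_subst u f) \<alpha> =
      mfps_nth (\<Sum>k\<le>n. mfps_const (fps_nth f k) * u ^ k) \<alpha>"
    by (simp add: fps_subst_def mfps_nth_sum mfps_nth_const_mult)
qed

section \<open>Substitution in several variables as a ring map\<close>

lemma mfps_subst_add: "mfps_subst V b (f + g) = mfps_subst V b f + mfps_subst V b g"
  by (rule mfps_eqI) (simp add: mfps_subst_def sum.distrib algebra_simps)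

lemma mfps_subst_0 [simp]: "mfps_subst V b 0 = 0"
  by (rule mfps_eqI) (simp add: mfps_subst_def)

lemma mfps_subst_const_mult: "mfps_subst V b (mfps_const c * f) = mfps_const c * mfps_subst V b f"
  by (rule mfps_eqI)
    (simp add: mfps_subst_def mfps_nth_const_mult sum_distrib_left mult.assoc)

lemma mfps_subst_sum: "mfps_subst V b (\<Sum>x\<in>A. f x) = (\<Sum>x\<in>A. mfps_subst V b (f x))"
  by (induction A rule: infinite_finite_induct) (auto simp: mfps_subst_add)

lemma mfps_subst_cong:
  assumes "\<And>i. i \<in> V \<Longrightarrow> b i = b' i"
  shows "mfps_subst V b f = mfps_subst V b' f"
proof (rule mfps_eqI)
  fix \<alpha>
  have "(\<Prod>i\<in>#\<beta>. b i) = (\<Prod>i\<in>#\<beta>. b' i)" if "set_mset \<beta> \<subseteq> V" for \<beta>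
    using that assms by (intro arg_cong[of _ _ prod_mset] image_mset_cong) auto
  then show "mfps_nth (mfps_subst V b f) \<alpha> = mfps_nth (mfps_subst V b' f) \<alpha>"
    by (simp add: mfps_subst_def)
qed

lemma mfps_subst_degree_cong:
  assumes "mfps_cong n f g"
  shows "mfps_cong n (mfps_subst V b f) (mfps_subst V b g)"
  using assms by (auto simp: mfps_cong_def mfps_subst_def intro!: sum.cong)

lemma const_term_mfps_subst [simp]: "mfps_const_term (mfps_subst V b f) = mfps_const_term f"
proof -
  have "{\<beta>. set_mset \<beta> \<subseteq> V \<and> \<beta> = {#}} = {{#}}"
    by auto
  then show ?thesis
    by (simp add: mfps_const_term_def mfps_subst_def)
qed

lemma mfps_subst_const [simp]:
  assumes "finite V"
  shows "mfps_subst V b (mfps_const c) = mfps_const c"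
proof (rule mfps_eqI)
  fix \<alpha>
  have "(\<Sum>\<beta> | set_mset \<beta> \<subseteq> V \<and> size \<beta> \<le> size \<alpha>.
      mfps_nth (mfps_const c) \<beta> * mfps_nth (\<Prod>i\<in>#\<beta>. b i) \<alpha>) =
    (\<Sum>\<beta>\<in>{{#}}. mfps_nth (mfps_const c) \<beta> * mfps_nth (\<Prod>i\<in>#\<beta>. b i) \<alpha>)"
    using finite_monomials[OF assms, of "size \<alpha>"]
    by (intro sum.mono_neutral_right ballI) (auto simp: mfps_const_def monomials_def)
  then show "mfps_nth (mfps_subst V b (mfps_const c)) \<alpha> = mfps_nth (mfps_const c) \<alpha>"
    by (simp add: mfps_subst_def) (simp add: mfps_const_def)
qed

lemma mfps_subst_1 [simp]: "finite V \<Longrightarrow> mfps_subst V b 1 = 1"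
  using mfps_subst_const[of V b 1] by simp

text \<open>Up to degree n both sides are sums over pairs of monomials of f and g: on the left over
  pairs whose product has size at most n, on the right over all pairs of monomials of size at most
  n. The extra pairs only reach higher degrees.\<close>

lemma mfps_subst_mult:
  assumes "finite V" and b: "\<And>i. i \<in> V \<Longrightarrow> mfps_const_term (b i) = 0"
  shows "mfps_subst V b (f * g) = mfps_subst V b f * mfps_subst V b g"
proof (rule mfps_cong_eqI)
  fix n
  let ?M = "monomials V n"
  let ?t = "\<lambda>(\<beta>, \<gamma>). mfps_const (mfps_nth f \<beta>) * (\<Prod>i\<in>#\<beta>. b i) *
    (mfps_const (mfps_nth g \<gamma>) * (\<Prod>i\<in>#\<gamma>. b i))"
  have "mfps_cong n (mfps_subst V b (f * g))
      (\<Sum>\<delta>\<in>?M. mfps_const (mfps_nth (f * g) \<delta>) * (\<Prod>i\<in>#\<delta>. b i))"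
    by (intro mfps_subst_cong_polynomial assms)
  also have "(\<Sum>\<delta>\<in>?M. mfps_const (mfps_nth (f * g) \<delta>) * (\<Prod>i\<in>#\<delta>. b i)) =
      (\<Sum>\<delta>\<in>?M. \<Sum>\<beta> | \<beta> \<subseteq># \<delta>. ?t (\<beta>, \<delta> - \<beta>))"
  proof (rule sum.cong[OF refl])
    fix \<delta>
    have "mfps_const (mfps_nth (f * g) \<delta>) * (\<Prod>i\<in>#\<delta>. b i) =
        (\<Sum>\<beta> | \<beta> \<subseteq># \<delta>. mfps_const (mfps_nth f \<beta>) * mfps_const (mfps_nth g (\<delta> - \<beta>)) *
          (\<Prod>i\<in>#\<delta>. b i))"
      by (simp add: times_mfps.rep_eq mfps_const_sum mfps_const_mult sum_distrib_right)
    also have "\<dots> = (\<Sum>\<beta> | \<beta> \<subseteq># \<delta>. ?t (\<beta>, \<delta> - \<beta>))"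
    proof (rule sum.cong[OF refl])
      fix \<beta> assume "\<beta> \<in> {\<beta>. \<beta> \<subseteq># \<delta>}"
      then obtain \<gamma> where "\<delta> = \<beta> + \<gamma>"
        by (auto simp: subset_mset.le_iff_add)
      then show "mfps_const (mfps_nth f \<beta>) * mfps_const (mfps_nth g (\<delta> - \<beta>)) *
          (\<Prod>i\<in>#\<delta>. b i) = ?t (\<beta>, \<delta> - \<beta>)"
        by (simp add: ac_simps)
    qed
    finally show "mfps_const (mfps_nth (f * g) \<delta>) * (\<Prod>i\<in>#\<delta>. b i) =
        (\<Sum>\<beta> | \<beta> \<subseteq># \<delta>. ?t (\<beta>, \<delta> - \<beta>))" .
  qed
  also have "\<dots> = (\<Sum>(\<delta>, \<beta>)\<in>(SIGMA \<delta>:?M. {\<beta>. \<beta> \<subseteq># \<delta>}). ?t (\<beta>, \<delta> - \<beta>))"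
    by (rule sum.Sigma) (auto simp: assms finite_submultisets)
  \<comment> \<open>A monomial with a chosen divisor is the same as a pair of factors.\<close>
  also have "\<dots> = (\<Sum>x | fst x + snd x \<in> ?M. ?t x)"
    by (rule sum.reindex_bij_witness
      [where i = "\<lambda>(\<beta>, \<gamma>). (\<beta> + \<gamma>, \<beta>)" and j = "\<lambda>(\<delta>, \<beta>). (\<beta>, \<delta> - \<beta>)"]) auto
  also have "mfps_cong n \<dots> (\<Sum>x\<in>?M \<times> ?M. ?t x)"
    unfolding mfps_cong_def
  proof (intro allI impI)
    fix \<alpha> :: "nat multiset"
    assume \<alpha>: "size \<alpha> \<le> n"
    have "mfps_nth (?t x) \<alpha> = 0" if "x \<in> ?M \<times> ?M - {x. fst x + snd x \<in> ?M}" for x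
    proof -
      obtain \<beta> \<gamma> where x: "x = (\<beta>, \<gamma>)"
        by fastforce
      have "?t x = mfps_const (mfps_nth f \<beta> * mfps_nth g \<gamma>) * (\<Prod>i\<in>#\<beta>+\<gamma>. b i)"
        by (simp add: x ac_simps mfps_const_mult)
      moreover have "mfps_nth (\<Prod>i\<in>#\<beta>+\<gamma>. b i) \<alpha> = 0"
        using that \<alpha> b by (intro nth_prod_mset_eq_0) (auto simp: x monomials_def)
      ultimately show ?thesis
        by (simp add: mfps_nth_const_mult)
    qed
    then have "(\<Sum>x | fst x + snd x \<in> ?M. mfps_nth (?t x) \<alpha>) =
        (\<Sum>x\<in>?M \<times> ?M. mfps_nth (?t x) \<alpha>)"
      by (intro sum.mono_neutral_left) (auto simp: assms monomials_def finite_monomials[unfolded monomials_def])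
    then show "mfps_nth (\<Sum>x | fst x + snd x \<in> ?M. ?t x) \<alpha> =
        mfps_nth (\<Sum>x\<in>?M \<times> ?M. ?t x) \<alpha>"
      by (simp add: mfps_nth_sum)
  qed
  also have "(\<Sum>x\<in>?M \<times> ?M. ?t x) =
      (\<Sum>\<beta>\<in>?M. mfps_const (mfps_nth f \<beta>) * (\<Prod>i\<in>#\<beta>. b i)) *
      (\<Sum>\<gamma>\<in>?M. mfps_const (mfps_nth g \<gamma>) * (\<Prod>i\<in>#\<gamma>. b i))"
    by (simp add: sum_product sum.cartesian_product)
  also have "mfps_cong n \<dots> (mfps_subst V b f * mfps_subst V b g)"
    by (intro mfps_cong_mult mfps_cong_sym[OF mfps_subst_cong_polynomial] assms)
  finally show "mfps_cong n (mfps_subst V b (f * g)) (mfps_subst V b f * mfps_subst V b g)" .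
qed

lemma mfps_subst_prod_mset:
  assumes "finite V" and "\<And>i. i \<in> V \<Longrightarrow> mfps_const_term (b i) = 0"
  shows "mfps_subst V b (\<Prod>i\<in>#\<beta>. a i) = (\<Prod>i\<in>#\<beta>. mfps_subst V b (a i))"
  by (induction \<beta>) (use assms in \<open>auto simp: mfps_subst_mult\<close>)

lemma mfps_subst_prod:
  assumes "finite V" and "\<And>i. i \<in> V \<Longrightarrow> mfps_const_term (b i) = 0"
  shows "mfps_subst V b (\<Prod>i\<in>A. a i) = (\<Prod>i\<in>A. mfps_subst V b (a i))"
  by (induction A rule: infinite_finite_induct) (use assms in \<open>auto simp: mfps_subst_mult\<close>)

lemma mfps_subst_power:
  assumes "finite V" and "\<And>i. i \<in> V \<Longrightarrow> mfps_const_term (b i) = 0"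
  shows "mfps_subst V b (a ^ n) = mfps_subst V b a ^ n"
  by (induction n) (use assms in \<open>auto simp: mfps_subst_mult\<close>)

lemma mfps_subst_var:
  assumes "finite V" and "i \<in> V" and "mfps_const_term (b i) = 0"
  shows "mfps_subst V b (mfps_var i) = b i"
proof (rule mfps_eqI)
  fix \<alpha>
  have "mfps_nth (mfps_subst V b (mfps_var i)) \<alpha> = (\<Sum>\<beta>\<in>monomials V (size \<alpha>).
      mfps_nth (mfps_var i) \<beta> * mfps_nth (\<Prod>i\<in>#\<beta>. b i) \<alpha>)"
    by (simp add: mfps_subst_def monomials_def)
  also have "\<dots> = (\<Sum>\<beta>\<in>monomials V (size \<alpha>).
      if \<beta> = {#i#} then mfps_nth (b i) \<alpha> else 0)"
    by (rule sum.cong) (auto simp: mfps_nth_var)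
  also have "\<dots> = mfps_nth (b i) \<alpha>"
    using assms by (cases "\<alpha> = {#}") (auto simp: monomials_def mfps_const_term_def
      finite_monomials[unfolded monomials_def] nonempty_has_size)
  finally show "mfps_nth (mfps_subst V b (mfps_var i)) \<alpha> = mfps_nth (b i) \<alpha>" .
qed

text \<open>Substitution respects equality up to degree n, so the inner one may be replaced by a
  polynomial in the \<open>a i\<close>, to which multiplicativity applies.\<close>

lemma mfps_subst_subst:
  assumes "finite V" and b: "\<And>i. i \<in> V \<Longrightarrow> mfps_const_term (b i) = 0"
    and "finite W" and a: "\<And>i. i \<in> W \<Longrightarrow> mfps_const_term (a i) = 0"
  shows "mfps_subst V b (mfps_subst W a f) = mfps_subst W (\<lambda>i. mfps_subst V b (a i)) f"
proof (rule mfps_cong_eqI)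
  fix n
  have "mfps_cong n (mfps_subst V b (mfps_subst W a f)) (mfps_subst V b
      (\<Sum>\<beta>\<in>monomials W n. mfps_const (mfps_nth f \<beta>) * (\<Prod>i\<in>#\<beta>. a i)))"
    by (intro mfps_subst_degree_cong mfps_subst_cong_polynomial assms)
  also have "mfps_subst V b
      (\<Sum>\<beta>\<in>monomials W n. mfps_const (mfps_nth f \<beta>) * (\<Prod>i\<in>#\<beta>. a i)) =
    (\<Sum>\<beta>\<in>monomials W n. mfps_const (mfps_nth f \<beta>) * (\<Prod>i\<in>#\<beta>. mfps_subst V b (a i)))"
    by (simp add: mfps_subst_sum mfps_subst_const_mult mfps_subst_prod_mset[OF assms(1) b])
  also have "mfps_cong n \<dots> (mfps_subst W (\<lambda>i. mfps_subst V b (a i)) f)"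
    by (intro mfps_cong_sym[OF mfps_subst_cong_polynomial] assms) (simp add: a)
  finally show "mfps_cong n (mfps_subst V b (mfps_subst W a f))
      (mfps_subst W (\<lambda>i. mfps_subst V b (a i)) f)" .
qed

lemma mfps_subst_fps_subst:
  assumes "finite V" and b: "\<And>i. i \<in> V \<Longrightarrow> mfps_const_term (b i) = 0"
    and u: "mfps_const_term u = 0"
  shows "mfps_subst V b (fps_subst u f) = fps_subst (mfps_subst V b u) f"
proof (rule mfps_cong_eqI)
  fix n
  have "mfps_cong n (mfps_subst V b (fps_subst u f)) (mfps_subst V b
      (\<Sum>k\<le>n. mfps_const (fps_nth f k) * u ^ k))"
    by (intro mfps_subst_degree_cong fps_subst_cong_polynomial assms)
  also have "mfps_subst V b (\<Sum>k\<le>n. mfps_const (fps_nth f k) * u ^ k) =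
    (\<Sum>k\<le>n. mfps_const (fps_nth f k) * mfps_subst V b u ^ k)"
    by (simp add: mfps_subst_sum mfps_subst_const_mult mfps_subst_power[OF assms(1) b])
  also have "mfps_cong n \<dots> (fps_subst (mfps_subst V b u) f)"
    by (intro mfps_cong_sym[OF fps_subst_cong_polynomial]) (simp add: u)
  finally show "mfps_cong n (mfps_subst V b (fps_subst u f)) (fps_subst (mfps_subst V b u) f)" .
qed

section \<open>Substitution into a power series in one variable\<close>

lemma fps_subst_add: "fps_subst u (f + g) = fps_subst u f + fps_subst u g"
  by (rule mfps_eqI) (simp add: fps_subst_def sum.distrib algebra_simps)

lemma const_term_fps_subst [simp]: "mfps_const_term (fps_subst u f) = fps_nth f 0"
  by (simp add: mfps_const_term_def fps_subst_def)

lemma fps_subst_const [simp]: "fps_subst u (fps_const c) = mfps_const c"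
proof (rule mfps_eqI)
  fix \<alpha>
  have "(\<Sum>n\<le>size \<alpha>. fps_nth (fps_const c) n * mfps_nth (u ^ n) \<alpha>) =
      (\<Sum>n\<in>{0}. fps_nth (fps_const c) n * mfps_nth (u ^ n) \<alpha>)"
    by (intro sum.mono_neutral_right) auto
  then show "mfps_nth (fps_subst u (fps_const c)) \<alpha> = mfps_nth (mfps_const c) \<alpha>"
    by (simp add: fps_subst_def) (simp add: mfps_const_def)
qed

lemma fps_subst_1 [simp]: "fps_subst u 1 = 1"
  using fps_subst_const[of u 1] by (simp del: fps_subst_const)

lemma fps_subst_X:
  assumes "mfps_const_term u = 0"
  shows "fps_subst u fps_X = u"
proof (rule mfps_eqI)
  fix \<alpha>
  have "(\<Sum>n\<le>size \<alpha>. fps_nth fps_X n * mfps_nth (u ^ n) \<alpha>) =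
      (\<Sum>n\<le>size \<alpha>. if n = 1 then mfps_nth u \<alpha> else 0)"
    by (rule sum.cong) auto
  also have "\<dots> = mfps_nth u \<alpha>"
    using assms by (cases "\<alpha> = {#}") (auto simp: mfps_const_term_def nonempty_has_size)
  finally show "mfps_nth (fps_subst u fps_X) \<alpha> = mfps_nth u \<alpha>"
    by (simp add: fps_subst_def)
qed

text \<open>The argument of \<open>mfps_subst_mult\<close> again: up to degree n the triangle of
  exponents \<open>i + j \<le> n\<close> may be enlarged to a square.\<close>

lemma fps_subst_mult:
  assumes "mfps_const_term u = 0"
  shows "fps_subst u (f * g) = fps_subst u f * fps_subst u g"
proof (rule mfps_cong_eqI)
  fix n
  let ?t = "\<lambda>(i, j). mfps_const (fps_nth f i) * u ^ i * (mfps_const (fps_nth g j) * u ^ j)"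
  have "mfps_cong n (fps_subst u (f * g)) (\<Sum>k\<le>n. mfps_const (fps_nth (f * g) k) * u ^ k)"
    by (intro fps_subst_cong_polynomial assms)
  also have "(\<Sum>k\<le>n. mfps_const (fps_nth (f * g) k) * u ^ k) = (\<Sum>k\<le>n. \<Sum>i\<le>k. ?t (i, k - i))"
  proof (rule sum.cong[OF refl])
    fix k
    have "mfps_const (fps_nth (f * g) k) * u ^ k =
        (\<Sum>i\<le>k. mfps_const (fps_nth f i) * mfps_const (fps_nth g (k - i)) * u ^ (i + (k - i)))"
      by (simp add: fps_mult_nth mfps_const_sum mfps_const_mult sum_distrib_right atLeast0AtMost)
    then show "mfps_const (fps_nth (f * g) k) * u ^ k = (\<Sum>i\<le>k. ?t (i, k - i))"
      by (simp only: power_add ac_simps case_prod_conv)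
  qed
  also have "\<dots> = (\<Sum>x\<in>{(i, j). i + j \<le> n}. ?t x)"
    using sum.triangle_reindex_eq[of "\<lambda>i j. ?t (i, j)" n] by simp
  also have "mfps_cong n \<dots> (\<Sum>x\<in>{..n} \<times> {..n}. ?t x)"
    unfolding mfps_cong_def
  proof (intro allI impI)
    fix \<alpha> :: "nat multiset"
    assume \<alpha>: "size \<alpha> \<le> n"
    have "mfps_nth (?t x) \<alpha> = 0" if "x \<in> {..n} \<times> {..n} - {(i, j). i + j \<le> n}" for x
    proof -
      obtain i j where x: "x = (i, j)"
        by fastforce
      have "?t x = mfps_const (fps_nth f i * fps_nth g j) * u ^ (i + j)"
        by (simp add: x ac_simps mfps_const_mult power_add)
      moreover have "mfps_nth (u ^ (i + j)) \<alpha> = 0"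
        using that \<alpha> assms by (intro nth_power_eq_0) (auto simp: x)
      ultimately show ?thesis
        by (simp add: mfps_nth_const_mult)
    qed
    then have "(\<Sum>x\<in>{(i, j). i + j \<le> n}. mfps_nth (?t x) \<alpha>) =
        (\<Sum>x\<in>{..n} \<times> {..n}. mfps_nth (?t x) \<alpha>)"
      by (intro sum.mono_neutral_left) auto
    then show "mfps_nth (\<Sum>x\<in>{(i, j). i + j \<le> n}. ?t x) \<alpha> =
        mfps_nth (\<Sum>x\<in>{..n} \<times> {..n}. ?t x) \<alpha>"
      by (simp add: mfps_nth_sum)
  qed
  also have "(\<Sum>x\<in>{..n} \<times> {..n}. ?t x) = (\<Sum>i\<le>n. mfps_const (fps_nth f i) * u ^ i) *
      (\<Sum>j\<le>n. mfps_const (fps_nth g j) * u ^ j)"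
    by (simp add: sum_product sum.cartesian_product)
  also have "mfps_cong n \<dots> (fps_subst u f * fps_subst u g)"
    by (intro mfps_cong_mult mfps_cong_sym[OF fps_subst_cong_polynomial] assms)
  finally show "mfps_cong n (fps_subst u (f * g)) (fps_subst u f * fps_subst u g)" .
qed

section \<open>Subrings, units and coefficient extension\<close>

lemma mfps_over_0 [simp]: "0 \<in> mfps_over V"
  and mfps_over_1 [simp]: "1 \<in> mfps_over V"
  and mfps_over_const [simp]: "mfps_const c \<in> mfps_over V"
  by (auto simp: mfps_over_def mfps_const_def)

lemma mfps_over_var: "i \<in> V \<Longrightarrow> mfps_var i \<in> mfps_over V"
  by (auto simp: mfps_over_def mfps_nth_var)

lemma mfps_over_mono: "V \<subseteq> W \<Longrightarrow> f \<in> mfps_over V \<Longrightarrow> f \<in> mfps_over W"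
  by (auto simp: mfps_over_def)

lemma mfps_over_mult:
  assumes "f \<in> mfps_over V" and "g \<in> mfps_over V"
  shows "f * g \<in> mfps_over V"
proof -
  have "mfps_nth f \<beta> * mfps_nth g (\<alpha> - \<beta>) = 0"
    if "\<not> set_mset \<alpha> \<subseteq> V" "\<beta> \<subseteq># \<alpha>" for \<alpha> \<beta>
  proof -
    have "set_mset \<alpha> = set_mset \<beta> \<union> set_mset (\<alpha> - \<beta>)"
      using that(2) by (metis set_mset_union subset_mset.add_diff_inverse)
    then show ?thesis
      using that(1) assms by (auto simp: mfps_over_def)
  qed
  then show ?thesis
    by (auto simp: mfps_over_def times_mfps.rep_eq)
qed

lemma mfps_over_prod: "(\<And>x. x \<in> A \<Longrightarrow> f x \<in> mfps_over V) \<Longrightarrow> (\<Prod>x\<in>A. f x) \<in> mfps_over V"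
  by (induction A rule: infinite_finite_induct) (auto simp: mfps_over_mult)

lemma mfps_over_prod_mset:
  "(\<And>x. x \<in># \<beta> \<Longrightarrow> f x \<in> mfps_over V) \<Longrightarrow> (\<Prod>x\<in>#\<beta>. f x) \<in> mfps_over V"
  by (induction \<beta>) (auto simp: mfps_over_mult)

lemma mfps_over_power: "f \<in> mfps_over V \<Longrightarrow> f ^ n \<in> mfps_over V"
  by (induction n) (auto simp: mfps_over_mult)

lemma mfps_over_subst:
  assumes "\<And>i. i \<in> V \<Longrightarrow> b i \<in> mfps_over W"
  shows "mfps_subst V b f \<in> mfps_over W"
proof -
  have "mfps_nth (\<Prod>i\<in>#\<beta>. b i) \<alpha> = 0" if "set_mset \<beta> \<subseteq> V" "\<not> set_mset \<alpha> \<subseteq> W" for \<alpha> \<beta>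
    using mfps_over_prod_mset[of \<beta> b W] assms that by (auto simp: mfps_over_def)
  then show ?thesis
    by (auto simp: mfps_over_def mfps_subst_def intro!: sum.neutral)
qed

lemma mfps_over_fps_subst: "u \<in> mfps_over V \<Longrightarrow> fps_subst u f \<in> mfps_over V"
  using mfps_over_power[of u V]
  by (auto simp: mfps_over_def fps_subst_def intro!: sum.neutral)

text \<open>The inverse of \<open>1 - h\<close> is the geometric series in \<open>h\<close>.\<close>

lemma mfps_unit:
  assumes "mfps_const_term f * c = 1" and "f \<in> mfps_over V"
  obtains g where "g \<in> mfps_over V" and "f * g = 1"
proof
  define h where "h = 1 - mfps_const c * f"
  have h: "mfps_const_term h = 0"
  proof -
    have "mfps_const_term h + mfps_const_term (mfps_const c * f) = mfps_const_term (h + mfps_const c * f)"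
      by (rule const_term_add[symmetric])
    also have "\<dots> = 1"
      by (simp add: h_def)
    finally show ?thesis
      using assms by (simp add: mult.commute)
  qed
  let ?s = "fps_subst h (Abs_fps (\<lambda>_. 1))"
  \<comment> \<open>The geometric series S satisfies S = 1 + x S. Substituting h gives (1 - h) S(h)
    = 1, and 1 - h is the constant c times f.\<close>
  have "(1 - fps_X) * Abs_fps (\<lambda>_. 1 :: 'a) = 1"
    by (rule fps_ext) (simp add: left_diff_distrib)
  then have "Abs_fps (\<lambda>_. 1 :: 'a) = 1 + fps_X * Abs_fps (\<lambda>_. 1)"
    by (simp add: algebra_simps)
  then have "?s = fps_subst h (1 + fps_X * Abs_fps (\<lambda>_. 1))"
    by simp
  also have "\<dots> = 1 + h * ?s"
    by (simp add: fps_subst_add fps_subst_mult fps_subst_X h)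
  finally show "f * (mfps_const c * ?s) = 1"
    by (simp add: h_def algebra_simps)
  have "h \<in> mfps_over V"
    using mfps_over_mult[OF mfps_over_const[of c V] assms(2)]
    by (auto simp: mfps_over_def h_def minus_mfps.rep_eq)
  then show "mfps_const c * ?s \<in> mfps_over V"
    by (intro mfps_over_mult mfps_over_fps_subst) auto
qed

section \<open>Extension of coefficients along a ring map\<close>

lemma mfps_map_nth [simp]: "mfps_nth (mfps_map h f) \<alpha> = h (mfps_nth f \<alpha>)"
  by (simp add: mfps_map_def)

locale ring_hom =
  fixes h :: "'a::comm_ring_1 \<Rightarrow> 'b::comm_ring_1"
  assumes hom_add: "h (a + b) = h a + h b"
    and hom_mult: "h (a * b) = h a * h b"
    and hom_1 [simp]: "h 1 = 1"
begin

lemma hom_0 [simp]: "h 0 = 0"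
  using hom_add[of 0 0] by simp

lemma hom_sum: "h (\<Sum>x\<in>A. f x) = (\<Sum>x\<in>A. h (f x))"
  by (induction A rule: infinite_finite_induct) (auto simp: hom_add)

lemma hom_prod: "h (\<Prod>x\<in>A. f x) = (\<Prod>x\<in>A. h (f x))"
  by (induction A rule: infinite_finite_induct) (auto simp: hom_mult)

lemma hom_power: "h (x ^ n) = h x ^ n"
  by (induction n) (auto simp: hom_mult)

end

context ring_hom
begin

lemma mfps_map_mult: "mfps_map h (f * g) = mfps_map h f * mfps_map h g"
  by (rule mfps_eqI) (simp add: hom_sum hom_mult times_mfps.rep_eq)

lemma mfps_map_0 [simp]: "mfps_map h 0 = 0"
  by (rule mfps_eqI) simp

lemma mfps_map_1 [simp]: "mfps_map h 1 = 1"
  by (rule mfps_eqI) simp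

lemma mfps_map_var [simp]: "mfps_map h (mfps_var i) = mfps_var i"
  by (rule mfps_eqI) (simp add: mfps_nth_var)

lemma mfps_map_power: "mfps_map h (f ^ n) = mfps_map h f ^ n"
  by (induction n) (auto simp: mfps_map_mult)

lemma mfps_map_prod_mset: "mfps_map h (\<Prod>i\<in>#\<beta>. f i) = (\<Prod>i\<in>#\<beta>. mfps_map h (f i))"
  by (induction \<beta>) (auto simp: mfps_map_mult)

lemma const_term_map [simp]: "mfps_const_term (mfps_map h f) = h (mfps_const_term f)"
  by (simp add: mfps_const_term_def)

lemma mfps_map_subst:
  "mfps_map h (mfps_subst V b f) = mfps_subst V (\<lambda>i. mfps_map h (b i)) (mfps_map h f)"
  by (rule mfps_eqI)
    (simp add: mfps_subst_def hom_sum hom_mult, simp flip: mfps_map_prod_mset)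

lemma mfps_map_fps_subst:
  "mfps_map h (fps_subst u f) = fps_subst (mfps_map h u) (Abs_fps (\<lambda>n. h (fps_nth f n)))"
  by (rule mfps_eqI) (simp add: fps_subst_def hom_sum hom_mult, simp flip: mfps_map_power)

lemma mfps_over_map: "f \<in> mfps_over V \<Longrightarrow> mfps_map h f \<in> mfps_over V"
  by (auto simp: mfps_over_def)

end

lemma ring_hom_fps_subst: "mfps_const_term u = 0 \<Longrightarrow> ring_hom (fps_subst u)"
  by unfold_locales (simp_all add: fps_subst_add fps_subst_mult)

lemma ring_hom_mfps_subst:
  assumes "finite V" and "\<And>i. i \<in> V \<Longrightarrow> mfps_const_term (b i) = 0"
  shows "ring_hom (mfps_subst V b)"
  by unfold_locales (simp_all add: mfps_subst_add mfps_subst_mult assms)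

lemma ring_hom_const_term: "ring_hom mfps_const_term"
  by unfold_locales simp_all

lemma ring_hom_comp: "ring_hom h \<Longrightarrow> ring_hom g \<Longrightarrow> ring_hom (h \<circ> g)"
  by (simp add: ring_hom_def)

section \<open>Sums of points\<close>

lemma const_term_fg_add [simp]: "mfps_const_term (fg_add F a b) = mfps_const_term F"
  by (simp add: fg_add_def)

lemma fg_add_over:
  "a \<in> mfps_over V \<Longrightarrow> b \<in> mfps_over V \<Longrightarrow> fg_add F a b \<in> mfps_over V"
  by (auto simp: fg_add_def intro!: mfps_over_subst)

lemma mfps_subst_fg_add:
  assumes "finite V" and "\<And>i. i \<in> V \<Longrightarrow> mfps_const_term (b i) = 0"
    and "mfps_const_term u = 0" and "mfps_const_term v = 0"
  shows "mfps_subst V b (fg_add F u v) = fg_add F (mfps_subst V b u) (mfps_subst V b v)"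
  unfolding fg_add_def
  by (subst mfps_subst_subst) (use assms in \<open>auto intro!: mfps_subst_cong\<close>)

lemma (in ring_hom) mfps_map_fg_add:
  "mfps_map h (fg_add F a b) = fg_add (mfps_map h F) (mfps_map h a) (mfps_map h b)"
  unfolding fg_add_def mfps_map_subst by (rule mfps_subst_cong) auto

lemma (in ring_hom) formal_group_map: "formal_group F \<Longrightarrow> formal_group (mfps_map h F)"
  unfolding formal_group_def
  by (metis mfps_map_0 mfps_map_fg_add mfps_map_var mfps_over_map)

locale formal_group_law =
  fixes F :: "'a::comm_ring_1 mfps"
  assumes formal_group: "formal_group F"
begin

text \<open>Substitution keeps constant terms, so F(x_1, 0) = x_1 forces that of F to
  vanish.\<close>

lemma const_term_law [simp]: "mfps_const_term F = 0"
proof -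
  have "mfps_const_term F = mfps_const_term (fg_add F (mfps_var 1) 0)"
    by simp
  also have "\<dots> = mfps_const_term (mfps_var 1 :: 'a mfps)"
    using formal_group by (simp add: formal_group_def del: const_term_fg_add)
  finally show ?thesis
    by simp
qed

text \<open>The axioms concern variables; substitution carries them to arbitrary series without
  constant term, which are the points of the formal group.\<close>

lemma add_assoc:
  assumes a: "mfps_const_term a = 0" "mfps_const_term b = 0" "mfps_const_term c = 0"
  shows "fg_add F (fg_add F a b) c = fg_add F a (fg_add F b c)"
proof -
  let ?h = "mfps_subst {1, 2, 3} (\<lambda>i. if i = 1 then a else if i = 2 then b else c)"
  have "?h (fg_add F (fg_add F (mfps_var 1) (mfps_var 2)) (mfps_var 3)) =
      ?h (fg_add F (mfps_var 1) (fg_add F (mfps_var 2) (mfps_var 3)))"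
    using formal_group unfolding formal_group_def by metis
  then show ?thesis
    using a by (simp add: mfps_subst_fg_add mfps_subst_var)
qed

lemma add_commute:
  assumes a: "mfps_const_term a = 0" "mfps_const_term b = 0"
  shows "fg_add F a b = fg_add F b a"
proof -
  let ?h = "mfps_subst {1, 2} (\<lambda>i. if i = 1 then a else b)"
  have "?h (fg_add F (mfps_var 1) (mfps_var 2)) = ?h (fg_add F (mfps_var 2) (mfps_var 1))"
    using formal_group unfolding formal_group_def by metis
  then show ?thesis
    using a by (simp add: mfps_subst_fg_add mfps_subst_var)
qed

lemma add_0_right:
  assumes a: "mfps_const_term a = 0"
  shows "fg_add F a 0 = a"
proof -
  let ?h = "mfps_subst {1} (\<lambda>i. a)"
  have "?h (fg_add F (mfps_var 1) 0) = ?h (mfps_var 1)"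
    using formal_group unfolding formal_group_def by metis
  then show ?thesis
    using a by (simp add: mfps_subst_fg_add mfps_subst_var)
qed

lemma add_0_left: "mfps_const_term a = 0 \<Longrightarrow> fg_add F 0 a = a"
  using add_0_right[of a] add_commute[of 0 a] by simp

lemma fg_sum_empty [simp]: "fg_sum F {} = 0"
  by (simp add: fg_sum_def)

lemma const_term_foldr_add [simp]:
  "mfps_const_term (foldr (\<lambda>i. fg_add F (mfps_var i)) xs 0) = 0"
  by (induction xs) auto

lemma const_term_fg_sum [simp]: "mfps_const_term (fg_sum F I) = 0"
  by (simp add: fg_sum_def)

text \<open>\<open>fg_sum\<close> runs through a sorted list; commutativity and associativity let
  the inserted point move to the front, whatever its rank.\<close>

lemma foldr_add_insort:
  "foldr (\<lambda>i. fg_add F (mfps_var i)) (insort x xs) 0 =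
    fg_add F (mfps_var x) (foldr (\<lambda>i. fg_add F (mfps_var i)) xs 0)"
proof (induction xs)
  case (Cons y xs)
  let ?S = "foldr (\<lambda>i. fg_add F (mfps_var i)) xs 0"
  have "fg_add F (mfps_var y) (fg_add F (mfps_var x) ?S) =
      fg_add F (mfps_var x) (fg_add F (mfps_var y) ?S)"
    by (simp flip: add_assoc add: add_commute[of "mfps_var y" "mfps_var x"])
  then show ?case
    using Cons by simp
qed simp

lemma fg_sum_insert:
  "finite I \<Longrightarrow> i \<notin> I \<Longrightarrow> fg_sum F (insert i I) = fg_add F (mfps_var i) (fg_sum F I)"
  by (simp add: fg_sum_def sorted_list_of_set_insert_remove foldr_add_insort)

lemma fg_sum_single [simp]: "fg_sum F {i} = mfps_var i"
  using fg_sum_insert[of "{}" i] by (simp add: add_0_right)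

lemma fg_sum_over: "finite I \<Longrightarrow> fg_sum F I \<in> mfps_over I"
proof (induction I rule: finite_induct)
  case (insert i I)
  then show ?case
    by (auto simp: fg_sum_insert intro!: fg_add_over mfps_over_var intro: mfps_over_mono[of I])
qed simp

lemma fg_sum_Un:
  assumes "finite A" and "finite B" and "A \<inter> B = {}"
  shows "fg_sum F (A \<union> B) = fg_add F (fg_sum F A) (fg_sum F B)"
  using assms by (induction A rule: finite_induct) (auto simp: fg_sum_insert add_0_left add_assoc)

text \<open>The maps between powers of G used below have as components sums of points over disjoint
  sets: permutations, cocycle maps and, with empty sets for the point 0, inclusions of axes.\<close>

lemma mfps_subst_fg_sum:
  assumes "finite V" and "I \<subseteq> V" and "\<And>i. i \<in> V \<Longrightarrow> finite (S i)"
    and "disjoint_family_on S V"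
  shows "mfps_subst V (\<lambda>i. fg_sum F (S i)) (fg_sum F I) = fg_sum F (\<Union>i\<in>I. S i)"
proof -
  have "finite I"
    using assms finite_subset by blast
  then show ?thesis
    using assms(2)
  proof (induction I rule: finite_induct)
    case (insert i I)
    then have "S i \<inter> \<Union> (S ` I) = {}"
      using assms(4) by (fastforce simp: disjoint_family_on_def)
    then show ?case
      using insert assms
      by (simp add: fg_sum_insert mfps_subst_fg_add mfps_subst_var fg_sum_Un subset_iff)
  qed simp
qed

lemma fg_sum_pair: "i \<noteq> j \<Longrightarrow> fg_sum F {i, j} = fg_add F (mfps_var i) (mfps_var j)"
  using fg_sum_insert[of "{j}" i] by simp

lemma mfps_subst_mu:
  assumes "finite V" and "I \<subseteq> V" and "\<And>i. i \<in> V \<Longrightarrow> finite (S i)"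
    and "disjoint_family_on S V" and "\<And>i. i \<in> V \<Longrightarrow> b i = fg_sum F (S i)"
  shows "mfps_subst V b \<circ> mu F I = mu F (\<Union>i\<in>I. S i)"
proof -
  have "mfps_subst V b (fg_sum F I) = fg_sum F (\<Union>i\<in>I. S i)"
    using mfps_subst_fg_sum[OF assms(1-4)] assms(5) mfps_subst_cong[of V b "\<lambda>i. fg_sum F (S i)"]
    by simp
  then show ?thesis
    using assms by (auto simp: mu_def fun_eq_iff mfps_subst_fps_subst)
qed

lemma ring_hom_mu: "ring_hom (mu F I)"
  by (simp add: mu_def ring_hom_fps_subst)

lemma mu_over: "finite I \<Longrightarrow> I \<subseteq> V \<Longrightarrow> mu F I f \<in> mfps_over V"
  using mfps_over_mono[OF _ fg_sum_over] by (auto simp: mu_def intro: mfps_over_fps_subst)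

lemma mfps_subst_single_fg_sum:
  assumes "finite I"
  shows "mfps_subst I (\<lambda>i. if i = q then mfps_var q else 0) (fg_sum F I) =
    (if q \<in> I then mfps_var q else 0)"
proof -
  \<comment> \<open>The empty sum encodes the point 0.\<close>
  define S where "S = (\<lambda>i::nat. if i = q then {q} else {})"
  have "mfps_subst I (\<lambda>i. if i = q then mfps_var q else 0) (fg_sum F I) =
      mfps_subst I (\<lambda>i. fg_sum F (S i)) (fg_sum F I)"
    by (rule mfps_subst_cong) (simp add: S_def)
  also have "\<dots> = fg_sum F (\<Union>i\<in>I. S i)"
    using assms by (intro mfps_subst_fg_sum) (auto simp: S_def disjoint_family_on_def)
  also have "(\<Union>i\<in>I. S i) = (if q \<in> I then {q} else {})"
    by (auto simp: S_def)
  finally show ?thesis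
    by simp
qed

end

section \<open>Restriction of a series to a coordinate axis\<close>

lemma add_mset_eq_replicate_mset_iff:
  "add_mset x \<beta> = add_mset q (replicate_mset n q) \<longleftrightarrow> x = q \<and> \<beta> = replicate_mset n q"
  by (metis add_mset_add_single add_right_cancel in_replicate_mset replicate_mset_Suc
    union_single_eq_member)

lemma mfps_var_power_nth:
  "mfps_nth (mfps_var q ^ k :: 'a::comm_ring_1 mfps) \<alpha> = (if \<alpha> = replicate_mset k q then 1 else 0)"
proof (induction k arbitrary: \<alpha>)
  case (Suc k)
  have "mfps_nth (mfps_var q ^ Suc k :: 'a mfps) \<alpha> =
      (\<Sum>\<beta> | \<beta> \<subseteq># \<alpha>. if \<beta> = {#q#} then mfps_nth (mfps_var q ^ k) (\<alpha> - {#q#}) else 0)"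
    unfolding power_Suc times_mfps.rep_eq by (rule sum.cong) (auto simp: mfps_nth_var)
  also have "\<dots> = (if q \<in># \<alpha> then mfps_nth (mfps_var q ^ k) (\<alpha> - {#q#}) else 0)"
    by (simp add: finite_submultisets)
  also have "\<dots> = (if \<alpha> = replicate_mset (Suc k) q then 1 else 0)"
    unfolding Suc.IH by (auto dest: insert_DiffM)
  finally show ?case .
qed simp

text \<open>A monomial with an entry other than q becomes 0 on the q-th axis, and the powers of x_q
  stay as they are.\<close>

lemma mfps_nth_subst_single:
  assumes "finite V" and "q \<in> V"
  shows "mfps_nth (mfps_subst V (\<lambda>i. if i = q then mfps_var q else 0) f) (replicate_mset k q) =
    mfps_nth f (replicate_mset k q)"
proof -
  let ?b = "\<lambda>i. if i = q then mfps_var q else (0 :: 'a mfps)"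
  have prod: "(\<Prod>i\<in>#\<beta>. ?b i) = (if \<beta> = replicate_mset (size \<beta>) q then mfps_var q ^ size \<beta> else 0)"
    for \<beta>
    by (induction \<beta>) (auto simp: add_mset_eq_replicate_mset_iff)
  have "mfps_nth (mfps_subst V ?b f) (replicate_mset k q) =
      (\<Sum>\<beta>\<in>monomials V k. mfps_nth f \<beta> * mfps_nth (\<Prod>i\<in>#\<beta>. ?b i) (replicate_mset k q))"
    by (simp add: mfps_subst_def monomials_def)
  also have "\<dots> = (\<Sum>\<beta>\<in>monomials V k. if \<beta> = replicate_mset k q then mfps_nth f \<beta> else 0)"
    unfolding prod by (rule sum.cong) (auto simp: mfps_var_power_nth)
  also have "\<dots> = mfps_nth f (replicate_mset k q)"
    using assms by (auto simp: monomials_def finite_monomials[unfolded monomials_def]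
      split: if_splits)
  finally show ?thesis .
qed

text \<open>On the q-th axis all other points are 0, so the sum is the point x_q or the point 0.
  This yields the linear part for \<open>mu_inj\<close> and later the unit y.\<close>

lemma (in formal_group_law) fg_sum_nth_single:
  assumes "finite I"
  shows "mfps_nth (fg_sum F I) (replicate_mset k q) = (if q \<in> I \<and> k = 1 then 1 else 0)"
proof (cases "q \<in> I")
  case True
  have "mfps_nth (fg_sum F I) (replicate_mset k q) = mfps_nth (mfps_var q) (replicate_mset k q)"
    using mfps_nth_subst_single[OF assms True, of "fg_sum F I" k]
    unfolding mfps_subst_single_fg_sum[OF assms] using True by simp
  moreover have "replicate_mset k q = {#q#} \<longleftrightarrow> k = 1"
    by (metis One_nat_def replicate_mset_0 replicate_mset_Suc size_replicate_mset size_single)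
  ultimately show ?thesis
    using True by (simp only: mfps_nth_var) simp
next
  case False
  then have "mfps_nth (fg_sum F I) (replicate_mset k q) = 0" if "k > 0"
    using fg_sum_over[OF assms] that by (auto simp: mfps_over_def set_mset_replicate_mset_subset)
  moreover have "mfps_nth (fg_sum F I) {#} = 0"
    using const_term_fg_sum[of I] by (simp add: mfps_const_term_def)
  ultimately show ?thesis
    using False by (cases "k = 0") auto
qed

text \<open>The linear part of \<open>\<Sum>i\<in>I. a\<^sub>i\<close> determines \<open>I\<close>.\<close>

lemma (in formal_group_law) mu_inj:
  assumes "finite I" and "finite J" and "mu F I = mu F J"
  shows "I = J"
proof -
  \<comment> \<open>The coordinate of the sum is the image of \<open>fps_X\<close>.\<close>
  have "fg_sum F I = fg_sum F J"
    using assms(3) by (metis const_term_fg_sum fps_subst_X mu_def)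
  then have "(if q \<in> I then 1 else (0::'a)) = (if q \<in> J then 1 else 0)" for q
    using fg_sum_nth_single[OF assms(1), of 1 q] fg_sum_nth_single[OF assms(2), of 1 q] by simp
  then show ?thesis
    by (metis one_neq_zero subsetI subset_antisym)
qed

section \<open>Restriction to the punctured formal group\<close>

lemma ring_hom_fls_const: "ring_hom (fls_const :: 'a::comm_ring_1 \<Rightarrow> 'a fls)"
  by unfold_locales (simp_all add: fls_plus_const)

lemma ring_hom_fps_to_fls: "ring_hom (fps_to_fls :: 'a::comm_ring_1 fps \<Rightarrow> 'a fls)"
  by unfold_locales (simp_all add: fls_times_fps_to_fls)

interpretation fls_const: ring_hom "fls_const :: 'a::comm_ring_1 \<Rightarrow> 'a fls"
  by (rule ring_hom_fls_const)

interpretation fps_to_fls: ring_hom "fps_to_fls :: 'a::comm_ring_1 fps \<Rightarrow> 'a fls"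
  by (rule ring_hom_fps_to_fls)

lemma to_punctured_nth:
  "mfps_nth (to_punctured q f) \<alpha> = (if q \<in># \<alpha> then 0
     else fps_to_fls (Abs_fps (\<lambda>k. mfps_nth f (\<alpha> + replicate_mset k q))))"
  by (simp add: to_punctured_def)

text \<open>A submultiset splits uniquely into a part without q and some copies of q.\<close>

lemma submultisets_add_replicate_mset:
  assumes "q \<notin># \<alpha>"
  shows "(\<Sum>\<gamma> | \<gamma> \<subseteq># \<alpha> + replicate_mset k q. h \<gamma>) =
    (\<Sum>\<beta> | \<beta> \<subseteq># \<alpha>. \<Sum>j = 0..k. h (\<beta> + replicate_mset j q))"
proof -
  have "(\<Sum>\<gamma> | \<gamma> \<subseteq># \<alpha> + replicate_mset k q. h \<gamma>) =
      (\<Sum>(\<beta>, j)\<in>{\<beta>. \<beta> \<subseteq># \<alpha>} \<times> {0..k}. h (\<beta> + replicate_mset j q))"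
  proof (rule sum.reindex_bij_witness
      [where i = "\<lambda>(\<beta>, j). \<beta> + replicate_mset j q"
        and j = "\<lambda>\<gamma>. (filter_mset (\<lambda>i. i \<noteq> q) \<gamma>, count \<gamma> q)"])
    show "(case (filter_mset (\<lambda>i. i \<noteq> q) \<gamma>, count \<gamma> q) of (\<beta>, j) \<Rightarrow> \<beta> + replicate_mset j q) = \<gamma>"
      for \<gamma>
      by (auto intro!: multiset_eqI)
    then show "(case (filter_mset (\<lambda>i. i \<noteq> q) \<gamma>, count \<gamma> q) of (\<beta>, j) \<Rightarrow> h (\<beta> + replicate_mset j q)) = h \<gamma>"
      for \<gamma>
      by simp
    show "(filter_mset (\<lambda>i. i \<noteq> q) \<gamma>, count \<gamma> q) \<in> {\<beta>. \<beta> \<subseteq># \<alpha>} \<times> {0..k}"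
      if "\<gamma> \<in> {\<gamma>. \<gamma> \<subseteq># \<alpha> + replicate_mset k q}" for \<gamma>
    proof -
      have *: "count \<gamma> i \<le> count \<alpha> i + (if i = q then k else 0)" for i
        using that by (auto simp: subseteq_mset_def dest: spec[of _ i])
      have "count \<gamma> i \<le> count \<alpha> i" if "i \<noteq> q" for i
        using *[of i] that by simp
      moreover have "count \<gamma> q \<le> k"
        using *[of q] assms by (simp add: not_in_iff)
      ultimately show ?thesis
        by (auto simp: subseteq_mset_def)
    qed
    show "(case x of (\<beta>, j) \<Rightarrow> \<beta> + replicate_mset j q) \<in> {\<gamma>. \<gamma> \<subseteq># \<alpha> + replicate_mset k q}"
      if "x \<in> {\<beta>. \<beta> \<subseteq># \<alpha>} \<times> {0..k}" for x
      using that by (auto simp: subseteq_mset_def add_mono)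
    show "(filter_mset (\<lambda>i. i \<noteq> q) (case x of (\<beta>, j) \<Rightarrow> \<beta> + replicate_mset j q),
        count (case x of (\<beta>, j) \<Rightarrow> \<beta> + replicate_mset j q) q) = x"
      if *: "x \<in> {\<beta>. \<beta> \<subseteq># \<alpha>} \<times> {0..k}" for x
    proof -
      obtain \<beta> j where x: "x = (\<beta>, j)" "\<beta> \<subseteq># \<alpha>"
        using * by auto
      then have "q \<notin># \<beta>"
        using assms by (auto dest: mset_subset_eqD)
      then show ?thesis
        using x by (auto simp: not_in_iff intro!: multiset_eqI)
    qed
  qed
  then show ?thesis
    by (simp add: sum.cartesian_product)
qed

text \<open>Series in the x_i and x_q are regrouped as series in the x_i over R[[x_q]]: the product
  runs over the divisors of \<open>\<alpha>\<close> and is, for each of them, a Cauchy product in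
  x_q.\<close>

lemma to_punctured_mult: "to_punctured q (f * g) = to_punctured q f * to_punctured q g"
proof (rule mfps_eqI)
  fix \<alpha>
  let ?c = "\<lambda>f \<alpha>. Abs_fps (\<lambda>k. mfps_nth f (\<alpha> + replicate_mset k q))"
  show "mfps_nth (to_punctured q (f * g)) \<alpha> = mfps_nth (to_punctured q f * to_punctured q g) \<alpha>"
  proof (cases "q \<in># \<alpha>")
    case True
    \<comment> \<open>In the target x_q is no longer a variable, so coefficients at monomials with q
      vanish on both sides.\<close>
    have "mfps_nth (to_punctured q f) \<beta> * mfps_nth (to_punctured q g) (\<alpha> - \<beta>) = 0" if "\<beta> \<subseteq># \<alpha>" for \<beta>
    proof -
      have "q \<in># \<beta> \<or> q \<in># \<alpha> - \<beta>"
        using True that by (metis subset_mset.add_diff_inverse union_iff)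
      then show ?thesis
        by (auto simp: to_punctured_nth)
    qed
    then show ?thesis
      using True by (simp add: times_mfps.rep_eq) (simp add: to_punctured_nth)
  next
    case False
    have "?c (f * g) \<alpha> = (\<Sum>\<beta> | \<beta> \<subseteq># \<alpha>. ?c f \<beta> * ?c g (\<alpha> - \<beta>))"
    proof (rule fps_ext)
      fix k
      have "\<alpha> + replicate_mset k q - (\<beta> + replicate_mset j q) = \<alpha> - \<beta> + replicate_mset (k - j) q"
        if *: "\<beta> \<subseteq># \<alpha>" "j \<le> k" for \<beta> j
      proof -
        obtain \<delta> i where "\<alpha> = \<beta> + \<delta>" "k = j + i"
          using * by (metis le_Suc_ex subset_mset.le_iff_add)
        then show ?thesis
          by (simp add: multiset_eq_iff)
      qed
      then show "fps_nth (?c (f * g) \<alpha>) k = fps_nth (\<Sum>\<beta> | \<beta> \<subseteq># \<alpha>. ?c f \<beta> * ?c g (\<alpha> - \<beta>)) k"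
        by (simp add: times_mfps.rep_eq submultisets_add_replicate_mset[OF False] fps_sum_nth fps_mult_nth)
    qed
    then have "mfps_nth (to_punctured q (f * g)) \<alpha> =
        (\<Sum>\<beta> | \<beta> \<subseteq># \<alpha>. fps_to_fls (?c f \<beta>) * fps_to_fls (?c g (\<alpha> - \<beta>)))"
      using False by (simp add: to_punctured_nth fps_to_fls.hom_sum fls_times_fps_to_fls)
    also have "\<dots> = (\<Sum>\<beta> | \<beta> \<subseteq># \<alpha>. mfps_nth (to_punctured q f) \<beta> * mfps_nth (to_punctured q g) (\<alpha> - \<beta>))"
    proof (rule sum.cong[OF refl])
      fix \<beta> assume "\<beta> \<in> {\<beta>. \<beta> \<subseteq># \<alpha>}"
      then have "q \<notin># \<beta>" "q \<notin># \<alpha> - \<beta>"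
        using False by (auto dest: mset_subset_eqD in_diffD)
      then show "fps_to_fls (?c f \<beta>) * fps_to_fls (?c g (\<alpha> - \<beta>)) =
          mfps_nth (to_punctured q f) \<beta> * mfps_nth (to_punctured q g) (\<alpha> - \<beta>)"
        by (simp add: to_punctured_nth)
    qed
    finally show ?thesis
      by (simp add: times_mfps.rep_eq)
  qed
qed

text \<open>Only the coefficient with \<open>k = 0\<close> is left, so here the inclusion is base
  change from R to R((y)).\<close>

lemma to_punctured_eq_map:
  assumes "f \<in> mfps_over V" and "q \<notin> V"
  shows "to_punctured q f = mfps_map fls_const f"
proof (rule mfps_eqI)
  fix \<alpha>
  show "mfps_nth (to_punctured q f) \<alpha> = mfps_nth (mfps_map fls_const f) \<alpha>"
  proof (cases "q \<in># \<alpha>")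
    case True
    then show ?thesis
      using assms by (auto simp: to_punctured_nth mfps_over_def subset_iff)
  next
    case False
    have "mfps_nth f (\<alpha> + replicate_mset k q) = 0" if "k > 0" for k
    proof -
      have "\<not> set_mset (\<alpha> + replicate_mset k q) \<subseteq> V"
        using that assms(2) by auto
      then show ?thesis
        using assms(1) unfolding mfps_over_def by blast
    qed
    then have "Abs_fps (\<lambda>k. mfps_nth f (\<alpha> + replicate_mset k q)) = fps_const (mfps_nth f \<alpha>)"
      by (intro fps_ext) auto
    then show ?thesis
      using False by (simp add: to_punctured_nth)
  qed
qed

lemma ring_hom_to_punctured: "ring_hom (to_punctured q)"
proof
  show "to_punctured q (f + g) = to_punctured q f + to_punctured q g" for f g :: "'a mfps"
  proof (rule mfps_eqI)
    fix \<alpha>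
    have "Abs_fps (\<lambda>k. mfps_nth (f + g) (\<alpha> + replicate_mset k q)) =
        Abs_fps (\<lambda>k. mfps_nth f (\<alpha> + replicate_mset k q)) +
        Abs_fps (\<lambda>k. mfps_nth g (\<alpha> + replicate_mset k q))"
      by (rule fps_ext) simp
    then show "mfps_nth (to_punctured q (f + g)) \<alpha> = mfps_nth (to_punctured q f + to_punctured q g) \<alpha>"
      by (simp add: to_punctured_nth)
  qed
  show "to_punctured q 1 = (1 :: 'a fls mfps)"
    by (subst to_punctured_eq_map[of _ "{}"]) auto
qed (rule to_punctured_mult)

interpretation to_punctured: ring_hom "to_punctured q :: 'a::comm_ring_1 mfps \<Rightarrow> 'a fls mfps" for q
  by (rule ring_hom_to_punctured)

lemma to_punctured_over:
  assumes "f \<in> mfps_over (insert q V)"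
  shows "to_punctured q f \<in> mfps_over V"
  unfolding mfps_over_def
proof (intro CollectI allI impI)
  fix \<alpha>
  assume \<alpha>: "\<not> set_mset \<alpha> \<subseteq> V"
  have "mfps_nth f (\<alpha> + replicate_mset k q) = 0" if "q \<notin># \<alpha>" for k
  proof -
    have "\<not> set_mset (\<alpha> + replicate_mset k q) \<subseteq> insert q V"
      using \<alpha> that by auto
    then show ?thesis
      using assms by (simp add: mfps_over_def)
  qed
  then have "q \<notin># \<alpha> \<Longrightarrow> Abs_fps (\<lambda>k. mfps_nth f (\<alpha> + replicate_mset k q)) = 0"
    by (intro fps_ext) simp
  then show "mfps_nth (to_punctured q f) \<alpha> = 0"
    by (simp add: to_punctured_nth)
qed

text \<open>This is f on the q-th axis with the coordinate renamed y. Rigidity over R((y)) thereby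
  becomes a condition along that whole axis.\<close>

lemma const_term_to_punctured:
  "mfps_const_term (to_punctured q f) = fps_to_fls (Abs_fps (\<lambda>k. mfps_nth f (replicate_mset k q)))"
  by (simp add: mfps_const_term_def to_punctured_nth)

lemma mult_var_power_nth:
  assumes "g \<in> mfps_over W" and "q \<notin> W" and "q \<notin># \<alpha>"
  shows "mfps_nth (g * mfps_var q ^ j) (\<alpha> + replicate_mset k q) = (if j = k then mfps_nth g \<alpha> else 0)"
proof -
  have "mfps_nth g \<gamma> * mfps_nth (mfps_var q ^ j) (\<alpha> + replicate_mset k q - \<gamma>) =
      (if \<gamma> = \<alpha> then if j = k then mfps_nth g \<alpha> else 0 else 0)"
    if "\<gamma> \<subseteq># \<alpha> + replicate_mset k q" for \<gamma>
  proof (cases "q \<in># \<gamma>")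
    case True
    then show ?thesis
      using assms by (auto simp: mfps_over_def subset_iff)
  next
    case False
    \<comment> \<open>With no q in \<open>\<alpha>\<close> or \<open>\<gamma>\<close>, counting q on
      both sides forces \<open>j = k\<close>.\<close>
    have "\<alpha> + replicate_mset k q - \<gamma> = replicate_mset j q \<longleftrightarrow> \<gamma> = \<alpha> \<and> j = k"
    proof
      assume "\<alpha> + replicate_mset k q - \<gamma> = replicate_mset j q"
      then have *: "\<alpha> + replicate_mset k q = \<gamma> + replicate_mset j q"
        using that by (metis subset_mset.add_diff_inverse)
      have "count (\<alpha> + replicate_mset k q) q = count (\<gamma> + replicate_mset j q) q"
        using * by simp
      then have "k = j"
        using False assms(3) by (simp add: not_in_iff)
      then show "\<gamma> = \<alpha> \<and> j = k"
        using * by simp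
    qed simp
    then show ?thesis
      by (simp add: mfps_var_power_nth)
  qed
  then have "mfps_nth (g * mfps_var q ^ j) (\<alpha> + replicate_mset k q) =
      (\<Sum>\<gamma> | \<gamma> \<subseteq># \<alpha> + replicate_mset k q. if \<gamma> = \<alpha> then if j = k then mfps_nth g \<alpha> else 0 else 0)"
    unfolding times_mfps.rep_eq by (intro sum.cong) auto
  then show ?thesis
    by (simp add: finite_submultisets)
qed

text \<open>The substitution fixes x_q and acts on the other variables by series free of x_q. So a
  monomial of f contributes to the k-th power of x_q exactly if it has k copies of q itself, and y
  may be treated as a coefficient throughout.\<close>

lemma to_punctured_subst:
  assumes "finite V" and "q \<notin> V" and "q \<notin> W" and bq: "b q = mfps_var q"
    and b: "\<And>i. i \<in> V \<Longrightarrow> b i \<in> mfps_over W" "\<And>i. i \<in> V \<Longrightarrow> mfps_const_term (b i) = 0"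
  shows "to_punctured q (mfps_subst (insert q V) b f) =
    mfps_subst V (\<lambda>i. mfps_map fls_const (b i)) (to_punctured q f)"
proof (rule mfps_eqI)
  fix \<alpha>
  show "mfps_nth (to_punctured q (mfps_subst (insert q V) b f)) \<alpha> =
    mfps_nth (mfps_subst V (\<lambda>i. mfps_map fls_const (b i)) (to_punctured q f)) \<alpha>"
  proof (cases "q \<in># \<alpha>")
    case True
    have "mfps_subst V (\<lambda>i. mfps_map fls_const (b i)) (to_punctured q f) \<in> mfps_over W"
      using b by (intro mfps_over_subst fls_const.mfps_over_map) auto
    then show ?thesis
      using True assms(3) by (auto simp: to_punctured_nth mfps_over_def subset_iff)
  next
    case False
    have coeff: "mfps_nth (mfps_subst (insert q V) b f) (\<alpha> + replicate_mset k q) =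
        (\<Sum>\<beta>\<in>monomials V (size \<alpha>). mfps_nth f (\<beta> + replicate_mset k q) * mfps_nth (\<Prod>i\<in>#\<beta>. b i) \<alpha>)"
      for k
    proof -
      let ?M = "monomials (insert q V) (size \<alpha> + k)"
      let ?t = "\<lambda>\<beta>. mfps_nth f \<beta> * mfps_nth (\<Prod>i\<in>#\<beta>. b i) (\<alpha> + replicate_mset k q)"
      have prod: "mfps_nth (\<Prod>i\<in>#\<beta> + replicate_mset j q. b i) (\<alpha> + replicate_mset k q) =
          (if j = k then mfps_nth (\<Prod>i\<in>#\<beta>. b i) \<alpha> else 0)" if "set_mset \<beta> \<subseteq> V" for \<beta> j
      proof -
        have "(\<Prod>i\<in>#\<beta>. b i) \<in> mfps_over W"
          using that b by (intro mfps_over_prod_mset) auto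
        then show ?thesis
          using mult_var_power_nth[of "\<Prod>i\<in>#\<beta>. b i" W q \<alpha> j k] assms(3) False by (simp add: bq)
      qed
      have "mfps_nth (mfps_subst (insert q V) b f) (\<alpha> + replicate_mset k q) = (\<Sum>\<beta>\<in>?M. ?t \<beta>)"
        by (simp add: mfps_subst_def monomials_def)
      \<comment> \<open>Only monomials with exactly k copies of q count; removing the copies lowers
        the size bound by k.\<close>
      also have "\<dots> = (\<Sum>\<beta>\<in>(\<lambda>\<beta>. \<beta> + replicate_mset k q) ` monomials V (size \<alpha>). ?t \<beta>)"
      proof (rule sum.mono_neutral_right)
        show "\<forall>\<beta>\<in>?M - (\<lambda>\<beta>. \<beta> + replicate_mset k q) ` monomials V (size \<alpha>). ?t \<beta> = 0"
        proof
          fix \<beta>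
          assume \<beta>: "\<beta> \<in> ?M - (\<lambda>\<beta>. \<beta> + replicate_mset k q) ` monomials V (size \<alpha>)"
          define \<gamma> j where "\<gamma> = filter_mset (\<lambda>i. i \<noteq> q) \<beta>" and "j = count \<beta> q"
          have eq: "\<beta> = \<gamma> + replicate_mset j q"
            by (auto simp: \<gamma>_def j_def intro!: multiset_eqI)
          have V: "set_mset \<gamma> \<subseteq> V"
            using \<beta> by (auto simp: \<gamma>_def monomials_def)
          have "size \<gamma> + j \<le> size \<alpha> + k"
            using \<beta> by (auto simp: monomials_def eq)
          then have "j \<noteq> k"
            using \<beta> V by (auto simp: eq monomials_def)
          then show "?t \<beta> = 0"
            using prod[OF V] by (simp add: eq)
        qed
        show "finite ?M"
          by (simp add: assms)
        show "(\<lambda>\<beta>. \<beta> + replicate_mset k q) ` monomials V (size \<alpha>) \<subseteq> ?M"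
          by (fastforce simp: monomials_def split: if_splits)
      qed
      also have "\<dots> = (\<Sum>\<beta>\<in>monomials V (size \<alpha>). ?t (\<beta> + replicate_mset k q))"
        by (subst sum.reindex) (auto simp: inj_on_def)
      also have "\<dots> = (\<Sum>\<beta>\<in>monomials V (size \<alpha>). mfps_nth f (\<beta> + replicate_mset k q) *
          mfps_nth (\<Prod>i\<in>#\<beta>. b i) \<alpha>)"
        by (rule sum.cong) (auto simp only: prod monomials_def simp_thms mem_Collect_eq if_True)
      finally show ?thesis .
    qed
    let ?c = "\<lambda>\<beta>. Abs_fps (\<lambda>k. mfps_nth f (\<beta> + replicate_mset k q))"
    have "mfps_nth (to_punctured q (mfps_subst (insert q V) b f)) \<alpha> =
        fps_to_fls (\<Sum>\<beta>\<in>monomials V (size \<alpha>). ?c \<beta> * fps_const (mfps_nth (\<Prod>i\<in>#\<beta>. b i) \<alpha>))"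
      using False by (auto simp: to_punctured_nth coeff fps_sum_nth intro!: fps_ext)
    also have "\<dots> = (\<Sum>\<beta>\<in>monomials V (size \<alpha>). mfps_nth (to_punctured q f) \<beta> *
        mfps_nth (\<Prod>i\<in>#\<beta>. mfps_map fls_const (b i)) \<alpha>)"
      unfolding fps_to_fls.hom_sum
    proof (rule sum.cong[OF refl])
      fix \<beta> assume "\<beta> \<in> monomials V (size \<alpha>)"
      then have "q \<notin># \<beta>"
        using assms(2) by (auto simp: monomials_def)
      then show "fps_to_fls (?c \<beta> * fps_const (mfps_nth (\<Prod>i\<in>#\<beta>. b i) \<alpha>)) =
          mfps_nth (to_punctured q f) \<beta> * mfps_nth (\<Prod>i\<in>#\<beta>. mfps_map fls_const (b i)) \<alpha>"
        by (simp add: to_punctured_nth fps_to_fls.hom_mult flip: fls_const.mfps_map_prod_mset)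
    qed
    also have "\<dots> = mfps_nth (mfps_subst V (\<lambda>i. mfps_map fls_const (b i)) (to_punctured q f)) \<alpha>"
      by (simp add: mfps_subst_def monomials_def)
    finally show ?thesis .
  qed
qed

section \<open>Extending ring maps to Laurent series\<close>

text \<open>\<open>fls_shift n\<close> is multiplication by x^(-n), so this clears
  denominators.\<close>

lemma fls_shift_fps_to_fls:
  obtains n g where "l = fls_shift (int n) (fps_to_fls g)"
proof -
  have "- fls_subdegree l \<le> int (nat (- fls_subdegree l))"
    by linarith
  from fls_as_fps[OF this] show thesis
    using that by blast
qed

text \<open>With u inverse to the image of x, the map extends to Laurent series by sending x^(-n) g
  to \<open>u ^ n * m g\<close>.\<close>

locale laurent_extension = ring_hom m for m :: "'a::comm_ring_1 fps \<Rightarrow> 'b::comm_ring_1" +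
  fixes u
  assumes unit: "m fps_X * u = 1"
begin

lemma unit_power: "m fps_X ^ n * u ^ n = 1"
  using unit by (simp flip: power_mult_distrib)

lemma shift_eqI:
  assumes "fps_to_fls f * fls_shift (int n) (fps_to_fls g) = fps_to_fls g'"
  shows "f * g = fps_X ^ n * g'"
proof -
  have "fps_to_fls (f * g) = fls_X ^ n * (fps_to_fls f * fls_shift (int n) (fps_to_fls g))"
    by (simp add: fls_X_power_times_conv_shift fls_times_fps_to_fls fls_shifted_times_simps)
  also have "\<dots> = fps_to_fls (fps_X ^ n * g')"
    by (simp add: assms fls_times_fps_to_fls fps_to_fls_power)
  finally show ?thesis
    by simp
qed

lemma extends:
  assumes "fps_to_fls f * fls_shift (int n) (fps_to_fls g) = fps_to_fls g'"
  shows "m f * (u ^ n * m g) = m g'"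
proof -
  have "m f * m g = m fps_X ^ n * m g'"
    using shift_eqI[OF assms] by (metis hom_mult hom_power)
  then have "m f * (u ^ n * m g) = m fps_X ^ n * u ^ n * m g'"
    by (metis mult.assoc mult.commute)
  then show ?thesis
    by (simp add: unit_power)
qed

text \<open>Uniqueness in \<open>extend_map\<close> is tested on f = x^n, which clears the
  denominator and goes to a unit.\<close>

lemma extend_map_shift: "extend_map m (fls_shift (int n) (fps_to_fls g)) = u ^ n * m g"
  unfolding extend_map_def
proof (rule the_equality)
  show "\<forall>f g'. fps_to_fls f * fls_shift (int n) (fps_to_fls g) = fps_to_fls g' \<longrightarrow>
      m f * (u ^ n * m g) = m g'"
    using extends by blast
next
  fix a
  assume "\<forall>f g'. fps_to_fls f * fls_shift (int n) (fps_to_fls g) = fps_to_fls g' \<longrightarrow> m f * a = m g'"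
  moreover have "fps_to_fls (fps_X ^ n) * fls_shift (int n) (fps_to_fls g) = fps_to_fls g"
    by (simp add: fps_to_fls_power fls_X_power_times_conv_shift)
  ultimately have "m fps_X ^ n * a = m g"
    by (metis hom_power)
  then have "u ^ n * m g = m fps_X ^ n * u ^ n * a"
    by (metis mult.assoc mult.commute)
  then show "a = u ^ n * m g"
    by (simp add: unit_power)
qed

lemma extend_map_mult: "extend_map m (l * l') = extend_map m l * extend_map m l'"
proof -
  obtain n g n' g' where l: "l = fls_shift (int n) (fps_to_fls g)"
    "l' = fls_shift (int n') (fps_to_fls g')"
    by (metis fls_shift_fps_to_fls)
  then have "l * l' = fls_shift (int (n + n')) (fps_to_fls (g * g'))"
    by (simp add: fls_times_both_shifted_simp fls_times_fps_to_fls)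
  then show ?thesis
    unfolding l by (simp only: extend_map_shift) (simp add: hom_mult power_add ac_simps)
qed

lemma extend_map_fps [simp]: "extend_map m (fps_to_fls f) = m f"
  using extend_map_shift[of 0 f] by simp

lemma extend_map_1 [simp]: "extend_map m 1 = 1"
  using extend_map_fps[of 1] by simp

lemma extend_map_prod: "extend_map m (\<Prod>x\<in>A. l x) = (\<Prod>x\<in>A. extend_map m (l x))"
  by (induction A rule: infinite_finite_induct) (auto simp: extend_map_mult)

text \<open>The composite inverts x as well, with inverse \<open>h u\<close>, so the formula of
  \<open>extend_map_shift\<close> computes both sides.\<close>

lemma extend_map_comp:
  assumes "ring_hom h"
  shows "extend_map (h \<circ> m) l = h (extend_map m l)"
proof -
  interpret h: ring_hom h
    by fact
  interpret hm: laurent_extension "h \<circ> m" "h u"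
    by (simp add: laurent_extension_def laurent_extension_axioms_def ring_hom_comp ring_hom_axioms
      assms unit flip: h.hom_mult)
  obtain n g where l: "l = fls_shift (int n) (fps_to_fls g)"
    by (rule fls_shift_fps_to_fls)
  show ?thesis
    unfolding l extend_map_shift hm.extend_map_shift by (simp add: h.hom_mult h.hom_power)
qed

end

section \<open>Coordinates of sections\<close>

text \<open>\<open>coord e l\<close> is the coordinate of \<open>l\<close> with respect to the generator \<open>x\<^bsup>-e\<^esup>\<close>.\<close>

definition coord :: "int \<Rightarrow> 'a::comm_ring_1 fls \<Rightarrow> 'a fps" where
  "coord e l = fls_regpart (fls_shift (- e) l)"

lemma coord_shift [simp]: "coord e (fls_shift e (fps_to_fls f)) = f"
  by (simp add: coord_def)

lemma coord_1 [simp]: "coord e (fls_shift e 1) = 1"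
  using coord_shift[of e 1] by (simp del: coord_shift)

text \<open>L^(-e) is free of rank one on x^(-e), which is \<open>fls_shift e 1\<close>: for
  \<open>e = -1\<close> it is the ideal (x) itself, for \<open>e = 1\<close> its inverse.\<close>

lemma twist_identity_ideal:
  assumes "e = 1 \<or> e = -1"
  shows "twist identity_ideal (- e) = range (\<lambda>f :: 'a::comm_ring_1 fps. fls_shift e (fps_to_fls f))"
proof -
  have ideal: "identity_ideal = range (\<lambda>f :: 'a fps. fls_shift (-1) (fps_to_fls f))"
  proof (intro equalityI subsetI)
    fix l :: "'a fls"
    assume "l \<in> identity_ideal"
    then obtain f where f: "l = fps_to_fls f" "fps_nth f 0 = 0"
      by (auto simp: identity_ideal_def)
    have "f = fps_X * fps_shift 1 f"
      by (rule fps_ext) (use f in \<open>simp add: fps_X_mult_nth\<close>)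
    then have "l = fls_X * fps_to_fls (fps_shift 1 f)"
      using f by (metis fls_times_fps_to_fls fps_X_to_fls)
    then show "l \<in> range (\<lambda>f :: 'a fps. fls_shift (-1) (fps_to_fls f))"
      by (simp add: fls_X_times_conv_shift)
  next
    fix l :: "'a fls"
    assume "l \<in> range (\<lambda>f :: 'a fps. fls_shift (-1) (fps_to_fls f))"
    then obtain f :: "'a fps" where "l = fls_shift (-1) (fps_to_fls f)"
      by blast
    then have "l = fps_to_fls (fps_X * f)"
      by (simp add: fls_times_fps_to_fls fls_X_times_conv_shift)
    then show "l \<in> identity_ideal"
      by (auto simp: identity_ideal_def)
  qed
  show ?thesis
  proof (cases "e = 1")
    case True
    show ?thesis
      unfolding True
    proof (intro equalityI subsetI)
      fix l :: "'a fls"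
      assume "l \<in> twist identity_ideal (- 1)"
      then have "\<forall>f. l * fls_shift (-1) (fps_to_fls f) \<in> structure_sheaf"
        by (auto simp: twist_def ideal)
      \<comment> \<open>Testing on the generator x of the ideal bounds the pole order by
        one.\<close>
      from spec[OF this, of 1] obtain g where "l * fls_X = fps_to_fls g"
        by (auto simp: structure_sheaf_def fls_X_conv_shift_1)
      then have "fls_shift (-1) l = fps_to_fls g"
        by (simp add: fls_X_times_conv_shift)
      from this[symmetric] have "l = fls_shift 1 (fps_to_fls g)"
        by simp
      then show "l \<in> range (\<lambda>f. fls_shift 1 (fps_to_fls f))"
        by blast
    qed (auto simp: twist_def ideal structure_sheaf_def fls_times_both_shifted_simp
        simp flip: fls_times_fps_to_fls)
  next
    case False
    then show ?thesis
      using assms by (simp add: twist_def ideal)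
  qed
qed

lemma coord_twist:
  assumes "e = 1 \<or> e = -1" and "l \<in> twist identity_ideal (- e)"
  shows "fls_shift e (fps_to_fls (coord e l)) = l"
  using assms by (auto simp: twist_identity_ideal)

lemma shift_in_twist [simp]:
  "e = 1 \<or> e = -1 \<Longrightarrow> fls_shift e (fps_to_fls f) \<in> twist identity_ideal (- e)"
  by (simp add: twist_identity_ideal)

lemma one_shift_in_twist [simp]:
  "e = 1 \<or> e = -1 \<Longrightarrow> fls_shift e 1 \<in> twist identity_ideal (- e)"
  using shift_in_twist[of e 1] by simp

lemma coord_add: "coord e (l + l') = coord e l + coord e l'"
  by (simp add: coord_def)

lemma coord_smult:
  assumes "e = 1 \<or> e = -1" and "l \<in> twist identity_ideal (- e)"
  shows "coord e (fps_to_fls f * l) = f * coord e l"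
proof -
  have "fps_to_fls f * l = fls_shift e (fps_to_fls (f * coord e l))"
    by (subst (1) coord_twist[OF assms, symmetric])
      (simp add: fls_shifted_times_simps fls_times_fps_to_fls)
  then show ?thesis
    by simp
qed

definition coord_section ::
  "'i set \<Rightarrow> ('i \<Rightarrow> 'a::comm_ring_1 fps \<Rightarrow> 'b::comm_ring_1) \<Rightarrow> ('i \<Rightarrow> int) \<Rightarrow> 'b \<Rightarrow> ('i \<Rightarrow> 'a fls) \<Rightarrow> 'b"
  where "coord_section J m e c =
    (\<lambda>l\<in>tensor_args identity_ideal J e. c * (\<Prod>j\<in>J. m j (coord (e j) (l j))))"

definition generators :: "'i set \<Rightarrow> ('i \<Rightarrow> int) \<Rightarrow> 'i \<Rightarrow> 'a::comm_ring_1 fls" where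
  "generators J e = (\<lambda>j\<in>J. fls_shift (e j) 1)"

text \<open>One setting for Theta^p over G and over the punctured group, for the pull backs in the
  cocycle condition and for the restriction to the origin; these differ in the ring, the maps and
  the signs.\<close>

locale tensor_data =
  fixes A :: "'b::comm_ring_1 set" and J :: "'i set"
    and m :: "'i \<Rightarrow> 'a::comm_ring_1 fps \<Rightarrow> 'b" and e :: "'i \<Rightarrow> int"
  assumes finite_J [simp]: "finite J"
    and one_in_A: "1 \<in> A" and mult_in_A: "a \<in> A \<Longrightarrow> b \<in> A \<Longrightarrow> a * b \<in> A"
    and m_hom: "j \<in> J \<Longrightarrow> ring_hom (m j)"
    and m_in_A: "j \<in> J \<Longrightarrow> m j f \<in> A"
    and sign: "j \<in> J \<Longrightarrow> e j = 1 \<or> e j = -1"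
begin

abbreviation "args \<equiv> tensor_args identity_ideal J e :: ('i \<Rightarrow> 'a fls) set"

lemma generators_in_args: "generators J e \<in> args"
  using sign by (auto simp: generators_def tensor_args_def)

lemma prod_coord_generators [simp]: "(\<Prod>j\<in>J. m j (coord (e j) (generators J e j))) = 1"
  using ring_hom.hom_1[OF m_hom] by (simp add: generators_def)

lemma coord_section_generators [simp]: "coord_section J m e c (generators J e) = c"
  by (simp add: coord_section_def generators_in_args)

lemma args_upd: "l \<in> args \<Longrightarrow> j \<in> J \<Longrightarrow> v \<in> twist identity_ideal (- e j) \<Longrightarrow> l(j := v) \<in> args"
  by (auto simp: tensor_args_def PiE_def extensional_def)

lemma args_coord: "l \<in> args \<Longrightarrow> j \<in> J \<Longrightarrow> fls_shift (e j) (fps_to_fls (coord (e j) (l j))) = l j"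
  by (intro coord_twist sign) (auto simp: tensor_args_def)

lemma coord_section_in:
  assumes "c \<in> A"
  shows "coord_section J m e c \<in> tensor_sections A identity_ideal J m e"
  unfolding tensor_sections_def
proof (intro CollectI conjI ballI allI)
  have "(\<Prod>j\<in>K. m j (coord (e j) (l j))) \<in> A" if "finite K" "K \<subseteq> J" for K l
    using that by (induction K rule: finite_induct) (auto simp: one_in_A mult_in_A m_in_A)
  then show "coord_section J m e c \<in> args \<rightarrow>\<^sub>E A"
    by (auto simp: coord_section_def intro!: mult_in_A assms)
next
  fix l and j and v :: "'a fls"
  assume l: "l \<in> args" and j: "j \<in> J" and v: "v \<in> twist identity_ideal (- e j)"
  have "l j \<in> twist identity_ideal (- e j)"
    using l j by (auto simp: tensor_args_def)
  then have "l j + v \<in> twist identity_ideal (- e j)"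
    using v sign[OF j] by (auto simp: twist_identity_ideal simp flip: fls_shift_plus fps_to_fls_plus)
  then show "coord_section J m e c (l(j := l j + v)) =
      coord_section J m e c l + coord_section J m e c (l(j := v))"
    using l j v args_upd[OF l j]
    by (simp add: coord_section_def prod.remove[of J j] coord_add ring_hom.hom_add[OF m_hom]
      algebra_simps)
next
  fix l j f
  assume l: "l \<in> args" and j: "j \<in> J"
  have lj: "l j \<in> twist identity_ideal (- e j)"
    using l j by (auto simp: tensor_args_def)
  then have "fps_to_fls f * l j \<in> twist identity_ideal (- e j)"
    using sign[OF j]
    by (auto simp: twist_identity_ideal fls_shifted_times_simps simp flip: fls_times_fps_to_fls)
  then show "coord_section J m e c (l(j := fps_to_fls f * l j)) = m j f * coord_section J m e c l"
    using l j lj args_upd[OF l j] sign[OF j]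
    by (simp add: coord_section_def prod.remove[of J j] coord_smult ring_hom.hom_mult[OF m_hom]
      ac_simps)
qed

text \<open>The generators are replaced by the \<open>l j\<close> one argument at a time, and each
  step produces one factor by semilinearity.\<close>

lemma section_eq_coord_section:
  assumes "\<phi> \<in> tensor_sections A identity_ideal J m e"
  shows "\<phi> = coord_section J m e (\<phi> (generators J e))"
proof
  fix l
  show "\<phi> l = coord_section J m e (\<phi> (generators J e)) l"
  proof (cases "l \<in> args")
    case False
    then show ?thesis
      using assms by (auto simp: tensor_sections_def coord_section_def PiE_def extensional_def)
  next
    case l: True
    let ?g = "\<lambda>K. \<lambda>j\<in>J. if j \<in> K then l j else generators J e j"
    have g: "?g K \<in> args" for K
      using l generators_in_args by (auto simp: tensor_args_def)
    have *: "\<phi> (?g K) = (\<Prod>j\<in>K. m j (coord (e j) (l j))) * \<phi> (generators J e)"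
      if "finite K" "K \<subseteq> J" for K
      using that
    proof (induction K rule: finite_induct)
      case empty
      have "?g {} = generators J e"
        by (auto simp: generators_def)
      then show ?case
        by simp
    next
      case (insert k K)
      then have k: "k \<in> J" "k \<notin> K"
        by auto
      have "?g (insert k K) = (?g K)(k := fps_to_fls (coord (e k) (l k)) * ?g K k)"
        using k args_coord[OF l] by (auto simp: fun_eq_iff generators_def fls_shifted_times_simps)
      moreover have "\<phi> ((?g K)(k := fps_to_fls (coord (e k) (l k)) * ?g K k)) =
          m k (coord (e k) (l k)) * \<phi> (?g K)"
        using assms g[of K] k(1) unfolding tensor_sections_def by blast
      moreover have "\<phi> (?g K) = (\<Prod>j\<in>K. m j (coord (e j) (l j))) * \<phi> (generators J e)"
        by (rule insert.IH) (use insert.prems in auto)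
      ultimately show ?case
        using insert(1,2) by (simp only: prod.insert mult.assoc not_False_eq_True)
    qed
    have "?g J = l"
      using l by (auto simp: tensor_args_def fun_eq_iff PiE_def extensional_def)
    then show ?thesis
      using *[of J] l by (simp add: coord_section_def mult.commute)
  qed
qed

lemma sections_eq: "tensor_sections A identity_ideal J m e = coord_section J m e ` A"
proof (intro equalityI subsetI)
  fix \<phi> assume \<phi>: "\<phi> \<in> tensor_sections A identity_ideal J m e"
  then have "\<phi> (generators J e) \<in> A"
    using generators_in_args by (auto simp: tensor_sections_def)
  then show "\<phi> \<in> coord_section J m e ` A"
    using section_eq_coord_section[OF \<phi>] by blast
qed (use coord_section_in in auto)

text \<open>The coefficient of a section is its value on the generators. Hence the condition says
  that every d in A is a unique multiple of c, and \<open>d = 1\<close> yields the inverse of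
  c.\<close>

lemma trivialization_iff:
  assumes "c \<in> A"
  shows "trivialization A identity_ideal J m e (coord_section J m e c) \<longleftrightarrow> (\<exists>b\<in>A. c * b = 1)"
proof -
  have eq: "(\<forall>l\<in>args. coord_section J m e d l = a * coord_section J m e c l) \<longleftrightarrow> d = a * c" for a d
  proof
    assume "\<forall>l\<in>args. coord_section J m e d l = a * coord_section J m e c l"
    then show "d = a * c"
      using generators_in_args coord_section_generators by metis
  qed (auto simp: coord_section_def)
  have "trivialization A identity_ideal J m e (coord_section J m e c) \<longleftrightarrow>
      (\<forall>d\<in>A. \<exists>!a. a \<in> A \<and> d = a * c)"
    using assms by (auto simp: trivialization_def sections_eq eq)
  also have "\<dots> \<longleftrightarrow> (\<exists>b\<in>A. c * b = 1)"
  proof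
    assume "\<forall>d\<in>A. \<exists>!a. a \<in> A \<and> d = a * c"
    then show "\<exists>b\<in>A. c * b = 1"
      using one_in_A by (metis mult.commute)
  next
    assume "\<exists>b\<in>A. c * b = 1"
    then obtain b where b: "b \<in> A" "c * b = 1"
      by blast
    show "\<forall>d\<in>A. \<exists>!a. a \<in> A \<and> d = a * c"
    proof
      fix d assume "d \<in> A"
      show "\<exists>!a. a \<in> A \<and> d = a * c"
      proof
        show "d * b \<in> A \<and> d = d * b * c"
          using b \<open>d \<in> A\<close> mult_in_A by (simp add: mult.assoc mult.commute[of b])
        show "a = d * b" if "a \<in> A \<and> d = a * c" for a
          using that b by (simp add: mult.assoc)
      qed
    qed
  qed
  finally show ?thesis .
qed

lemma tensor_data_dual: "tensor_data A J m (\<lambda>j. - e j)"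
  unfolding tensor_data_def using one_in_A mult_in_A m_hom m_in_A sign by force

text \<open>The generators x^(-e) and x^e contract to 1, so contraction just multiplies
  coordinates.\<close>

lemma inverse_section_eq:
  assumes "c \<in> A" and "c' \<in> A" and "c * c' = 1"
  shows "inverse_section A identity_ideal J m e (coord_section J m e c) =
    coord_section J m (\<lambda>j. - e j) c'"
  unfolding inverse_section_def
proof (rule the_equality)
  interpret dual: tensor_data A J m "\<lambda>j. - e j"
    by (rule tensor_data_dual)
  have contract: "(\<Prod>j\<in>J. m j (fls_regpart (l j * l' j))) =
      (\<Prod>j\<in>J. m j (coord (e j) (l j))) * (\<Prod>j\<in>J. m j (coord (- e j) (l' j)))"
    if "l \<in> args" "l' \<in> dual.args" for l l'
  proof -
    have "m j (fls_regpart (l j * l' j)) = m j (coord (e j) (l j)) * m j (coord (- e j) (l' j))"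
      if "j \<in> J" for j
    proof -
      have "l j * l' j = fps_to_fls (coord (e j) (l j) * coord (- e j) (l' j))"
        by (subst (1) args_coord[OF \<open>l \<in> args\<close> that, symmetric],
            subst (1) dual.args_coord[OF \<open>l' \<in> dual.args\<close> that, symmetric])
          (simp add: fls_times_both_shifted_simp fls_times_fps_to_fls)
      then show ?thesis
        using that by (simp add: ring_hom.hom_mult[OF m_hom])
    qed
    then show ?thesis
      by (simp add: prod.distrib)
  qed
  show "coord_section J m (\<lambda>j. - e j) c' \<in> tensor_sections A identity_ideal J m (\<lambda>j. - e j) \<and>
    (\<forall>l\<in>args. \<forall>l'\<in>dual.args. coord_section J m e c l * coord_section J m (\<lambda>j. - e j) c' l' =
       (\<Prod>j\<in>J. m j (fls_regpart (l j * l' j))))"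
  proof (intro conjI ballI)
    fix l l' assume "l \<in> args" "l' \<in> dual.args"
    then have "coord_section J m e c l * coord_section J m (\<lambda>j. - e j) c' l' =
        c * c' * ((\<Prod>j\<in>J. m j (coord (e j) (l j))) * (\<Prod>j\<in>J. m j (coord (- e j) (l' j))))"
      by (simp add: coord_section_def ac_simps)
    then show "coord_section J m e c l * coord_section J m (\<lambda>j. - e j) c' l' =
        (\<Prod>j\<in>J. m j (fls_regpart (l j * l' j)))"
      using assms contract[OF \<open>l \<in> args\<close> \<open>l' \<in> dual.args\<close>] by simp
  qed (use assms dual.coord_section_in in auto)
  fix \<psi>
  assume \<psi>: "\<psi> \<in> tensor_sections A identity_ideal J m (\<lambda>j. - e j) \<and>
    (\<forall>l\<in>args. \<forall>l'\<in>dual.args. coord_section J m e c l * \<psi> l' =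
       (\<Prod>j\<in>J. m j (fls_regpart (l j * l' j))))"
  then obtain d where d: "\<psi> = coord_section J m (\<lambda>j. - e j) d"
    using dual.sections_eq by blast
  \<comment> \<open>Uniqueness: evaluation on the generators gives c d = 1.\<close>
  have "c * d = (\<Prod>j\<in>J. m j (fls_regpart (generators J e j * generators J (\<lambda>j. - e j) j)))"
    using \<psi>[THEN conjunct2, rule_format, OF generators_in_args dual.generators_in_args]
    by (simp only: d coord_section_generators dual.coord_section_generators)
  also have "\<dots> = 1"
    by (simp only: contract[OF generators_in_args dual.generators_in_args]
      prod_coord_generators dual.prod_coord_generators mult_1)
  finally have "d = c'"
    using assms by (metis mult.assoc mult.commute mult_1)
  then show "\<psi> = coord_section J m (\<lambda>j. - e j) c'"
    using d by simp
qed

text \<open>Within a group of equal maps the powers x^(-e) multiply to x^0, so the product of the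
  \<open>l j\<close> is a power series, namely the product of their coordinates.\<close>

lemma canonical_section_eq:
  assumes "l \<in> args" and "\<And>i. i \<in> J \<Longrightarrow> (\<Sum>j | j \<in> J \<and> m j = m i. e j) = 0"
  shows "canonical_section J m l = (\<Prod>j\<in>J. m j (coord (e j) (l j)))"
proof -
  have prod: "(\<Prod>j\<in>K. l j) = fls_shift (\<Sum>j\<in>K. e j) (fps_to_fls (\<Prod>j\<in>K. coord (e j) (l j)))"
    if "finite K" "K \<subseteq> J" for K
    using that
  proof (induction K rule: finite_induct)
    case (insert k K)
    have "l k * (\<Prod>j\<in>K. l j) = fls_shift (e k) (fps_to_fls (coord (e k) (l k))) *
        fls_shift (\<Sum>j\<in>K. e j) (fps_to_fls (\<Prod>j\<in>K. coord (e j) (l j)))"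
      using insert args_coord[OF assms(1)] by simp
    then show ?case
      using insert by (simp add: fls_times_both_shifted_simp fls_times_fps_to_fls)
  qed simp
  have "h (fls_regpart (\<Prod>j\<in>{j\<in>J. m j = h}. l j)) = (\<Prod>j\<in>{j\<in>J. m j = h}. m j (coord (e j) (l j)))"
    if "h \<in> m ` J" for h
  proof -
    obtain i where i: "i \<in> J" "h = m i"
      using \<open>h \<in> m ` J\<close> by blast
    then show ?thesis
      using prod[of "{j\<in>J. m j = h}"] assms(2)[OF i(1)]
      by (simp add: ring_hom.hom_prod[OF m_hom[OF i(1)]])
  qed
  then have "canonical_section J m l = (\<Prod>h\<in>m ` J. \<Prod>j\<in>{j\<in>J. m j = h}. m j (coord (e j) (l j)))"
    unfolding canonical_section_def by (rule prod.cong[OF refl])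
  also have "\<dots> = (\<Prod>j\<in>J. m j (coord (e j) (l j)))"
    by (rule prod.image_gen[symmetric]) simp
  finally show ?thesis .
qed

end

lemma pullback_coord_section:
  assumes "ring_hom h"
  shows "pullback_section h identity_ideal J e (coord_section J m e c) =
    coord_section J (\<lambda>j. h \<circ> m j) e (h c)"
  unfolding pullback_section_def coord_section_def
  by (rule restrict_ext) (simp add: ring_hom.hom_mult[OF assms]
    ring_hom.hom_prod[OF assms])

section \<open>Coordinates of \<open>\<Theta>\<^sup>p\<close>-structures\<close>

text \<open>Each I is paired with \<open>insert a I\<close>. Under alternating signs such a pair
  cancels, and with a = p + 1 the pairing splits the factors of Theta^(p+1) into those of Theta^p
  and of Theta_star.\<close>

lemma (in comm_monoid_set) Pow_insert:
  assumes "finite B" and "a \<notin> B"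
  shows "F g (Pow (insert a B)) = F (\<lambda>I. g I \<^bold>* g (insert a I)) (Pow B)"
proof -
  have "F g (Pow (insert a B)) = F g (Pow B) \<^bold>* F g (insert a ` Pow B)"
    unfolding Pow_insert using assms by (intro union_disjoint) auto
  also have "F g (insert a ` Pow B) = F (\<lambda>I. g (insert a I)) (Pow B)"
    using assms by (subst reindex) (auto simp: inj_on_def)
  finally show ?thesis
    by (simp add: distrib)
qed

section \<open>Signs of subsets and their cancellation\<close>

lemma theta_sign_cases: "theta_sign I = 1 \<or> theta_sign I = -1"
  by (cases "even (card I)") (auto simp: theta_sign_def)

lemma theta_sign_insert: "finite I \<Longrightarrow> a \<notin> I \<Longrightarrow> theta_sign (insert a I) = - theta_sign I"
  by (simp add: theta_sign_def)

text \<open>Adding p to a subset of \<open>{1..<p}\<close> reverses its sign.\<close>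

lemma sum_theta_sign:
  assumes "p \<ge> 1"
  shows "(\<Sum>I\<in>Pow {1..p}. theta_sign I) = 0"
proof -
  have "{1..p} = insert p {1..<p}"
    using assms by auto
  moreover have "theta_sign I + theta_sign (insert p I) = 0" if "I \<in> Pow {1..<p}" for I
    using that finite_subset[of I "{1..<p}"] by (subst theta_sign_insert) auto
  ultimately show ?thesis
    by (simp only: sum.Pow_insert finite_atLeastLessThan atLeastLessThan_iff less_irrefl simp_thms
      sum.neutral_const cong: sum.cong)
qed

text \<open>The indices j of the points a_j whose sum is the i-th component of the k-th cocycle
  map.\<close>

definition cocycle_sets :: "nat \<Rightarrow> nat \<Rightarrow> nat set" where
  "cocycle_sets k i =
     (if k = 2 \<and> i = 1 then {0, 1}
      else if k = 3 \<and> i = 1 then {0}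
      else if k = 3 \<and> i = 2 then {1, 2}
      else if k = 4 \<and> i = 1 then {0}
      else if k = 4 \<and> i = 2 then {1}
      else {i})"

lemma finite_cocycle_sets [simp]: "finite (cocycle_sets k i)"
  by (simp add: cocycle_sets_def)

lemma disjoint_cocycle_sets: "disjoint_family_on (cocycle_sets k) {1..p}"
  by (auto simp: disjoint_family_on_def cocycle_sets_def split: if_splits)

lemma cocycle_sets_subset: "i \<in> {1..p} \<Longrightarrow> cocycle_sets k i \<subseteq> {0..p}"
  by (auto simp: cocycle_sets_def)

lemma cocycle_sign_cases: "cocycle_sign x = 1 \<or> cocycle_sign x = -1"
  using theta_sign_cases[of "snd x"] by (cases "even (fst x)") (auto simp: cocycle_sign_def split: prod.splits)

lemma cocycle_sign_eq: "cocycle_sign (k, I) = (if odd k then theta_sign I else - theta_sign I)"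
  by (simp add: cocycle_sign_def)

text \<open>For I inside \<open>{3..p}\<close> fixed, the k-th map contributes the second difference
  D(A, B) of g at its first two components A and B. Second differences are cocycles: D(1, 2) - D(01,
  2) + D(0, 12) - D(0, 1) = 0. The function g is arbitrary so that indicator functions can be
  inserted.\<close>

lemma sum_cocycle_sign:
  assumes "p \<ge> 2"
  shows "(\<Sum>k\<in>{1..4}. \<Sum>I\<in>Pow {1..p}. cocycle_sign (k, I) * g (\<Union>i\<in>I. cocycle_sets k i)) = 0"
proof -
  have p: "{1..p} = insert 1 (insert 2 {3..p})"
    using assms by auto
  have four: "{1..4::nat} = {1, 2, 3, 4}"
    by auto
  have Un: "(\<Union>i\<in>I. cocycle_sets k i) = I" if "I \<subseteq> {3..p}" for k I
    using that by (fastforce simp: cocycle_sets_def)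
  have sgn: "theta_sign (insert 2 I) = - theta_sign I" "theta_sign (insert 1 I) = - theta_sign I"
      "theta_sign (insert 1 (insert 2 I)) = theta_sign I" if "I \<subseteq> {3..p}" for I
  proof -
    have "finite I" "1 \<notin> I" "2 \<notin> I"
      using that finite_subset by fastforce+
    then show "theta_sign (insert 2 I) = - theta_sign I" "theta_sign (insert 1 I) = - theta_sign I"
        "theta_sign (insert 1 (insert 2 I)) = theta_sign I"
      by (simp_all add: theta_sign_insert)
  qed
  have "(\<Sum>k\<in>{1..4}. \<Sum>I\<in>Pow {1..p}. cocycle_sign (k, I) * g (\<Union>i\<in>I. cocycle_sets k i)) =
    (\<Sum>k\<in>{1..4}. \<Sum>I\<in>Pow {3..p}. (if odd k then theta_sign I else - theta_sign I) *
      (g I - g (cocycle_sets k 1 \<union> I) - g (cocycle_sets k 2 \<union> I) +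
       g (cocycle_sets k 1 \<union> (cocycle_sets k 2 \<union> I))))"
  proof (rule sum.cong[OF refl])
    fix k :: nat
    let ?h = "\<lambda>I. cocycle_sign (k, I) * g (\<Union>i\<in>I. cocycle_sets k i)"
    \<comment> \<open>The four terms are the possible intersections of a subset with {1, 2}.\<close>
    have "(\<Sum>I\<in>Pow {1..p}. ?h I) = (\<Sum>I\<in>Pow {3..p}. ?h I + ?h (insert 1 I) +
        (?h (insert 2 I) + ?h (insert 1 (insert 2 I))))"
      unfolding p by (subst sum.Pow_insert, simp, simp)+ (rule refl)
    also have "\<dots> = (\<Sum>I\<in>Pow {3..p}. (if odd k then theta_sign I else - theta_sign I) *
      (g I - g (cocycle_sets k 1 \<union> I) - g (cocycle_sets k 2 \<union> I) +
       g (cocycle_sets k 1 \<union> (cocycle_sets k 2 \<union> I))))"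
    proof (rule sum.cong[OF refl])
      fix I assume "I \<in> Pow {3..p}"
      then have "I \<subseteq> {3..p}"
        by simp
      then show "?h I + ?h (insert 1 I) + (?h (insert 2 I) + ?h (insert 1 (insert 2 I))) =
          (if odd k then theta_sign I else - theta_sign I) *
          (g I - g (cocycle_sets k 1 \<union> I) - g (cocycle_sets k 2 \<union> I) +
           g (cocycle_sets k 1 \<union> (cocycle_sets k 2 \<union> I)))"
        by (simp only: cocycle_sign_eq sgn UN_insert Un) (simp add: algebra_simps)
    qed
    finally show "(\<Sum>I\<in>Pow {1..p}. ?h I) = (\<Sum>I\<in>Pow {3..p}.
      (if odd k then theta_sign I else - theta_sign I) *
      (g I - g (cocycle_sets k 1 \<union> I) - g (cocycle_sets k 2 \<union> I) +
       g (cocycle_sets k 1 \<union> (cocycle_sets k 2 \<union> I))))" .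
  qed
  also have "\<dots> = (\<Sum>I\<in>Pow {3..p}. \<Sum>k\<in>{1..4}. (if odd k then theta_sign I else - theta_sign I) *
      (g I - g (cocycle_sets k 1 \<union> I) - g (cocycle_sets k 2 \<union> I) +
       g (cocycle_sets k 1 \<union> (cocycle_sets k 2 \<union> I))))"
    by (rule sum.swap)
  also have "\<dots> = 0"
    unfolding four
    by (rule sum.neutral, rule ballI) (simp add: cocycle_sets_def algebra_simps insert_commute)
  finally show ?thesis .
qed

text \<open>The factor at (k, I) of the cocycle condition is the pull back of L along the sum of the
  points in this set.\<close>

definition cocycle_union :: "nat \<times> nat set \<Rightarrow> nat set" where
  "cocycle_union = (\<lambda>(k, I). \<Union>i\<in>I. cocycle_sets k i)"

text \<open>The case of \<open>sum_cocycle_sign\<close> in which g is the indicator function of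
  T.\<close>

lemma sum_cocycle_sign_fibre:
  assumes "p \<ge> 2"
  shows "(\<Sum>y\<in>{y \<in> {1..4} \<times> Pow {1..p}. cocycle_union y = T}. cocycle_sign y) = 0"
proof -
  have "(\<Sum>y\<in>{y \<in> {1..4} \<times> Pow {1..p}. cocycle_union y = T}. cocycle_sign y) =
      (\<Sum>y\<in>{1..4} \<times> Pow {1..p}. if cocycle_union y = T then cocycle_sign y else 0)"
    by (rule sum.inter_filter) simp
  also have "\<dots> = (\<Sum>(k, I)\<in>{1..4} \<times> Pow {1..p}.
      cocycle_sign (k, I) * (if (\<Union>i\<in>I. cocycle_sets k i) = T then 1 else 0))"
    by (intro sum.cong refl) (simp add: case_prod_beta cocycle_union_def)
  also have "\<dots> = 0"
    using sum_cocycle_sign[OF assms(1), of "\<lambda>T'. if T' = T then 1 else 0"]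
    by (simp add: sum.cartesian_product)
  finally show ?thesis .
qed

context formal_group_law
begin

section \<open>Cocycle maps and the factors of the cocycle condition\<close>

lemma cocycle_map_eq: "cocycle_map F k i = fg_sum F (cocycle_sets k i)"
  using fg_sum_pair[of 0 "Suc 0"] fg_sum_pair[of "Suc 0" 2]
  by (simp add: cocycle_map_def cocycle_sets_def)

lemma const_term_cocycle_map [simp]: "mfps_const_term (cocycle_map F k i) = 0"
  by (simp add: cocycle_map_eq)

lemma cocycle_map_over: "i \<in> {1..p} \<Longrightarrow> cocycle_map F k i \<in> mfps_over {0..p}"
  using mfps_over_mono[OF cocycle_sets_subset fg_sum_over[OF finite_cocycle_sets]]
  by (simp add: cocycle_map_eq)

lemma ring_hom_cocycle_map: "ring_hom (mfps_subst {1..p} (cocycle_map F k))"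
  by (simp add: ring_hom_mfps_subst)

lemma cocycle_factor_eq:
  assumes "I \<subseteq> {1..p}"
  shows "cocycle_factor F p (k, I) = mu F (\<Union>i\<in>I. cocycle_sets k i)"
  unfolding cocycle_factor_def case_prod_conv
  by (rule mfps_subst_mu) (use assms disjoint_cocycle_sets in \<open>auto simp: cocycle_map_eq\<close>)

lemma theta_data: "tensor_data (mfps_over {1..p}) (Pow {1..p}) (mu F) theta_sign"
  by (simp add: tensor_data_def mfps_over_mult ring_hom_mu theta_sign_cases mu_over finite_subset)

lemma cocycle_factor_hom: "ring_hom (cocycle_factor F p x)"
  by (cases x) (auto simp: cocycle_factor_def intro!: ring_hom_comp ring_hom_mfps_subst ring_hom_mu)

lemma cocycle_factor_over: "cocycle_factor F p x f \<in> mfps_over {0..p}"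
  using cocycle_map_over
  by (cases x) (auto simp: cocycle_factor_def intro!: mfps_over_subst)

lemma cocycle_data:
  "tensor_data (mfps_over {0..p}) ({1..4} \<times> Pow {1..p}) (cocycle_factor F p) cocycle_sign"
  by (simp add: tensor_data_def mfps_over_mult cocycle_sign_cases cocycle_factor_hom
    cocycle_factor_over)

lemma cocycle_term_data:
  "tensor_data (mfps_over {0..p}) (Pow {1..p}) (\<lambda>I. cocycle_factor F p (k, I)) theta_sign"
  by (simp add: tensor_data_def mfps_over_mult theta_sign_cases cocycle_factor_hom
    cocycle_factor_over)

text \<open>\<open>canonical_section\<close> compares ring maps, the sign count compares sets;
  \<open>mu_inj\<close> identifies the two groupings.\<close>

lemma cocycle_cancel:
  assumes "p \<ge> 2" and "x \<in> {1..4} \<times> Pow {1..p}"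
  shows "(\<Sum>y | y \<in> {1..4} \<times> Pow {1..p} \<and> cocycle_factor F p y = cocycle_factor F p x. cocycle_sign y) = 0"
proof -
  have "cocycle_factor F p y = cocycle_factor F p x \<longleftrightarrow> cocycle_union y = cocycle_union x"
    if "y \<in> {1..4} \<times> Pow {1..p}" for y
  proof -
    have "cocycle_factor F p z = mu F (cocycle_union z)" "finite (cocycle_union z)"
      if "z \<in> {1..4} \<times> Pow {1..p}" for z
      using that cocycle_factor_eq finite_subset[of "snd z" "{1..p}"]
      by (auto simp: cocycle_union_def)
    then show ?thesis
      using that assms(2) mu_inj by metis
  qed
  then have "{y. y \<in> {1..4} \<times> Pow {1..p} \<and> cocycle_factor F p y = cocycle_factor F p x} =
      {y \<in> {1..4} \<times> Pow {1..p}. cocycle_union y = cocycle_union x}"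
    by blast
  then show ?thesis
    using sum_cocycle_sign_fibre[OF assms(1)] by simp
qed

text \<open>At the origin every factor map becomes f -> f(0), so all factors form one group, whose
  exponents add up to 0.\<close>

lemma theta_rigid_iff:
  assumes "p \<ge> 1"
  shows "theta_rigid F p identity_ideal (coord_section (Pow {1..p}) (mu F) theta_sign c) \<longleftrightarrow>
    mfps_const_term c = 1"
proof -
  let ?m = "\<lambda>I. mfps_const_term \<circ> mu F I"
  interpret const: tensor_data UNIV "Pow {1..p}" ?m theta_sign
    by (simp add: tensor_data_def theta_sign_cases ring_hom_comp ring_hom_const_term ring_hom_mu)
  have m: "?m I = (\<lambda>f. fps_nth f 0)" for I
    by (simp add: mu_def fun_eq_iff)
  have "canonical_section (Pow {1..p}) ?m l = coord_section (Pow {1..p}) ?m theta_sign 1 l"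
    if "l \<in> const.args" for l
    using that const.canonical_section_eq[OF that] sum_theta_sign[OF assms]
    by (simp add: coord_section_def m Pow_def)
  then have "theta_rigid F p identity_ideal (coord_section (Pow {1..p}) (mu F) theta_sign c) \<longleftrightarrow>
      (\<forall>l\<in>const.args. coord_section (Pow {1..p}) ?m theta_sign (mfps_const_term c) l =
         coord_section (Pow {1..p}) ?m theta_sign 1 l)"
    by (simp add: theta_rigid_def pullback_coord_section[OF ring_hom_const_term])
  also have "\<dots> \<longleftrightarrow> mfps_const_term c = 1"
    using const.generators_in_args const.coord_section_generators by metis
  finally show ?thesis .
qed

lemma theta_symmetric_iff:
  "theta_symmetric p identity_ideal (coord_section (Pow {1..p}) (mu F) theta_sign c) \<longleftrightarrow>
    (\<forall>\<sigma>. \<sigma> permutes {1..p} \<longrightarrow> mfps_subst {1..p} (\<lambda>i. mfps_var (\<sigma> i)) c = c)"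
proof -
  interpret theta: tensor_data "mfps_over {1..p}" "Pow {1..p}" "mu F" theta_sign
    by (rule theta_data)
  have "(\<forall>l\<in>theta.args. pullback_section (mfps_subst {1..p} (\<lambda>i. mfps_var (\<sigma> i))) identity_ideal
      (Pow {1..p}) theta_sign (coord_section (Pow {1..p}) (mu F) theta_sign c) (\<lambda>I\<in>Pow {1..p}. l (\<sigma> ` I)) =
      coord_section (Pow {1..p}) (mu F) theta_sign c l) \<longleftrightarrow>
    mfps_subst {1..p} (\<lambda>i. mfps_var (\<sigma> i)) c = c" (is "(\<forall>l\<in>_. ?L l = ?R l) \<longleftrightarrow> ?h c = c")
    if \<sigma>: "\<sigma> permutes {1..p}" for \<sigma>
  proof -
    have hom: "ring_hom ?h"
      by (simp add: ring_hom_mfps_subst)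
    have bij: "bij_betw (image \<sigma>) (Pow {1..p}) (Pow {1..p})"
      by (rule bij_betw_Pow) (rule permutes_imp_bij[OF \<sigma>])
    have hmu: "?h \<circ> mu F I = mu F (\<sigma> ` I)" if "I \<in> Pow {1..p}" for I
    proof -
      have "?h \<circ> mu F I = mu F (\<Union>i\<in>I. {\<sigma> i})"
        using that permutes_inj[OF \<sigma>]
        by (intro mfps_subst_mu) (auto simp: disjoint_family_on_def inj_def)
      then show ?thesis
        by (simp add: UNION_singleton_eq_range)
    qed
    have sign: "theta_sign (\<sigma> ` I) = theta_sign I" for I
      using permutes_inj[OF \<sigma>] by (simp add: theta_sign_def card_image inj_on_subset)
    have "?L l = ?h c * (\<Prod>I\<in>Pow {1..p}. mu F I (coord (theta_sign I) (l I)))" if l: "l \<in> theta.args" for l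
    proof -
      have "(\<lambda>I\<in>Pow {1..p}. l (\<sigma> ` I)) \<in> theta.args"
      proof -
        have "l (\<sigma> ` I) \<in> twist identity_ideal (- theta_sign (\<sigma> ` I))" if "I \<in> Pow {1..p}" for I
          using l bij that unfolding tensor_args_def by (meson PiE_mem bij_betw_apply)
        then show ?thesis
          by (auto simp: tensor_args_def sign)
      qed
      then have "?L l = ?h c * (\<Prod>I\<in>Pow {1..p}. (?h \<circ> mu F I) (coord (theta_sign I) (l (\<sigma> ` I))))"
        unfolding pullback_coord_section[OF hom] by (simp add: coord_section_def)
      also have "(\<Prod>I\<in>Pow {1..p}. (?h \<circ> mu F I) (coord (theta_sign I) (l (\<sigma> ` I)))) =
          (\<Prod>I\<in>Pow {1..p}. mu F (\<sigma> ` I) (coord (theta_sign (\<sigma> ` I)) (l (\<sigma> ` I))))"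
        by (rule prod.cong[OF refl]) (simp only: hmu sign)
      also have "(\<Prod>I\<in>Pow {1..p}. mu F (\<sigma> ` I) (coord (theta_sign (\<sigma> ` I)) (l (\<sigma> ` I)))) =
          (\<Prod>I\<in>Pow {1..p}. mu F I (coord (theta_sign I) (l I)))"
        by (rule prod.reindex_bij_betw[OF bij])
      finally show ?thesis .
    qed
    then have "(\<forall>l\<in>theta.args. ?L l = ?R l) \<longleftrightarrow> (\<forall>l\<in>theta.args.
        coord_section (Pow {1..p}) (mu F) theta_sign (?h c) l = ?R l)"
      by (simp add: coord_section_def)
    also have "\<dots> \<longleftrightarrow> ?h c = c"
      using theta.generators_in_args theta.coord_section_generators by metis
    finally show ?thesis .
  qed
  then show ?thesis
    unfolding theta_symmetric_def by blast
qed

text \<open>The terms with k = 2 and k = 4 have coefficient c' instead of c. Both sides of the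
  condition are forms over the same factors, so comparing coefficients and multiplying by c at these
  two places gives the equation.\<close>

lemma theta_cocycle_iff:
  assumes "p \<ge> 2" and c: "c \<in> mfps_over {1..p}" "c' \<in> mfps_over {1..p}" "c * c' = 1"
  shows "theta_cocycle F p identity_ideal (coord_section (Pow {1..p}) (mu F) theta_sign c) \<longleftrightarrow>
    mfps_subst {1..p} (cocycle_map F 1) c * mfps_subst {1..p} (cocycle_map F 3) c =
    mfps_subst {1..p} (cocycle_map F 2) c * mfps_subst {1..p} (cocycle_map F 4) c"
proof -
  let ?\<theta> = "\<lambda>k. mfps_subst {1..p} (cocycle_map F k)"
  let ?m = "cocycle_factor F p"
  let ?J = "{1..4} \<times> Pow {1..p}"
  define C where "C = (\<lambda>k. ?\<theta> k (if odd k then c else c'))"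
  interpret cocycle: tensor_data "mfps_over {0..p}" ?J ?m cocycle_sign
    by (rule cocycle_data)
  have inv: "?\<theta> k c * ?\<theta> k c' = 1" for k
    using ring_hom.hom_mult[OF ring_hom_cocycle_map, of p k c c'] c by simp
  have over: "?\<theta> k d \<in> mfps_over {0..p}" for k d
    using cocycle_map_over by (intro mfps_over_subst) auto
  have cterm: "cocycle_term F p identity_ideal (coord_section (Pow {1..p}) (mu F) theta_sign c) k =
      coord_section (Pow {1..p}) (\<lambda>I. ?m (k, I)) (\<lambda>I. cocycle_sign (k, I)) (C k)" for k
  proof -
    have pb: "pullback_section (?\<theta> k) identity_ideal (Pow {1..p}) theta_sign
        (coord_section (Pow {1..p}) (mu F) theta_sign c) =
        coord_section (Pow {1..p}) (\<lambda>I. ?m (k, I)) theta_sign (?\<theta> k c)"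
      unfolding pullback_coord_section[OF ring_hom_cocycle_map] by (simp add: cocycle_factor_def)
    show ?thesis
      using tensor_data.inverse_section_eq[OF cocycle_term_data over over inv]
      unfolding cocycle_term_def pb Let_def by (simp add: cocycle_sign_eq C_def)
  qed
  have lhs: "(\<Prod>k\<in>{1..4}. cocycle_term F p identity_ideal (coord_section (Pow {1..p}) (mu F) theta_sign c) k
        (\<lambda>I\<in>Pow {1..p}. l (k, I))) = coord_section ?J ?m cocycle_sign (\<Prod>k\<in>{1..4}. C k) l"
    if l: "l \<in> cocycle.args" for l
  proof -
    have "cocycle_term F p identity_ideal (coord_section (Pow {1..p}) (mu F) theta_sign c) k
        (\<lambda>I\<in>Pow {1..p}. l (k, I)) = C k * (\<Prod>I\<in>Pow {1..p}. ?m (k, I) (coord (cocycle_sign (k, I)) (l (k, I))))"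
      if "k \<in> {1..4}" for k
    proof -
      have "(\<lambda>I\<in>Pow {1..p}. l (k, I)) \<in> tensor_args identity_ideal (Pow {1..p}) (\<lambda>I. cocycle_sign (k, I))"
        using l that by (auto simp: tensor_args_def PiE_iff)
      then show ?thesis
        unfolding cterm by (simp add: coord_section_def)
    qed
    then have "(\<Prod>k\<in>{1..4}. cocycle_term F p identity_ideal (coord_section (Pow {1..p}) (mu F) theta_sign c) k
        (\<lambda>I\<in>Pow {1..p}. l (k, I))) =
      (\<Prod>k\<in>{1..4}. C k * (\<Prod>I\<in>Pow {1..p}. ?m (k, I) (coord (cocycle_sign (k, I)) (l (k, I)))))"
      by (rule prod.cong[OF refl])
    then show ?thesis
      using l by (simp add: coord_section_def prod.distrib prod.cartesian_product case_prod_unfold)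
  qed
  have rhs: "canonical_section ?J ?m l = coord_section ?J ?m cocycle_sign 1 l" if "l \<in> cocycle.args" for l
    using that cocycle.canonical_section_eq[OF that cocycle_cancel[OF assms(1)]]
    by (simp add: coord_section_def)
  have "theta_cocycle F p identity_ideal (coord_section (Pow {1..p}) (mu F) theta_sign c) \<longleftrightarrow>
      (\<forall>l\<in>cocycle.args. coord_section ?J ?m cocycle_sign (\<Prod>k\<in>{1..4}. C k) l =
         coord_section ?J ?m cocycle_sign 1 l)"
    unfolding theta_cocycle_def using lhs rhs by simp
  also have "\<dots> \<longleftrightarrow> (\<Prod>k\<in>{1..4}. C k) = 1"
    using cocycle.generators_in_args cocycle.coord_section_generators by metis
  also have "{1..4::nat} = {1, 2, 3, 4}"
    by auto
  also have "(\<Prod>k\<in>{1, 2, 3, 4}. C k) = (?\<theta> 1 c * ?\<theta> 3 c) * (?\<theta> 2 c' * ?\<theta> 4 c')"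
    by (simp add: C_def ac_simps)
  also have "\<dots> = 1 \<longleftrightarrow> ?\<theta> 1 c * ?\<theta> 3 c = ?\<theta> 2 c * ?\<theta> 4 c"
  proof -
    have "x = y \<longleftrightarrow> x * z = 1" if "y * z = 1" for x y z :: "'a mfps"
    proof
      assume "x * z = 1"
      then have "x = x * (y * z)" "y = y * (x * z)"
        using that by simp_all
      then show "x = y"
        by (simp add: ac_simps)
    qed (use that in simp)
    moreover have "(?\<theta> 2 c * ?\<theta> 4 c) * (?\<theta> 2 c' * ?\<theta> 4 c') =
        (?\<theta> 2 c * ?\<theta> 2 c') * (?\<theta> 4 c * ?\<theta> 4 c')"
      by (simp only: ac_simps)
    ultimately show ?thesis
      unfolding inv by (metis mult_1)
  qed
  finally show ?thesis .
qed

text \<open>Constant term 1 provides an inverse of c in the same subring; it serves both as the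
  trivialization and as the c' of \<open>theta_cocycle_iff\<close>.\<close>

lemma theta_structures_iff:
  assumes "p \<ge> 1"
  shows "s \<in> theta_structures F p identity_ideal \<longleftrightarrow>
    (\<exists>c\<in>mfps_over {1..p}. s = coord_section (Pow {1..p}) (mu F) theta_sign c \<and>
       mfps_const_term c = 1 \<and>
       (\<forall>\<sigma>. \<sigma> permutes {1..p} \<longrightarrow> mfps_subst {1..p} (\<lambda>i. mfps_var (\<sigma> i)) c = c) \<and>
       (p > 1 \<longrightarrow>
          mfps_subst {1..p} (cocycle_map F 1) c * mfps_subst {1..p} (cocycle_map F 3) c =
          mfps_subst {1..p} (cocycle_map F 2) c * mfps_subst {1..p} (cocycle_map F 4) c))"
    (is "_ \<longleftrightarrow> (\<exists>c\<in>?A. s = ?s c \<and> ?rigid c \<and> ?symm c \<and> (p > 1 \<longrightarrow> ?cocycle c))")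
proof -
  interpret theta: tensor_data "mfps_over {1..p}" "Pow {1..p}" "mu F" theta_sign
    by (rule theta_data)
  have "?s c \<in> theta_structures F p identity_ideal \<longleftrightarrow>
      ?rigid c \<and> ?symm c \<and> (p > 1 \<longrightarrow> ?cocycle c)" if c: "c \<in> ?A" for c
  proof (cases "?rigid c")
    case True
    then obtain c' where c': "c' \<in> ?A" "c * c' = 1"
      using mfps_unit[of c 1] c by auto
    then have "theta_trivialization F p identity_ideal (?s c)"
      unfolding theta_trivialization_def using theta.trivialization_iff[OF c] by blast
    then show ?thesis
      using True theta_cocycle_iff[OF _ c c'] theta_symmetric_iff[of p c] theta_rigid_iff[OF assms, of c]
      by (auto simp: theta_structures_def)
  next
    case False
    then show ?thesis
      using theta_rigid_iff[OF assms, of c] by (auto simp: theta_structures_def)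
  qed
  moreover have "\<exists>c\<in>?A. s = ?s c" if "s \<in> theta_structures F p identity_ideal"
    using that theta.sections_eq
    by (auto simp: theta_structures_def theta_trivialization_def trivialization_def)
  ultimately show ?thesis
    by blast
qed

end

section \<open>The section \<open>s\<^sup>\<sharp>\<close>\<close>

lemma mfps_subst_zero [simp]: "finite V \<Longrightarrow> mfps_subst V (\<lambda>_. 0) f = mfps_const (mfps_const_term f)"
proof (rule mfps_eqI)
  fix \<alpha>
  assume V: "finite V"
  have "(\<Sum>\<beta>\<in>monomials V (size \<alpha>). mfps_nth f \<beta> * mfps_nth (\<Prod>i\<in>#\<beta>. 0) \<alpha>) =
      (\<Sum>\<beta>\<in>{{#}}. mfps_nth f \<beta> * mfps_nth (\<Prod>i\<in>#\<beta>. 0) \<alpha>)"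
    using V by (intro sum.mono_neutral_right finite_monomials)
      (auto simp: monomials_def image_mset_const_eq power_0_left)
  then show "mfps_nth (mfps_subst V (\<lambda>_. 0) f) \<alpha> = mfps_nth (mfps_const (mfps_const_term f)) \<alpha>"
    by (simp add: mfps_subst_def monomials_def) (simp add: mfps_const_def mfps_const_term_def)
qed

context formal_group_law
begin

text \<open>
  Put \<open>a\<^sub>2 = y\<close> and \<open>a\<^sub>i = 0\<close> for \<open>i \<noteq> 2\<close> in the cocycle condition: the first three terms become
  \<open>c(0, y, 0, \<dots>)\<close> and the fourth becomes \<open>c(0, \<dots>, 0) = 1\<close>.
\<close>

lemma theta_coordinate_axis:
  assumes "q \<ge> 2" and "mfps_const_term c = 1"
    and symm: "\<And>\<sigma>. \<sigma> permutes {1..q} \<Longrightarrow> mfps_subst {1..q} (\<lambda>i. mfps_var (\<sigma> i)) c = c"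
    and cocycle: "mfps_subst {1..q} (cocycle_map F 1) c * mfps_subst {1..q} (cocycle_map F 3) c =
          mfps_subst {1..q} (cocycle_map F 2) c * mfps_subst {1..q} (cocycle_map F 4) c"
  shows "mfps_nth c (replicate_mset k q) = (if k = 0 then 1 else 0)"
proof -
  \<comment> \<open>The value y is written x_q from the start, so that the result can be read at the
    powers of x_q.\<close>
  define axis :: "nat \<Rightarrow> nat \<Rightarrow> 'a mfps" where "axis = (\<lambda>j i. if i = j then mfps_var q else 0)"
  define S where "S = (\<lambda>i::nat. if i = 2 then {q} else {})"
  let ?h = "mfps_subst {0..q} (axis 2)"
  let ?e = "mfps_subst {1..q} (axis 2) c"
  have axis_S: "axis 2 i = fg_sum F (S i)" for i
    by (simp add: axis_def S_def)
  have hom: "ring_hom ?h"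
    by (rule ring_hom_mfps_subst) (auto simp: axis_def)
  have h: "?h (cocycle_map F k i) = (if 2 \<in> cocycle_sets k i then mfps_var q else 0)"
    if "i \<in> {1..q}" for k i
  proof -
    have "?h (cocycle_map F k i) = mfps_subst {0..q} (\<lambda>i. fg_sum F (S i)) (fg_sum F (cocycle_sets k i))"
      unfolding cocycle_map_eq by (rule mfps_subst_cong) (rule axis_S)
    also have "\<dots> = fg_sum F (\<Union>j\<in>cocycle_sets k i. S j)"
      using cocycle_sets_subset[OF that]
      by (intro mfps_subst_fg_sum) (auto simp: S_def disjoint_family_on_def)
    also have "(\<Union>j\<in>cocycle_sets k i. S j) = (if 2 \<in> cocycle_sets k i then {q} else {})"
      by (auto simp: S_def split: if_splits)
    finally show ?thesis
      by simp
  qed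
  have comp: "?h (mfps_subst {1..q} (cocycle_map F k) c) =
      mfps_subst {1..q} (\<lambda>i. if 2 \<in> cocycle_sets k i then mfps_var q else 0) c" for k
    by (subst mfps_subst_subst) (auto simp: axis_def h[unfolded axis_def] intro!: mfps_subst_cong)
  have "?h (mfps_subst {1..q} (cocycle_map F k) c) = ?e" if "k \<in> {1, 2, 3}" for k
    unfolding comp by (rule mfps_subst_cong) (use that in \<open>auto simp: cocycle_sets_def axis_def\<close>)
  moreover have "?h (mfps_subst {1..q} (cocycle_map F 4) c) = mfps_subst {1..q} (\<lambda>_. 0) c"
    unfolding comp by (rule mfps_subst_cong) (auto simp: cocycle_sets_def)
  ultimately have "?e * ?e = ?e"
    using arg_cong[OF cocycle, of ?h] assms(2) by (simp add: ring_hom.hom_mult[OF hom])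
  \<comment> \<open>The restriction e has the constant term 1 of c, so it is a unit, and being
    idempotent it equals 1.\<close>
  moreover obtain e' where "?e * e' = 1"
    using mfps_unit[of ?e 1 UNIV] assms(2) by (auto simp: mfps_over_def)
  ultimately have e: "?e = 1"
    by (metis mult.assoc mult.right_neutral)
  \<comment> \<open>Symmetry moves y from the second place, where the cocycle condition controls c,
    to the last.\<close>
  let ?\<sigma> = "transpose 2 q"
  have "mfps_subst {1..q} (axis q) c = mfps_subst {1..q} (\<lambda>i. mfps_subst {1..q} (axis 2) (mfps_var (?\<sigma> i))) c"
  proof (rule mfps_subst_cong)
    fix i assume "i \<in> {1..q}"
    then have "?\<sigma> i \<in> {1..q}"
      using assms(1) by (auto simp: transpose_def)
    then show "axis q i = mfps_subst {1..q} (axis 2) (mfps_var (?\<sigma> i))"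
      by (subst mfps_subst_var) (auto simp: axis_def transpose_def)
  qed
  also have "\<dots> = mfps_subst {1..q} (axis 2) (mfps_subst {1..q} (\<lambda>i. mfps_var (?\<sigma> i)) c)"
    by (rule mfps_subst_subst[symmetric]) (auto simp: axis_def)
  also have "\<dots> = 1"
    using symm[of ?\<sigma>] assms(1) e by (simp add: permutes_swap_id)
  finally show ?thesis
    using mfps_nth_subst_single[of "{1..q}" q c k] assms(1) by (auto simp: axis_def)
qed

end

section \<open>Base change of Laurent series\<close>

lemma fls_nth_base_change [simp]: "fls_nth (fls_base_change f) n = fls_const (fls_nth f n)"
  unfolding fls_base_change_def
  by (rule nth_Abs_fls_lower_bound[of "fls_subdegree f"]) simp

lemma fls_base_change_shift:
  "fls_base_change (fls_shift e (fps_to_fls f)) =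
    fls_shift e (fps_to_fls (Abs_fps (\<lambda>n. fls_const (fps_nth f n))))"
  by (rule fls_eqI) auto

lemma prod_fls_shift:
  "finite K \<Longrightarrow> (\<Prod>y\<in>K. fls_shift (e y) 1) = fls_shift (\<Sum>y\<in>K. e y) (1 :: 'a::comm_ring_1 fls)"
  by (induction K rule: finite_induct) (simp_all add: fls_times_both_shifted_simp)

locale punctured_formal_group = formal_group_law +
  fixes p :: nat
  assumes p: "p \<ge> 1"
begin

abbreviation "q \<equiv> p + 1"

abbreviation "F' \<equiv> punctured_group F"

text \<open>This makes the coordinate description of Theta^p-structures available over
  R((y)).\<close>

sublocale punctured: formal_group_law "punctured_group F"
  by unfold_locales (simp add: punctured_group_def fls_const.formal_group_map formal_group)

section \<open>The factors of Theta^(p+1) over the punctured group\<close>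

lemma fg_sum_punctured: "fg_sum F' I = mfps_map fls_const (fg_sum F I)"
proof -
  have "foldr (\<lambda>i. fg_add F' (mfps_var i)) xs 0 =
      mfps_map fls_const (foldr (\<lambda>i. fg_add F (mfps_var i)) xs 0)" for xs
    by (induction xs) (simp_all add: fls_const.mfps_map_fg_add punctured_group_def)
  then show ?thesis
    by (simp add: fg_sum_def)
qed

lemma cocycle_map_punctured: "cocycle_map F' k i = mfps_map fls_const (cocycle_map F k i)"
  by (simp add: cocycle_map_eq punctured.cocycle_map_eq fg_sum_punctured)

text \<open>The sum over such an I does not involve y, so the map is a base change. These factors
  make up the pull back of Theta^p.\<close>

lemma to_punctured_mu:
  assumes "I \<subseteq> {1..p}"
  shows "to_punctured q (mu F I f) = mu F' I (Abs_fps (\<lambda>n. fls_const (fps_nth f n)))"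
proof -
  have "finite I" "q \<notin> I"
    using assms finite_subset by auto
  then show ?thesis
    using to_punctured_eq_map[OF mu_over[of I I]]
    by (simp add: mu_def fls_const.mfps_map_fps_subst fg_sum_punctured)
qed

text \<open>The pull backs that make up Theta_star; \<open>star I\<close> is the extension to R((x))
  behind its canonical trivialization.\<close>

definition star_map :: "nat set \<Rightarrow> 'a fps \<Rightarrow> 'a fls mfps" where
  "star_map I = to_punctured q \<circ> mu F (insert q I)"

abbreviation "star I \<equiv> extend_map (star_map I)"

lemma star_map_X: "star_map I fps_X = to_punctured q (fg_sum F (insert q I))"
  by (simp add: star_map_def mu_def fps_subst_X)

lemma star_map_X_over:
  assumes "finite I" and "I \<subseteq> W" and "q \<notin> W"
  shows "star_map I fps_X \<in> mfps_over W"
  unfolding star_map_X using assms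
  by (intro to_punctured_over mfps_over_mono[OF _ fg_sum_over]) auto

text \<open>At x = 0 the sum reduces to the point y.\<close>

lemma const_term_star_map_X:
  assumes "finite I"
  shows "mfps_const_term (star_map I fps_X) = fls_X"
proof -
  have "Abs_fps (\<lambda>k. mfps_nth (fg_sum F (insert q I)) (replicate_mset k q)) = fps_X"
    using assms by (intro fps_ext) (simp add: fg_sum_nth_single)
  then show ?thesis
    by (simp add: star_map_X const_term_to_punctured)
qed

text \<open>The generator of the pulled back ideal has the unit y as constant term, so it is a unit
  and the ideal is the unit ideal. The inverse stays in the same variables.\<close>

lemma star_laurent_extension:
  assumes "finite I" and "I \<subseteq> W" and "q \<notin> W"
  obtains u where "laurent_extension (star_map I) u" and "u \<in> mfps_over W"
proof -
  have "mfps_const_term (star_map I fps_X) * fls_shift 1 1 = 1"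
    by (simp add: const_term_star_map_X assms fls_X_conv_shift_1 fls_times_both_shifted_simp)
  then obtain u where u: "star_map I fps_X * u = 1" "u \<in> mfps_over W"
    using mfps_unit star_map_X_over[OF assms] by metis
  have "ring_hom (star_map I)"
    unfolding star_map_def by (intro ring_hom_comp ring_hom_to_punctured ring_hom_mu)
  with u that show thesis
    by (simp add: laurent_extension_def laurent_extension_axioms_def)
qed

lemma star_mult: "finite I \<Longrightarrow> q \<notin> I \<Longrightarrow> star I (l * l') = star I l * star I l'"
  by (metis laurent_extension.extend_map_mult order_refl star_laurent_extension)

lemma star_prod: "finite I \<Longrightarrow> q \<notin> I \<Longrightarrow> star I (\<Prod>x\<in>A. l x) = (\<Prod>x\<in>A. star I (l x))"
  by (metis laurent_extension.extend_map_prod order_refl star_laurent_extension)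

lemma star_fps: "finite I \<Longrightarrow> q \<notin> I \<Longrightarrow> star I (fps_to_fls f) = star_map I f"
  by (metis laurent_extension.extend_map_fps order_refl star_laurent_extension)

lemma star_1: "finite I \<Longrightarrow> q \<notin> I \<Longrightarrow> star I 1 = 1"
  by (metis laurent_extension.extend_map_1 order_refl star_laurent_extension)

lemma star_shift_over:
  assumes "finite I" and "I \<subseteq> W" and "q \<notin> W" and "e = 1 \<or> e = -1"
  shows "star I (fls_shift e 1) \<in> mfps_over W"
proof -
  obtain u where u: "laurent_extension (star_map I) u" "u \<in> mfps_over W"
    using star_laurent_extension assms by metis
  have "star I (fls_shift 1 1) = u"
    using laurent_extension.extend_map_shift[OF u(1), of 1 1] laurent_extension.axioms(1)[OF u(1)]
    by (simp add: ring_hom.hom_1)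
  moreover have "star I (fls_shift (-1) 1) = star_map I fps_X"
    using laurent_extension.extend_map_fps[OF u(1), of fps_X] by (simp add: fls_X_conv_shift_1)
  ultimately show ?thesis
    using assms u star_map_X_over by auto
qed

text \<open>The image of x has constant term y, and that of x^(-1) is its inverse.\<close>

lemma const_term_star_shift:
  assumes "finite I" and "q \<notin> I" and "e = 1 \<or> e = -1"
  shows "mfps_const_term (star I (fls_shift e 1)) = fls_shift e 1"
proof -
  have X: "mfps_const_term (star I (fls_shift (-1) 1)) = fls_shift (-1) 1"
    using star_fps[OF assms(1,2), of fps_X] const_term_star_map_X[OF assms(1)]
    by (simp add: fls_X_conv_shift_1)
  have "star I (fls_shift (-1) 1) * star I (fls_shift 1 1) = 1"
    using assms by (simp add: fls_times_both_shifted_simp star_1 flip: star_mult)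
  from arg_cong[OF this, of mfps_const_term]
  have "fls_shift (-1) 1 * mfps_const_term (star I (fls_shift 1 1)) = 1"
    by (simp add: X)
  then have "fls_shift 1 1 * (fls_shift (-1) 1 * mfps_const_term (star I (fls_shift 1 1))) = fls_shift 1 1"
    by simp
  then have "mfps_const_term (star I (fls_shift 1 1)) = fls_shift 1 1"
    by (simp add: fls_times_both_shifted_simp flip: mult.assoc)
  with X show ?thesis
    using assms(3) by auto
qed

lemma star_shift_cancel:
  "finite I \<Longrightarrow> q \<notin> I \<Longrightarrow> star I (fls_shift e 1) * star I (fls_shift (- e) 1) = 1"
  by (simp add: fls_times_both_shifted_simp star_1 flip: star_mult)

text \<open>Factors with the same set are images under one multiplicative map \<open>star I\<close>
  of powers of x with total exponent 0.\<close>

lemma prod_star_eq_1: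
  assumes "finite Y" and "\<And>y. y \<in> Y \<Longrightarrow> finite (T y) \<and> q \<notin> T y"
    and "\<And>I. (\<Sum>y\<in>{y \<in> Y. T y = I}. e y) = 0"
  shows "(\<Prod>y\<in>Y. star (T y) (fls_shift (e y) 1)) = 1"
proof -
  have "(\<Prod>y\<in>Y. star (T y) (fls_shift (e y) 1)) =
      (\<Prod>I\<in>T ` Y. \<Prod>y\<in>{y \<in> Y. T y = I}. star (T y) (fls_shift (e y) 1))"
    by (rule prod.image_gen) (rule assms)
  also have "\<dots> = (\<Prod>I\<in>T ` Y. 1)"
  proof (rule prod.cong[OF refl])
    fix I assume "I \<in> T ` Y"
    then have I: "finite I" "q \<notin> I"
      using assms(2) by auto
    have "(\<Prod>y\<in>{y \<in> Y. T y = I}. star (T y) (fls_shift (e y) 1)) =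
        (\<Prod>y\<in>{y \<in> Y. T y = I}. star I (fls_shift (e y) 1))"
      by (rule prod.cong) auto
    also have "\<dots> = star I (\<Prod>y\<in>{y \<in> Y. T y = I}. fls_shift (e y) 1)"
      by (rule star_prod[OF I, symmetric])
    also have "\<dots> = 1"
      using assms(1,3) I by (simp add: prod_fls_shift star_1)
    finally show "(\<Prod>y\<in>{y \<in> Y. T y = I}. star (T y) (fls_shift (e y) 1)) = 1" .
  qed
  finally show ?thesis
    by simp
qed

text \<open>As \<open>fls_shift e 1\<close> is x^(-e), the product is the image of the standard
  generator of Theta_star under its canonical trivialization.\<close>

definition sharp_coord :: "'a mfps \<Rightarrow> 'a fls mfps" where
  "sharp_coord c = to_punctured q c * (\<Prod>I\<in>Pow {1..p}. star I (fls_shift (theta_sign I) 1))"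

lemma finite_subset_p: "I \<in> Pow {1..p} \<Longrightarrow> finite I \<and> q \<notin> I"
  using finite_subset by auto

lemma Suc_interval: "{1..p + 1} = insert q {1..p}"
  by auto

lemma sharp_coord_over:
  assumes "c \<in> mfps_over {1..p + 1}"
  shows "sharp_coord c \<in> mfps_over {1..p}"
  unfolding sharp_coord_def using assms theta_sign_cases
  by (intro mfps_over_mult to_punctured_over mfps_over_prod star_shift_over)
    (auto simp: Suc_interval[simplified] finite_subset)

text \<open>Each argument is its coordinate times a generator. The sign changes with the insertion
  of q, so the generators leave the inverse of the product in \<open>sharp_coord\<close>.\<close>

lemma theta_star_canonical_eq:
  assumes l: "l \<in> tensor_args identity_ideal (Pow {1..p + 1}) theta_sign"
  shows "theta_star_canonical F p (\<lambda>I\<in>Pow {1..p}. l (insert q I)) =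
    (\<Prod>I\<in>Pow {1..p}. to_punctured q (mu F (insert q I) (coord (theta_sign (insert q I)) (l (insert q I))))) *
    (\<Prod>I\<in>Pow {1..p}. star I (fls_shift (- theta_sign I) 1))"
proof -
  interpret theta: tensor_data "mfps_over {1..p + 1}" "Pow {1..p + 1}" "mu F" theta_sign
    by (rule theta_data)
  have "star I (l (insert q I)) =
      to_punctured q (mu F (insert q I) (coord (theta_sign (insert q I)) (l (insert q I)))) *
      star I (fls_shift (- theta_sign I) 1)" if I: "I \<in> Pow {1..p}" for I
  proof -
    let ?f = "coord (theta_sign (insert q I)) (l (insert q I))"
    have "insert q I \<in> Pow {1..p + 1}"
      using I by auto
    from theta.args_coord[OF l this]
    have "l (insert q I) = fps_to_fls ?f * fls_shift (theta_sign (insert q I)) 1"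
      by (simp add: fls_shifted_times_simps)
    moreover have "theta_sign (insert q I) = - theta_sign I"
      using finite_subset_p[OF I] by (simp add: theta_sign_insert)
    ultimately show ?thesis
      using finite_subset_p[OF I] by (metis star_mult star_fps star_map_def comp_apply)
  qed
  then show ?thesis
    by (simp add: theta_star_canonical_def star_map_def prod.distrib)
qed

text \<open>Both sides of the equation that defines \<open>sharp\<close> are multiples of one form P
  with value 1 on the generators. So the equation for the coefficient d of t says that d E is the
  image of c, and the unit E can be divided out.\<close>

lemma sharp_coord_section:
  assumes c: "c \<in> mfps_over {1..p + 1}"
  shows "sharp F p (coord_section (Pow {1..p + 1}) (mu F) theta_sign c) =
    coord_section (Pow {1..p}) (mu F') theta_sign (sharp_coord c)"
proof -
  let ?J = "Pow {1..p + 1}"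
  interpret theta: tensor_data "mfps_over {1..p + 1}" ?J "mu F" theta_sign
    by (rule theta_data)
  interpret theta': tensor_data "mfps_over {1..p}" "Pow {1..p}" "mu F'" theta_sign
    by (rule punctured.theta_data)
  define P where "P = (\<lambda>l. \<Prod>I\<in>?J. to_punctured q (mu F I (coord (theta_sign I) (l I))))"
  define E where "E = (\<Prod>I\<in>Pow {1..p}. star I (fls_shift (- theta_sign I) 1))"
  have lhs: "pullback_section (to_punctured q) identity_ideal ?J theta_sign
      (coord_section ?J (mu F) theta_sign c) l = to_punctured q c * P l" if "l \<in> theta.args" for l
    unfolding pullback_coord_section[OF ring_hom_to_punctured]
    using that by (simp add: coord_section_def P_def)
  have rhs: "coord_section (Pow {1..p}) (mu F') theta_sign d (\<lambda>I\<in>Pow {1..p}. fls_base_change (l I)) *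
      theta_star_canonical F p (\<lambda>I\<in>Pow {1..p}. l (insert q I)) = d * E * P l"
    if l: "l \<in> theta.args" for l d
  proof -
    let ?bc = "\<lambda>I\<in>Pow {1..p}. fls_base_change (l I)"
    have bc: "fls_base_change (l I) = fls_shift (theta_sign I)
        (fps_to_fls (Abs_fps (\<lambda>n. fls_const (fps_nth (coord (theta_sign I) (l I)) n))))"
      if "I \<in> Pow {1..p}" for I
    proof -
      have "I \<in> ?J"
        using that by auto
      then show ?thesis
        by (subst (1) theta.args_coord[OF l, of I, symmetric]) (simp_all only: fls_base_change_shift)
    qed
    then have "?bc \<in> theta'.args"
      using theta_sign_cases by (auto simp: tensor_args_def)
    then have "coord_section (Pow {1..p}) (mu F') theta_sign d ?bc =
        d * (\<Prod>I\<in>Pow {1..p}. mu F' I (coord (theta_sign I) (fls_base_change (l I))))"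
      by (simp add: coord_section_def)
    also have "(\<Prod>I\<in>Pow {1..p}. mu F' I (coord (theta_sign I) (fls_base_change (l I)))) =
        (\<Prod>I\<in>Pow {1..p}. to_punctured q (mu F I (coord (theta_sign I) (l I))))"
      by (rule prod.cong[OF refl]) (simp only: bc coord_shift to_punctured_mu Pow_iff)
    finally have 1: "coord_section (Pow {1..p}) (mu F') theta_sign d ?bc =
        d * (\<Prod>I\<in>Pow {1..p}. to_punctured q (mu F I (coord (theta_sign I) (l I))))" .
    \<comment> \<open>The factors of Theta^(p+1) are sorted into pairs, one from Theta^p and one
      from Theta_star.\<close>
    have 2: "P l = (\<Prod>I\<in>Pow {1..p}. to_punctured q (mu F I (coord (theta_sign I) (l I))) *
        to_punctured q (mu F (insert q I) (coord (theta_sign (insert q I)) (l (insert q I)))))"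
      unfolding P_def Suc_interval by (subst prod.Pow_insert) auto
    show ?thesis
      unfolding 1 2 theta_star_canonical_eq[OF l] by (simp add: E_def prod.distrib ac_simps)
  qed
  have E: "(\<Prod>I\<in>Pow {1..p}. star I (fls_shift (theta_sign I) 1)) * E = 1"
    unfolding E_def prod.distrib[symmetric]
    by (rule prod.neutral) (use finite_subset_p star_shift_cancel in blast)
  have eq: "(\<forall>l\<in>theta.args. pullback_section (to_punctured q) identity_ideal ?J theta_sign
      (coord_section ?J (mu F) theta_sign c) l =
      coord_section (Pow {1..p}) (mu F') theta_sign d (\<lambda>I\<in>Pow {1..p}. fls_base_change (l I)) *
      theta_star_canonical F p (\<lambda>I\<in>Pow {1..p}. l (insert q I))) \<longleftrightarrow> d = sharp_coord c" for d
  proof -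
    have "P (generators ?J theta_sign) = 1"
    proof -
      have "P (generators ?J theta_sign) = to_punctured q
          (\<Prod>I\<in>?J. mu F I (coord (theta_sign I) (generators ?J theta_sign I)))"
        by (simp only: P_def to_punctured.hom_prod)
      then show ?thesis
        by (simp only: theta.prod_coord_generators to_punctured.hom_1)
    qed
    then have "(\<forall>l\<in>theta.args. to_punctured q c * P l = d * E * P l) \<longleftrightarrow> to_punctured q c = d * E"
      using theta.generators_in_args by (metis mult.right_neutral)
    also have "\<dots> \<longleftrightarrow> d = sharp_coord c"
    proof
      assume "to_punctured q c = d * E"
      then have "sharp_coord c = d * ((\<Prod>I\<in>Pow {1..p}. star I (fls_shift (theta_sign I) 1)) * E)"
        by (simp only: sharp_coord_def ac_simps)
      then show "d = sharp_coord c"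
        by (simp only: E mult_1_right)
    next
      assume "d = sharp_coord c"
      then have "d * E = to_punctured q c *
          ((\<Prod>I\<in>Pow {1..p}. star I (fls_shift (theta_sign I) 1)) * E)"
        by (simp only: sharp_coord_def ac_simps)
      then show "to_punctured q c = d * E"
        by (simp only: E mult_1_right)
    qed
    finally show ?thesis
      using lhs rhs by simp
  qed
  show ?thesis
    unfolding sharp_def theta_sections_def theta'.sections_eq
  proof (rule the_equality, goal_cases)
    case 1
    show ?case
      using eq[of "sharp_coord c"] sharp_coord_over[OF c] by blast
  next
    case (2 t)
    then obtain d where d: "t = coord_section (Pow {1..p}) (mu F') theta_sign d"
      by blast
    have "d = sharp_coord c"
      using 2[THEN conjunct2] unfolding d eq .
    with d show ?case
      by (simp only:)
  qed
qed

text \<open>The form in which \<open>to_punctured_subst\<close> applies to permutations and cocycle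
  maps alike.\<close>

lemma to_punctured_subst_fg_sum:
  assumes "c \<in> mfps_over {1..p + 1}" and "finite W" and "q \<notin> W"
    and S: "\<And>i. i \<in> {1..p} \<Longrightarrow> S i \<subseteq> W"
    and b: "\<And>i. i \<in> {1..p} \<Longrightarrow> b i = fg_sum F (S i)" "b q = mfps_var q"
  shows "mfps_subst {1..p} (\<lambda>i. mfps_map fls_const (b i)) (to_punctured q c) =
    to_punctured q (mfps_subst {1..p + 1} b c)"
  unfolding Suc_interval
proof (rule to_punctured_subst[symmetric])
  show "b i \<in> mfps_over W" if "i \<in> {1..p}" for i
    using b(1)[OF that] mfps_over_mono[OF S[OF that] fg_sum_over] finite_subset[OF S[OF that] assms(2)]
    by simp
qed (use assms in auto)

text \<open>The substitution carries the map for I to the map for the union, and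
  \<open>extend_map\<close> commutes with ring maps.\<close>

lemma star_subst_fg_sum:
  assumes I: "I \<subseteq> {1..p}" and "finite W" and "q \<notin> W"
    and S: "\<And>i. i \<in> {1..p} \<Longrightarrow> S i \<subseteq> W" "disjoint_family_on S {1..p}"
    and b: "\<And>i. i \<in> {1..p} \<Longrightarrow> b i = fg_sum F (S i)" "b q = mfps_var q"
  shows "mfps_subst {1..p} (\<lambda>i. mfps_map fls_const (b i)) (star I l) = star (\<Union>i\<in>I. S i) l"
proof -
  let ?h = "mfps_subst {1..p} (\<lambda>i. mfps_map fls_const (b i))"
  \<comment> \<open>The last point y is kept, as one more set disjoint from the others.\<close>
  define S' where "S' = S(q := {q})"
  have "finite I" "q \<notin> I"
    using I finite_subset by auto
  then obtain u where u: "laurent_extension (star_map I) u"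
    using star_laurent_extension by blast
  have hom: "ring_hom ?h"
    by (rule ring_hom_mfps_subst) (use b in auto)
  have mu: "mfps_subst {1..p + 1} b \<circ> mu F (insert q I) = mu F (insert q (\<Union>i\<in>I. S i))"
  proof -
    have fin: "finite (S i)" if "i \<in> {1..p}" for i
      using S(1)[OF that] assms(2) finite_subset by blast
    have "disjoint_family_on S' {1..p + 1}"
      unfolding disjoint_family_on_def
    proof (intro ballI impI)
      fix i j assume "i \<in> {1..p + 1}" "j \<in> {1..p + 1}" "i \<noteq> j"
      then consider "i \<in> {1..p}" "j \<in> {1..p}" | "i \<in> {1..p}" "j = q" | "i = q" "j \<in> {1..p}"
        by force
      then show "S' i \<inter> S' j = {}"
        using S assms(3) \<open>i \<noteq> j\<close> by cases (auto simp: S'_def disjoint_family_on_def)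
    qed
    moreover have "finite (S' i)" "b i = fg_sum F (S' i)" if "i \<in> {1..p + 1}" for i
      using that b fin by (auto simp: S'_def)
    ultimately have "mfps_subst {1..p + 1} b \<circ> mu F (insert q I) = mu F (\<Union>i\<in>insert q I. S' i)"
      using I by (intro mfps_subst_mu) auto
    also have "(\<Union>i\<in>insert q I. S' i) = insert q (\<Union>i\<in>I. S i)"
      using \<open>q \<notin> I\<close> by (auto simp: S'_def)
    finally show ?thesis .
  qed
  have "?h (star_map I f) = star_map (\<Union>i\<in>I. S i) f" for f
  proof -
    have "mu F (insert q I) f \<in> mfps_over {1..p + 1}"
      using I finite_subset[OF I] by (intro mu_over) auto
    then have "?h (star_map I f) = to_punctured q ((mfps_subst {1..p + 1} b \<circ> mu F (insert q I)) f)"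
      using to_punctured_subst_fg_sum[of "mu F (insert q I) f" W S b] assms
      by (simp add: star_map_def)
    then show ?thesis
      unfolding mu by (simp add: star_map_def)
  qed
  then have "?h \<circ> star_map I = star_map (\<Union>i\<in>I. S i)"
    by auto
  then show ?thesis
    using laurent_extension.extend_map_comp[OF u hom, of l] by simp
qed

section \<open>Rigidity, symmetry and the cocycle condition for s^sharp\<close>

lemma const_term_sharp_coord:
  assumes "\<And>k. mfps_nth c (replicate_mset k q) = (if k = 0 then 1 else 0)"
  shows "mfps_const_term (sharp_coord c) = 1"
proof -
  have "Abs_fps (\<lambda>k. mfps_nth c (replicate_mset k q)) = 1"
    using assms by (intro fps_ext) simp
  then have "mfps_const_term (sharp_coord c) =
      (\<Prod>I\<in>Pow {1..p}. mfps_const_term (star I (fls_shift (theta_sign I) 1)))"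
    by (simp add: sharp_coord_def const_term_to_punctured)
  also have "\<dots> = (\<Prod>I\<in>Pow {1..p}. fls_shift (theta_sign I) 1)"
    using finite_subset_p theta_sign_cases by (intro prod.cong refl const_term_star_shift) auto
  also have "\<dots> = fls_shift (\<Sum>I\<in>Pow {1..p}. theta_sign I) 1"
    by (rule prod_fls_shift) simp
  finally show ?thesis
    using sum_theta_sign[OF p] by simp
qed

lemma sharp_coord_symmetric:
  assumes c: "c \<in> mfps_over {1..p + 1}" and \<sigma>: "\<sigma> permutes {1..p}"
    and symm: "mfps_subst {1..p + 1} (\<lambda>i. mfps_var (\<sigma> i)) c = c"
  shows "mfps_subst {1..p} (\<lambda>i. mfps_var (\<sigma> i)) (sharp_coord c) = sharp_coord c"
proof -
  let ?h = "mfps_subst {1..p} (\<lambda>i. mfps_map fls_const (mfps_var (\<sigma> i) :: 'a mfps))"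
  have S: "{\<sigma> i} \<subseteq> {1..p}" if "i \<in> {1..p}" for i
    using permutes_in_image[OF \<sigma>] that by simp
  \<comment> \<open>A permutation of the first p places fixes y.\<close>
  have q: "mfps_var (\<sigma> q) = (mfps_var q :: 'a mfps)"
    using permutes_not_in[OF \<sigma>, of q] by simp
  have "?h (sharp_coord c) = ?h (to_punctured q c) *
      (\<Prod>I\<in>Pow {1..p}. ?h (star I (fls_shift (theta_sign I) 1)))"
    by (simp add: sharp_coord_def mfps_subst_mult mfps_subst_prod)
  also have "?h (to_punctured q c) = to_punctured q c"
    using to_punctured_subst_fg_sum[OF c, where W = "{1..p}" and S = "\<lambda>i. {\<sigma> i}"
        and b = "\<lambda>i. mfps_var (\<sigma> i)"] S q symm by simp
  also have "(\<Prod>I\<in>Pow {1..p}. ?h (star I (fls_shift (theta_sign I) 1))) =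
      (\<Prod>I\<in>Pow {1..p}. star (\<sigma> ` I) (fls_shift (theta_sign (\<sigma> ` I)) 1))"
  proof (rule prod.cong[OF refl])
    fix I assume "I \<in> Pow {1..p}"
    moreover have "disjoint_family_on (\<lambda>i. {\<sigma> i}) {1..p}"
      using permutes_inj[OF \<sigma>] by (auto simp: disjoint_family_on_def inj_def)
    ultimately have "?h (star I (fls_shift (theta_sign I) 1)) =
        star (\<Union>i\<in>I. {\<sigma> i}) (fls_shift (theta_sign I) 1)"
      using S q by (intro star_subst_fg_sum[where W = "{1..p}"]) auto
    moreover have "theta_sign (\<sigma> ` I) = theta_sign I"
      using permutes_inj[OF \<sigma>] by (simp add: theta_sign_def card_image inj_on_subset)
    ultimately show "?h (star I (fls_shift (theta_sign I) 1)) =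
        star (\<sigma> ` I) (fls_shift (theta_sign (\<sigma> ` I)) 1)"
      by (simp add: UNION_singleton_eq_range)
  qed
  also have "\<dots> = (\<Prod>I\<in>Pow {1..p}. star I (fls_shift (theta_sign I) 1))"
    by (rule prod.reindex_bij_betw[OF bij_betw_Pow[OF permutes_imp_bij[OF \<sigma>]]])
  finally show ?thesis
    by (simp add: sharp_coord_def)
qed

text \<open>The image of c satisfies the condition by assumption on c. The unit factors are pulled
  back to P 1, ..., P 4 with inverses Q 1, ..., Q 4, and it remains to see that P 1 P 3 = P 2 P
  4.\<close>

lemma sharp_coord_cocycle:
  assumes c: "c \<in> mfps_over {1..p + 1}" and "p > 1"
    and cocycle: "mfps_subst {1..p + 1} (cocycle_map F 1) c * mfps_subst {1..p + 1} (cocycle_map F 3) c =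
          mfps_subst {1..p + 1} (cocycle_map F 2) c * mfps_subst {1..p + 1} (cocycle_map F 4) c"
  shows "mfps_subst {1..p} (cocycle_map F' 1) (sharp_coord c) *
      mfps_subst {1..p} (cocycle_map F' 3) (sharp_coord c) =
    mfps_subst {1..p} (cocycle_map F' 2) (sharp_coord c) *
      mfps_subst {1..p} (cocycle_map F' 4) (sharp_coord c)"
proof -
  let ?\<theta> = "\<lambda>k. mfps_subst {1..p + 1} (cocycle_map F k)"
  let ?\<theta>' = "\<lambda>k. mfps_subst {1..p} (cocycle_map F' k)"
  have S: "cocycle_sets k i \<subseteq> {0..p}" if "i \<in> {1..p}" for k i
    using cocycle_sets_subset[OF that] .
  \<comment> \<open>From p > 1 the index q is at least 3, and the cocycle maps alter only the
    components 1 and 2.\<close>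
  have q: "cocycle_map F k q = mfps_var q" for k
    using assms(2) by (simp add: cocycle_map_def)
  define P Q where
    "P = (\<lambda>k. \<Prod>I\<in>Pow {1..p}. star (cocycle_union (k, I)) (fls_shift (theta_sign I) 1))" and
    "Q = (\<lambda>k. \<Prod>I\<in>Pow {1..p}. star (cocycle_union (k, I)) (fls_shift (- theta_sign I) 1))"
  have union: "finite (cocycle_union y) \<and> q \<notin> cocycle_union y" if "y \<in> UNIV \<times> Pow {1..p}" for y
  proof -
    have "cocycle_union y \<subseteq> {0..p}"
      using that S unfolding cocycle_union_def by fastforce
    then show ?thesis
      using finite_subset by auto
  qed
  have \<theta>': "?\<theta>' k (sharp_coord c) = to_punctured q (?\<theta> k c) * P k" for k
  proof -
    have "?\<theta>' k (sharp_coord c) = ?\<theta>' k (to_punctured q c) *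
        (\<Prod>I\<in>Pow {1..p}. ?\<theta>' k (star I (fls_shift (theta_sign I) 1)))"
      by (simp add: sharp_coord_def mfps_subst_mult mfps_subst_prod)
    also have "?\<theta>' k (to_punctured q c) = to_punctured q (?\<theta> k c)"
      unfolding cocycle_map_punctured
      by (rule to_punctured_subst_fg_sum[OF c, where W = "{0..p}" and S = "cocycle_sets k"])
        (use S q in \<open>auto simp: cocycle_map_eq\<close>)
    also have "(\<Prod>I\<in>Pow {1..p}. ?\<theta>' k (star I (fls_shift (theta_sign I) 1))) = P k"
      unfolding P_def cocycle_union_def cocycle_map_punctured case_prod_conv
      by (rule prod.cong[OF refl], rule star_subst_fg_sum[where W = "{0..p}"])
        (use S disjoint_cocycle_sets q in \<open>auto simp: cocycle_map_eq\<close>)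
    finally show ?thesis .
  qed
  have PQ: "P k * Q k = 1" for k
    unfolding P_def Q_def prod.distrib[symmetric]
    by (rule prod.neutral) (use union star_shift_cancel in blast)
  \<comment> \<open>The signs over each set T cancel as in the cocycle condition, now as exponents
    of the units attached to T.\<close>
  have "(\<Prod>y\<in>{1..4} \<times> Pow {1..p}. star (cocycle_union y) (fls_shift (cocycle_sign y) 1)) = 1"
    using assms(2) union sum_cocycle_sign_fibre by (intro prod_star_eq_1) auto
  also have "(\<Prod>y\<in>{1..4} \<times> Pow {1..p}. star (cocycle_union y) (fls_shift (cocycle_sign y) 1)) =
      (\<Prod>k\<in>{1..4}. \<Prod>I\<in>Pow {1..p}. star (cocycle_union (k, I)) (fls_shift (cocycle_sign (k, I)) 1))"
    by (simp add: prod.cartesian_product)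
  also have "\<dots> = (\<Prod>k\<in>{1..4}. if odd k then P k else Q k)"
    by (rule prod.cong[OF refl]) (simp add: P_def Q_def cocycle_sign_eq)
  finally have "(\<Prod>k\<in>{1..4}. if odd k then P k else Q k) = 1" .
  moreover have "{1..4::nat} = {1, 2, 3, 4}"
    by auto
  ultimately have prod: "P 1 * P 3 * (Q 2 * Q 4) = 1"
    by (simp add: ac_simps)
  have "P 1 * P 3 = P 1 * P 3 * ((P 2 * Q 2) * (P 4 * Q 4))"
    by (simp add: PQ)
  also have "\<dots> = P 1 * P 3 * (Q 2 * Q 4) * (P 2 * P 4)"
    by (simp only: ac_simps)
  also have "\<dots> = P 2 * P 4"
    by (simp only: prod mult_1)
  finally have P: "P 1 * P 3 = P 2 * P 4" .
  have "?\<theta>' 1 (sharp_coord c) * ?\<theta>' 3 (sharp_coord c) =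
      to_punctured q (?\<theta> 1 c * ?\<theta> 3 c) * (P 1 * P 3)"
    by (simp only: \<theta>' to_punctured.hom_mult ac_simps)
  also have "\<dots> = to_punctured q (?\<theta> 2 c * ?\<theta> 4 c) * (P 2 * P 4)"
    by (simp only: cocycle P)
  also have "\<dots> = ?\<theta>' 2 (sharp_coord c) * ?\<theta>' 4 (sharp_coord c)"
    by (simp only: \<theta>' to_punctured.hom_mult ac_simps)
  finally show ?thesis .
qed

lemma sharp_in_theta_structures:
  assumes "s \<in> theta_structures F (p + 1) identity_ideal"
  shows "sharp F p s \<in> theta_structures F' p identity_ideal"
proof -
  \<comment> \<open>As p + 1 > 1, the cocycle condition on c is available even for p = 1, where it
    serves the rigidity of s^sharp.\<close>
  obtain c where c: "c \<in> mfps_over {1..p + 1}"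
    and s: "s = coord_section (Pow {1..p + 1}) (mu F) theta_sign c"
    and rigid: "mfps_const_term c = 1"
    and symm: "\<And>\<sigma>. \<sigma> permutes {1..p + 1} \<Longrightarrow> mfps_subst {1..p + 1} (\<lambda>i. mfps_var (\<sigma> i)) c = c"
    and cocycle: "mfps_subst {1..p + 1} (cocycle_map F 1) c * mfps_subst {1..p + 1} (cocycle_map F 3) c =
      mfps_subst {1..p + 1} (cocycle_map F 2) c * mfps_subst {1..p + 1} (cocycle_map F 4) c"
    using assms p unfolding theta_structures_iff[of "p + 1", OF le_add2] by (meson less_add_same_cancel2 order_less_le_trans zero_less_one)
  have "\<sigma> permutes {1..p + 1}" if "\<sigma> permutes {1..p}" for \<sigma>
    using that by (rule permutes_subset) auto
  then show ?thesis
    unfolding s sharp_coord_section[OF c] punctured.theta_structures_iff[OF p]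
    using sharp_coord_over[OF c] const_term_sharp_coord[OF theta_coordinate_axis[OF _ rigid symm cocycle]]
      sharp_coord_symmetric[OF c _ symm] sharp_coord_cocycle[OF c _ cocycle] p
    by (intro bexI[of _ "sharp_coord c"]) auto
qed

end

theorem proposition4p8:
  fixes F :: "'a::comm_ring_1 mfps" and p :: nat
  assumes "formal_group F" and "p \<ge> 1"
  shows "(\<forall>s. s \<in> theta_structures F (p + 1) identity_ideal \<longrightarrow>
             sharp F p s \<in> theta_structures (punctured_group F) p identity_ideal) \<and>
         sharp F p \<in> theta_structures F (p + 1) identity_ideal
                       \<rightarrow> theta_structures (punctured_group F) p identity_ideal"
proof -
  interpret punctured_formal_group F p
    using assms by unfold_locales
  show ?thesis
    using sharp_in_theta_structures by blast
qed

end
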